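(* For any $\epsilon>0$, there is a polynomial time two-sided distribution-free adaptive algorithm for $\epsilon$-testing $k$-Linear that makes $\tilde O(k/\epsilon)$ queries.
   Context: Boolean functions $f:\{0,1\}^n\to\{0,1\}$ are accessed through a membership-query oracle that returns $f(x)$ for a queried $x$. For a distribution $\mathcal D$ on $\{0,1\}^n$, $f$ is $\epsilon$-far from a class $C$ with respect to $\mathcal D$ if $\Pr_{x\sim\mathcal D}[f(x)\neq g(x)]\ge\epsilon$ for every $g\in C$. A two-sided distribution-free adaptive algorithm for $\epsilon$-testing $C$ is a randomized algorithm that, given $\epsilon$, membership-query access to an arbitrary $f$, and an oracle returning independent samples from an arbitrary unknown distribution $\mathcal D$ on $\{0,1\}^n$, chooses queries possibly adaptively and, for every $\mathcal D$, accepts with probability at least $2/3$ if $f\in C$ and rejects with probability at least $2/3$ if $f$ is $\epsilon$-far from every function in $C$ with respect to $\mathcal D$. Queries count membership queries and samples. $\tilde O(T)$ means $O(T\cdot\mathrm{poly}(\log T))$. $k$-Linear is the class of Boolean functions that are sums over the field $\mathbb F_2$ of at most $k$ variables. *)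

theory Defs
  imports "HOL-Probability.Probability" "HOL-Library.Z2"
begin

section \<open>Boolean functions, \<open>k\<close>-Linear, and distance with respect to a distribution\<close>

text \<open>
  The type \<^typ>\<open>bit\<close> is the field with two elements. A Boolean function on \<open>{0,1}\<^sup>n\<close> is a function
  on bit lists of which only the values on lists of length \<open>n\<close> matter.
\<close>

type_synonym point = "bit list"
type_synonym boolfun = "point \<Rightarrow> bit"

definition cube :: "nat \<Rightarrow> point set" where
  "cube n = {x. length x = n}"

definition k_linear :: "nat \<Rightarrow> nat \<Rightarrow> boolfun set" where
  "k_linear n k =
     {f. \<exists>S \<subseteq> {..<n}. card S \<le> k \<and> (\<forall>x \<in> cube n. f x = (\<Sum>i\<in>S. x ! i))}"

definition eps_far :: "real \<Rightarrow> point pmf \<Rightarrow> boolfun set \<Rightarrow> boolfun \<Rightarrow> bool" where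
  "eps_far \<epsilon> D C f \<longleftrightarrow> (\<forall>g \<in> C. measure_pmf.prob D {x. f x \<noteq> g x} \<ge> \<epsilon>)"


section \<open>Randomized oracle programs\<close>

text \<open>
  The model of computation is a structured random access machine: finitely many registers and
  one-dimensional arrays holding natural numbers, with unit cost per step. The only arithmetic is
  addition and truncated subtraction, so after \<open>t\<close> steps every number has \<open>O(t)\<close> bits more than
  the input, and unit-cost time is polynomially related to Turing machine time.
  (Multiplication as a primitive would break this.)
\<close>

type_synonym vname = string

datatype aexp =
    Num nat
  | Var vname
  | Arr vname aexp
  | Plus aexp aexp
  | Monus aexp aexp

datatype bexp =
    Less aexp aexp
  | Neg bexp
  | Conj bexp bexp

datatype com =
    SKIP
  | Assign vname aexp
  | Store vname aexp aexp
  | Seq com com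
  | Cond bexp com com
  | While bexp com
  | Flip vname
  | Query vname vname
  | Sample vname

text \<open>The counter \<open>queries\<close> cannot be accessed by programs.\<close>

record state =
  regs :: "vname \<Rightarrow> nat"
  arrs :: "vname \<Rightarrow> nat \<Rightarrow> nat"
  queries :: nat

fun aval :: "aexp \<Rightarrow> state \<Rightarrow> nat" where
  "aval (Num m) s = m"
| "aval (Var v) s = regs s v"
| "aval (Arr a e) s = arrs s a (aval e s)"
| "aval (Plus e1 e2) s = aval e1 s + aval e2 s"
| "aval (Monus e1 e2) s = aval e1 s - aval e2 s"

fun bval :: "bexp \<Rightarrow> state \<Rightarrow> bool" where
  "bval (Less e1 e2) s \<longleftrightarrow> aval e1 s < aval e2 s"
| "bval (Neg b) s \<longleftrightarrow> \<not> bval b s"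
| "bval (Conj b1 b2) s \<longleftrightarrow> bval b1 s \<and> bval b2 s"

definition set_reg :: "vname \<Rightarrow> nat \<Rightarrow> state \<Rightarrow> state" where
  "set_reg v m s = s\<lparr>regs := (regs s)(v := m)\<rparr>"

definition set_cell :: "vname \<Rightarrow> nat \<Rightarrow> nat \<Rightarrow> state \<Rightarrow> state" where
  "set_cell a i m s = s\<lparr>arrs := (arrs s)(a := (arrs s a)(i := m))\<rparr>"

definition count_query :: "state \<Rightarrow> state" where
  "count_query s = s\<lparr>queries := Suc (queries s)\<rparr>"

text \<open>The point held by the cells \<open>0, ..., n - 1\<close> of an array; \<^const>\<open>of_nat\<close> reduces modulo 2.\<close>

definition get_point :: "nat \<Rightarrow> vname \<Rightarrow> state \<Rightarrow> point" where
  "get_point n a s = map (\<lambda>i. of_nat (arrs s a i)) [0..<n]"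

definition put_point :: "nat \<Rightarrow> vname \<Rightarrow> point \<Rightarrow> state \<Rightarrow> state" where
  "put_point n a x s =
     s\<lparr>arrs := (arrs s)(a := (\<lambda>i. if i < n then of_bit (x ! i) else arrs s a i))\<rparr>"

text \<open>
  One step of a program on \<open>{0,1}\<^sup>n\<close> with membership oracle \<open>f\<close> and sampling oracle \<open>D\<close>.
  \<^const>\<open>Flip\<close> tosses a fair coin, \<open>Query v a\<close> asks for the value of \<open>f\<close> at the point in array \<open>a\<close>,
  and \<open>Sample a\<close> writes a fresh sample from \<open>D\<close> to array \<open>a\<close>.
  A program has halted when it has become \<^const>\<open>SKIP\<close>.
\<close>

fun step :: "nat \<Rightarrow> boolfun \<Rightarrow> point pmf \<Rightarrow> com \<Rightarrow> state \<Rightarrow> (com \<times> state) pmf" where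
  "step n f D SKIP s = return_pmf (SKIP, s)"
| "step n f D (Assign v e) s = return_pmf (SKIP, set_reg v (aval e s) s)"
| "step n f D (Store a i e) s = return_pmf (SKIP, set_cell a (aval i s) (aval e s) s)"
| "step n f D (Seq c1 c2) s =
     (if c1 = SKIP then return_pmf (c2, s)
      else map_pmf (\<lambda>(c1', s'). (Seq c1' c2, s')) (step n f D c1 s))"
| "step n f D (Cond b c1 c2) s = return_pmf (if bval b s then c1 else c2, s)"
| "step n f D (While b c) s =
     return_pmf (if bval b s then Seq c (While b c) else SKIP, s)"
| "step n f D (Flip v) s =
     map_pmf (\<lambda>b. (SKIP, set_reg v (of_bool b) s)) (bernoulli_pmf (1/2))"
| "step n f D (Query v a) s =
     return_pmf (SKIP, count_query (set_reg v (of_bit (f (get_point n a s))) s))"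
| "step n f D (Sample a) s =
     map_pmf (\<lambda>x. (SKIP, count_query (put_point n a x s))) D"

primrec run :: "nat \<Rightarrow> nat \<Rightarrow> boolfun \<Rightarrow> point pmf \<Rightarrow> com \<Rightarrow> state \<Rightarrow> (com \<times> state) pmf" where
  "run 0 n f D c s = return_pmf (c, s)"
| "run (Suc t) n f D c s = bind_pmf (step n f D c s) (\<lambda>(c', s'). run t n f D c' s')"


section \<open>Distribution-free testers\<close>

text \<open>
  A real \<open>\<epsilon> > 0\<close> is given to a program as a fraction \<open>p / q\<close>. A rational \<open>\<epsilon>\<close> may be
  given exactly; in general, the fraction need only be a lower bound that is tight up to a factor
  of 2, so that every real \<open>\<epsilon> > 0\<close> has an encoding.
\<close>

definition encodes :: "real \<Rightarrow> nat \<Rightarrow> nat \<Rightarrow> bool" where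
  "encodes \<epsilon> p q \<longleftrightarrow> p > 0 \<and> q > 0 \<and> real p / real q \<le> \<epsilon> \<and> \<epsilon> \<le> 2 * (real p / real q)"

definition initial_state :: "nat \<Rightarrow> nat \<Rightarrow> nat \<Rightarrow> nat \<Rightarrow> state" where
  "initial_state n k p q =
     \<lparr>regs = (\<lambda>_. 0)(''n'' := n, ''k'' := k, ''p'' := p, ''q'' := q),
      arrs = (\<lambda>_ _. 0), queries = 0\<rparr>"

definition accepting :: "(com \<times> state) set" where
  "accepting = {(c, s). c = SKIP \<and> regs s ''accept'' = 1}"

definition rejecting :: "(com \<times> state) set" where
  "rejecting = {(c, s). c = SKIP \<and> regs s ''accept'' \<noteq> 1}"

text \<open>
  The single program \<open>P\<close> is an adaptive two-sided distribution-free tester for the classes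
  \<open>C n k\<close> (\<open>k \<ge> 1\<close>). The bounds on running time (a function of \<open>n\<close> and \<open>\<epsilon>\<close>) and on the number of
  queries and samples (a function of \<open>k\<close> and \<open>\<epsilon>\<close>) hold for every outcome of the coins and samples.
\<close>

definition distribution_free_tester ::
  "(nat \<Rightarrow> nat \<Rightarrow> boolfun set) \<Rightarrow> com \<Rightarrow> (nat \<Rightarrow> real \<Rightarrow> real) \<Rightarrow> (nat \<Rightarrow> real \<Rightarrow> real) \<Rightarrow> bool" where
  "distribution_free_tester C P time query_bound \<longleftrightarrow>
     (\<forall>\<epsilon>>0. \<forall>n. \<forall>k\<ge>1. \<forall>p q f D. encodes \<epsilon> p q \<longrightarrow> set_pmf D \<subseteq> cube n \<longrightarrow>
       (\<exists>t. real t \<le> time n \<epsilon> \<and>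
         (let R = run t n f D P (initial_state n k p q) in
           (\<forall>(c, s) \<in> set_pmf R. c = SKIP \<and> real (queries s) \<le> query_bound k \<epsilon>) \<and>
           (f \<in> C n k \<longrightarrow> measure_pmf.prob R accepting \<ge> 2/3) \<and>
           (eps_far \<epsilon> D (C n k) f \<longrightarrow> measure_pmf.prob R rejecting \<ge> 2/3))))"

definition polynomial_time :: "(nat \<Rightarrow> real \<Rightarrow> real) \<Rightarrow> bool" where
  "polynomial_time time \<longleftrightarrow>
     (\<exists>(A::real) (d::nat). \<forall>n. \<forall>\<epsilon>>0. time n \<epsilon> \<le> A * (real n + 1 / \<epsilon> + 1) ^ d)"

text \<open>
  The bound \<open>O(T * polylog T)\<close> for \<open>T = k / \<epsilon>\<close>, with constants independent of \<open>k\<close> and \<open>\<epsilon>\<close>. The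
  shift \<open>T + 2\<close> only keeps the logarithm at least 1 when \<open>T\<close> is small.
\<close>

definition soft_O_k_over_eps :: "(nat \<Rightarrow> real \<Rightarrow> real) \<Rightarrow> bool" where
  "soft_O_k_over_eps Q \<longleftrightarrow>
     (\<exists>(B::real) (d::nat). \<forall>k\<ge>1. \<forall>\<epsilon>>0.
        Q k \<epsilon> \<le> B * (real k / \<epsilon>) * log 2 (real k / \<epsilon> + 2) ^ d)"

end

theory Submission
  imports Defs
begin

text \<open>
  The tester has one-sided error. It first runs the linearity test of Blum, Luby and Rubinfeld a
  constant number of times; if this test passes with probability at least \<open>7/8\<close>, there is a linear
  function \<open>g\<close> such that for every \<open>x\<close> the corrected query \<open>f (x + r) + f r\<close> with random \<open>r\<close> equals
  \<open>g x\<close> with probability at least \<open>3/4\<close>. Comparing \<open>f\<close> with corrected queries on about \<open>4/\<epsilon>\<close> samples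
  detects that \<open>f\<close> and \<open>g\<close> are \<open>\<epsilon>\<close>-far. It remains to detect that \<open>g\<close> depends on more than \<open>k\<close>
  variables. The variables are hashed to \<open>2\<^sup>L\<close> = \<open>O(k\<^sup>2)\<close> blocks, such that \<open>k + 1\<close> relevant variables
  probably lie in distinct blocks. As long as a relevant variable is alive, a corrected query at a random
  point supported on the alive variables has value 1 with probability at least \<open>3/8\<close>. Every such hit
  is followed by a bisection with \<open>L\<close> queries, which ends in a block that is removed; more than \<open>k\<close>
  hits cause rejection. The bisection need not be correct for the soundness, since every hit
  removes only one block. If \<open>f\<close> is linear, then all queries are exact and every removed block contains
  a relevant variable, so \<open>f\<close> is never rejected wrongly.
\<close>

section \<open>Expectations of oracle programs\<close>

text \<open>The query bound must not mention \<open>n\<close>, so a hit cannot be traced by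
  bisecting the variables themselves; bisecting \<open>2^L\<close> hash blocks costs
  \<open>O(log k)\<close> queries. Sets of blocks are always given by a threshold on the hash
  values, so a single register describes the set of variables that a query is restricted to.
  Soundness is proved without conditioning on what earlier stages did. The expected weight of
  acceptance is at most a product of three factors, one per stage, which are determined by
  \<open>f\<close>, \<open>D\<close> and the parameters and not by the run. For a far
  \<open>f\<close> one of the factors is at most \<open>1/3\<close>, and the other two are at most
  1. Running time, query count and one-sided error come out of the same inequality: every outcome
  that violates one of them has weight \<open>\<infinity>\<close>, so finiteness of the product
  already excludes it. Hence each loop is analysed once, with a potential that is
  \<open>\<infinity>\<close> outside the loop invariant.\<close>

abbreviation seq :: "com \<Rightarrow> com \<Rightarrow> com" (infixr \<open>;;\<close> 60) where
  "c1 ;; c2 \<equiv> Seq c1 c2"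

declare add_bit_eq_xor [simp del] mult_bit_eq_and [simp del]

definition xadd :: "point \<Rightarrow> point \<Rightarrow> point" where
  "xadd x y = map2 (+) x y"

text \<open>The uniform distribution, built bit by bit so that each coin of
  \<open>random_fill\<close> peels off one coordinate.\<close>

primrec ucube :: "nat \<Rightarrow> point pmf" where
  "ucube 0 = return_pmf []"
| "ucube (Suc n) = bind_pmf (bernoulli_pmf (1/2)) (\<lambda>b. map_pmf (\<lambda>u. of_bool b # u) (ucube n))"

text \<open>A frame condition: only \<open>V\<close> and \<open>A\<close> may have changed. The
  query counter is left out because every specification tracks it explicitly.\<close>

definition agree :: "vname set \<Rightarrow> vname set \<Rightarrow> state \<Rightarrow> state \<Rightarrow> bool" where
  "agree V A s s' \<longleftrightarrow> (\<forall>v. v \<notin> V \<longrightarrow> regs s' v = regs s v) \<and> (\<forall>a. a \<notin> A \<longrightarrow> arrs s' a = arrs s a)"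

lemma state_update_simps [simp]:
  "regs (set_reg v m s) = (regs s)(v := m)" "arrs (set_reg v m s) = arrs s"
  "queries (set_reg v m s) = queries s"
  "regs (set_cell a i m s) = regs s" "arrs (set_cell a i m s) = (arrs s)(a := (arrs s a)(i := m))"
  "queries (set_cell a i m s) = queries s"
  "regs (count_query s) = regs s" "arrs (count_query s) = arrs s"
  "queries (count_query s) = Suc (queries s)"
  "regs (put_point n a x s) = regs s"
  "arrs (put_point n a x s) = (arrs s)(a := (\<lambda>i. if i < n then of_bit (x ! i) else arrs s a i))"
  "queries (put_point n a x s) = queries s"
  by (simp_all add: set_reg_def set_cell_def count_query_def put_point_def)

locale access =
  fixes n :: nat and f :: boolfun and D :: "point pmf"
begin

text \<open>
  An upper bound on the expectation of \<open>\<psi>\<close> after \<open>T\<close> steps. The value \<open>\<infinity>\<close> stands for forbidden outcomes,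
  among them not having halted, so that a finite bound also expresses a time bound and a
  postcondition that holds with certainty.
\<close>

definition wpe :: "nat \<Rightarrow> com \<Rightarrow> (state \<Rightarrow> ennreal) \<Rightarrow> state \<Rightarrow> ennreal" where
  "wpe T c \<psi> s =
     (\<integral>\<^sup>+ cs. (if fst cs = SKIP then \<psi> (snd cs) else \<infinity>) \<partial>measure_pmf (run T n f D c s))"

lemma wpe_0: "wpe 0 c \<psi> s = (if c = SKIP then \<psi> s else \<infinity>)"
  by (simp add: wpe_def)

lemma wpe_Suc:
  "wpe (Suc T) c \<psi> s = (\<integral>\<^sup>+ cs. wpe T (fst cs) \<psi> (snd cs) \<partial>measure_pmf (step n f D c s))"
  by (simp add: wpe_def nn_integral_bind_pmf case_prod_beta)

lemma wpe_SKIP [simp]: "wpe T SKIP \<psi> s = \<psi> s"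
  by (induction T) (simp_all add: wpe_0 wpe_Suc)

lemma wpe_mono:
  assumes "\<And>s. \<psi> s \<le> \<psi>' s"
  shows "wpe T c \<psi> s \<le> wpe T c \<psi>' s"
  unfolding wpe_def by (intro nn_integral_mono) (simp add: assms)

text \<open>A halted run keeps its value, and an unfinished one already counts
  \<open>\<infinity>\<close>, so extra time can only lower the bound. This is why all later time
  budgets may be rough.\<close>

lemma wpe_time_Suc: "wpe (Suc T) c \<psi> s \<le> wpe T c \<psi> s"
proof (induction T arbitrary: c s)
  case 0
  show ?case by (cases "c = SKIP") (simp_all add: wpe_0)
next
  case (Suc T)
  show ?case
    unfolding wpe_Suc[of "Suc T"] wpe_Suc[of T c] by (intro nn_integral_mono Suc.IH)
qed

lemma wpe_time: "T \<le> T' \<Longrightarrow> wpe T' c \<psi> s \<le> wpe T c \<psi> s"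
  by (induction rule: dec_induct) (auto intro: order_trans wpe_time_Suc)

text \<open>The additional step is the one in which \<open>Seq SKIP c2\<close> becomes
  \<open>c2\<close>. Only an inequality can hold: \<open>c1\<close> may halt early and leave
  \<open>c2\<close> more than \<open>T2\<close> steps.\<close>

lemma wpe_Seq_aux: "wpe (T1 + T2 + 1) (c1 ;; c2) \<psi> s \<le> wpe T1 c1 (wpe T2 c2 \<psi>) s"
proof (induction T1 arbitrary: c1 s)
  case 0
  show ?case by (cases "c1 = SKIP") (simp_all add: wpe_0 wpe_Suc)
next
  case (Suc T1)
  show ?case
  proof (cases "c1 = SKIP")
    case True
    then show ?thesis using wpe_time[of T2 "Suc (T1 + T2)" c2 \<psi> s]
      by (simp add: wpe_Suc[of "Suc (T1 + T2)" "SKIP ;; c2"])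
  next
    case False
    have "wpe (Suc T1 + T2 + 1) (c1 ;; c2) \<psi> s =
      (\<integral>\<^sup>+ cs. wpe (T1 + T2 + 1) (fst cs ;; c2) \<psi> (snd cs) \<partial>measure_pmf (step n f D c1 s))"
      using False by (simp add: wpe_Suc[of "Suc (T1 + T2)"] case_prod_beta)
    also have "\<dots> \<le> wpe (Suc T1) c1 (wpe T2 c2 \<psi>) s"
      unfolding wpe_Suc[of T1] by (intro nn_integral_mono Suc.IH)
    finally show ?thesis .
  qed
qed

lemma wpe_Seq:
  assumes "T1 + T2 + 1 \<le> T"
  shows "wpe T (c1 ;; c2) \<psi> s \<le> wpe T1 c1 (wpe T2 c2 \<psi>) s"
  using wpe_time[OF assms] wpe_Seq_aux order_trans by blast

lemma wpe_Seq_le: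
  assumes "wpe T1 c1 (wpe T2 c2 \<psi>) s \<le> v" "T1 + T2 + 1 \<le> T"
  shows "wpe T (c1 ;; c2) \<psi> s \<le> v"
  using wpe_Seq[OF assms(2)] assms(1) order_trans by blast

lemma wpe_Assign [simp]: "1 \<le> T \<Longrightarrow> wpe T (Assign v e) \<psi> s = \<psi> (set_reg v (aval e s) s)"
  by (cases T) (simp_all add: wpe_Suc)

lemma wpe_Store [simp]:
  "1 \<le> T \<Longrightarrow> wpe T (Store a i e) \<psi> s = \<psi> (set_cell a (aval i s) (aval e s) s)"
  by (cases T) (simp_all add: wpe_Suc)

lemma wpe_Query [simp]:
  "1 \<le> T \<Longrightarrow> wpe T (Query v a) \<psi> s = \<psi> (count_query (set_reg v (of_bit (f (get_point n a s))) s))"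
  by (cases T) (simp_all add: wpe_Suc)

lemma wpe_Cond [simp]:
  "1 \<le> T \<Longrightarrow> wpe T (Cond b c1 c2) \<psi> s = wpe (T - 1) (if bval b s then c1 else c2) \<psi> s"
  by (cases T) (simp_all add: wpe_Suc)

lemma wpe_Seq_SKIP: "1 \<le> T \<Longrightarrow> wpe T (SKIP ;; c) \<psi> s = wpe (T - 1) c \<psi> s"
  by (cases T) (simp_all add: wpe_Suc)

lemma wpe_Seq_step:
  assumes "c1 \<noteq> SKIP" "1 \<le> T"
  shows "wpe T (c1 ;; c) \<psi> s =
    (\<integral>\<^sup>+ cs. wpe (T - 1) (fst cs ;; c) \<psi> (snd cs) \<partial>measure_pmf (step n f D c1 s))"
  using assms by (cases T) (simp_all add: wpe_Suc case_prod_beta)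

text \<open>This rule and its companions execute straight-line code symbolically by simplification.
  Each statement costs two steps: its own, and the removal of the \<open>SKIP\<close> it leaves
  behind.\<close>

lemma wpe_Seq_Assign [simp]:
  "2 \<le> T \<Longrightarrow> wpe T (Assign v e ;; c) \<psi> s = wpe (T - 2) c \<psi> (set_reg v (aval e s) s)"
  by (simp add: wpe_Seq_step wpe_Seq_SKIP numeral_2_eq_2)

lemma wpe_Seq_Store [simp]:
  "2 \<le> T \<Longrightarrow> wpe T (Store a i e ;; c) \<psi> s = wpe (T - 2) c \<psi> (set_cell a (aval i s) (aval e s) s)"
  by (simp add: wpe_Seq_step wpe_Seq_SKIP numeral_2_eq_2)

lemma wpe_Seq_Query [simp]:
  "2 \<le> T \<Longrightarrow> wpe T (Query v a ;; c) \<psi> s =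
     wpe (T - 2) c \<psi> (count_query (set_reg v (of_bit (f (get_point n a s))) s))"
  by (simp add: wpe_Seq_step wpe_Seq_SKIP numeral_2_eq_2)

lemma wpe_Seq_Cond [simp]:
  "1 \<le> T \<Longrightarrow> wpe T (Cond b c1 c2 ;; c) \<psi> s = wpe (T - 1) ((if bval b s then c1 else c2) ;; c) \<psi> s"
  by (simp add: wpe_Seq_step)

lemma wpe_Seq_Flip [simp]:
  assumes "2 \<le> T"
  shows "wpe T (Flip v ;; c) \<psi> s =
     (wpe (T - 2) c \<psi> (set_reg v 1 s) + wpe (T - 2) c \<psi> (set_reg v 0 s)) / 2"
  using assms
  by (simp add: wpe_Seq_step wpe_Seq_SKIP numeral_2_eq_2 divide_ennreal_def distrib_right)

lemma wpe_Sample: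
  "1 \<le> T \<Longrightarrow> wpe T (Sample a) \<psi> s = (\<integral>\<^sup>+ x. \<psi> (count_query (put_point n a x s)) \<partial>measure_pmf D)"
  by (cases T) (simp_all add: wpe_Suc)

text \<open>\<open>\<phi> m\<close> is a potential with exactly \<open>m\<close> rounds left, and
  its finiteness serves as the invariant that decides the guard. A round costs two steps beyond its
  body, for the guard and for dropping \<open>SKIP\<close>; the last step is the final
  guard.\<close>

lemma wpe_While:
  assumes body: "\<And>m s. \<phi> (Suc m) s < \<infinity> \<Longrightarrow> bval b s \<and> wpe T c (\<phi> m) s \<le> \<phi> (Suc m) s"
    and exit: "\<And>s. \<phi> 0 s < \<infinity> \<Longrightarrow> \<not> bval b s"
    and time: "m * (T + 2) + 1 \<le> T'"
  shows "wpe T' (While b c) (\<phi> 0) s \<le> \<phi> m s"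
proof -
  have "wpe (m * (T + 2) + 1) (While b c) (\<phi> 0) s \<le> \<phi> m s"
  proof (induction m arbitrary: s)
    case 0
    show ?case using exit[of s] by (cases "\<phi> 0 s < \<infinity>") (auto simp: wpe_Suc not_less top_unique)
  next
    case (Suc m)
    show ?case
    proof (cases "\<phi> (Suc m) s < \<infinity>")
      case True
      have "wpe (Suc m * (T + 2) + 1) (While b c) (\<phi> 0) s =
          wpe (T + (m * (T + 2) + 1) + 1) (c ;; While b c) (\<phi> 0) s"
        using body[OF True] by (simp add: wpe_Suc[of _ "While b c"] algebra_simps)
      also have "\<dots> \<le> wpe T c (wpe (m * (T + 2) + 1) (While b c) (\<phi> 0)) s"
        by (rule wpe_Seq) simp
      also have "\<dots> \<le> wpe T c (\<phi> m) s"
        by (intro wpe_mono Suc.IH)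
      also have "\<dots> \<le> \<phi> (Suc m) s"
        using body[OF True] by blast
      finally show ?thesis .
    qed (simp add: not_less top_unique)
  qed
  then show ?thesis using wpe_time[OF time] order_trans by blast
qed

end

section \<open>Corrected queries\<close>

text \<open>
  Fills \<open>a\<close> with random bits and \<open>y\<close> with the sum of \<open>a\<close> and the part of \<open>x\<close> on which the hash values \<open>h\<close>
  are below the threshold \<open>t\<close> (sums need no reduction, since points are read modulo 2). For
  \<open>a = x\<close> the contents of \<open>y\<close> are meaningless.
\<close>

definition random_fill :: "vname \<Rightarrow> com" where
  "random_fill a =
    Assign ''i'' (Num 0) ;;
    While (Less (Var ''i'') (Var ''n''))
     (Flip ''b'' ;;
      Store a (Var ''i'') (Var ''b'') ;;
      Cond (Less (Arr ''h'' (Var ''i'')) (Var ''t''))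
        (Store ''y'' (Var ''i'') (Plus (Var ''b'') (Arr ''x'' (Var ''i''))))
        (Store ''y'' (Var ''i'') (Var ''b'')) ;;
      Assign ''i'' (Plus (Var ''i'') (Num 1)))"

definition corrected_query :: com where
  "corrected_query = random_fill ''r'' ;;
    Query ''u'' ''y'' ;;
    Query ''v'' ''r'' ;;
    Assign ''d'' (Plus (Monus (Var ''u'') (Var ''v'')) (Monus (Var ''v'') (Var ''u'')))"

lemma set_ucube: "set_pmf (ucube n) = cube n"
proof (induction n)
  case (Suc n)
  have "set_pmf (ucube (Suc n)) = (\<Union>b::bool. (#) (of_bool b) ` cube n)"
    using Suc by (simp add: set_pmf_bernoulli)
  also have "\<dots> = cube (Suc n)"
  proof
    show "cube (Suc n) \<subseteq> (\<Union>b::bool. (#) (of_bool b) ` cube n)"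
    proof
      fix u :: point assume "u \<in> cube (Suc n)"
      then obtain c v where u: "u = c # v" "v \<in> cube n" by (auto simp: cube_def length_Suc_conv)
      then have "u = of_bool (c = 1) # v" by (cases c) auto
      then show "u \<in> (\<Union>b::bool. (#) (of_bool b) ` cube n)" using u(2) by blast
    qed
  qed (auto simp: cube_def)
  finally show ?case .
qed (auto simp: cube_def)

lemma length_ucube: "u \<in> set_pmf (ucube n) \<Longrightarrow> length u = n"
  by (simp add: set_ucube cube_def)

lemma of_nat_of_bit [simp]: "of_nat (of_bit b) = (b :: bit)"
  by (cases b) simp_all

lemma of_bit_of_nat: "m \<le> 1 \<Longrightarrow> of_bit (of_nat m :: bit) = m"
  by (cases m) auto

lemma nn_integral_ucube_Suc:
  "(\<integral>\<^sup>+ u. G u \<partial>measure_pmf (ucube (Suc m))) =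
   ((\<integral>\<^sup>+ u. G (1 # u) \<partial>measure_pmf (ucube m)) + (\<integral>\<^sup>+ u. G (0 # u) \<partial>measure_pmf (ucube m))) / 2"
  by (simp add: nn_integral_bind_pmf divide_ennreal_def distrib_right)

lemma nn_integral_pmf_mono:
  assumes "\<And>x. x \<in> set_pmf p \<Longrightarrow> F x \<le> G x"
  shows "(\<integral>\<^sup>+ x. F x \<partial>measure_pmf p) \<le> (\<integral>\<^sup>+ x. G x \<partial>measure_pmf p)"
  by (intro nn_integral_mono_AE) (auto simp: AE_measure_pmf_iff assms)

definition masked :: "nat \<Rightarrow> state \<Rightarrow> point" where
  "masked n s = map (\<lambda>i. if arrs s ''h'' i < regs s ''t'' then of_nat (arrs s ''x'' i) else 0) [0..<n]"

lemma agree_refl: "agree V A s s"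
  by (simp add: agree_def)

lemma agree_regs: "agree V A s s' \<Longrightarrow> v \<notin> V \<Longrightarrow> regs s' v = regs s v"
  by (simp add: agree_def)

lemma agree_arrs: "agree V A s s' \<Longrightarrow> a \<notin> A \<Longrightarrow> arrs s' a = arrs s a"
  by (simp add: agree_def)

lemma agree_trans: "agree V A s s' \<Longrightarrow> agree W B s' s'' \<Longrightarrow> V \<union> W \<subseteq> U \<Longrightarrow> A \<union> B \<subseteq> C \<Longrightarrow> agree U C s s''"
  unfolding agree_def by (metis Un_iff subsetD)

lemma ennreal_half_mono: "a \<le> c \<Longrightarrow> b \<le> d \<Longrightarrow> (a + b) / 2 \<le> (c + d) / (2::ennreal)"
  by (intro divide_right_mono_ennreal add_mono)

lemma get_point_simps [simp]:
  "get_point n a (set_reg v m s) = get_point n a s"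
  "get_point n a (count_query s) = get_point n a s"
  by (simp_all add: get_point_def)

lemma length_masked [simp]: "length (masked n s) = n"
  by (simp add: masked_def)

context access
begin

lemma wpe_random_fill:
  assumes a: "a = ''x'' \<or> a = ''r''" and n: "regs s ''n'' = n"
  assumes post: "\<And>s' u. \<lbrakk>length u = n; agree {''i'', ''b''} {a, ''y''} s s'; queries s' = queries s;
      \<forall>i<n. arrs s' a i = of_bit (u ! i);
      a = ''r'' \<longrightarrow> (\<forall>i<n. of_nat (arrs s' ''y'' i) = u ! i + masked n s ! i)\<rbrakk> \<Longrightarrow> \<psi> s' \<le> G u"
    and T: "20 * n + 10 \<le> T"
  shows "wpe T (random_fill a) \<psi> s \<le> (\<integral>\<^sup>+ u. G u \<partial>measure_pmf (ucube n))"
proof -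
  define I where "I m s' \<longleftrightarrow> regs s' ''i'' + m = n \<and> agree {''i'', ''b''} {a, ''y''} s s' \<and>
    queries s' = queries s \<and> (\<forall>i < n - m. arrs s' a i \<le> 1) \<and>
    (a = ''r'' \<longrightarrow> (\<forall>i<n - m. of_nat (arrs s' ''y'' i) = of_nat (arrs s' a i) + masked n s ! i))" for m s'
  define pre where "pre m s' = map (\<lambda>i. of_nat (arrs s' a i) :: bit) [0..<n - m]"
    for m and s' :: state
  \<comment> \<open>The conditional expectation of \<open>G\<close> given the bits drawn so far:
    \<open>pre m s'\<close> is the known prefix, and the remaining \<open>m\<close> bits are still
    uniform. A coin toss splits it as in \<open>nn_integral_ucube_Suc\<close>.\<close>
  define \<phi> where "\<phi> m s' = (if I m s' then (\<integral>\<^sup>+ u. G (pre m s' @ u) \<partial>measure_pmf (ucube m)) else \<infinity>)"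
    for m s'
  have fin: "I m s'" if "\<phi> m s' < \<infinity>" for m s'
    using that by (simp add: \<phi>_def split: if_splits)
  have end_le: "\<psi> s' \<le> \<phi> 0 s'" for s'
  proof (cases "I 0 s'")
    case True
    have nth: "pre 0 s' ! i = of_nat (arrs s' a i)" if "i < n" for i
      using that by (simp add: pre_def)
    have "arrs s' a i = of_bit (pre 0 s' ! i)" if "i < n" for i
    proof -
      have "arrs s' a i \<le> 1" using True that by (simp add: I_def)
      then show ?thesis by (simp only: nth[OF that] of_bit_of_nat)
    qed
    then have "\<psi> s' \<le> G (pre 0 s')"
      using True by (intro post) (simp_all add: I_def nth, simp add: pre_def)
    then show ?thesis using True by (simp add: \<phi>_def)
  qed (simp add: \<phi>_def)
  let ?body = "Store a (Var ''i'') (Var ''b'') ;;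
      Cond (Less (Arr ''h'' (Var ''i'')) (Var ''t''))
        (Store ''y'' (Var ''i'') (Plus (Var ''b'') (Arr ''x'' (Var ''i''))))
        (Store ''y'' (Var ''i'') (Var ''b'')) ;;
      Assign ''i'' (Plus (Var ''i'') (Num 1))"
  have bit: "wpe 13 ?body (\<phi> m) (set_reg ''b'' (of_bit b) s')
      \<le> (\<integral>\<^sup>+ u. G (pre (Suc m) s' @ b # u) \<partial>measure_pmf (ucube m))"
    if I: "I (Suc m) s'" for m s' b
  proof -
    obtain i where i: "regs s' ''i'' = i" "n - m = Suc i" "n - Suc m = i" "i < n" "i + Suc m = n"
      using I by (auto simp: I_def)
    have ag: "agree {''i'', ''b''} {a, ''y''} s s'" using I by (simp add: I_def)
    have th: "regs s' ''t'' = regs s ''t''" "arrs s' ''h'' = arrs s ''h''"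
      "a = ''r'' \<Longrightarrow> arrs s' ''x'' = arrs s ''x''"
      using ag a by (auto simp: agree_regs agree_arrs)
    \<comment> \<open>For \<open>a = ''x''\<close> the cell of \<open>x\<close> has just been
      overwritten by the coin, and that new value is what the program adds.\<close>
    define w where "w = of_bit b + (if arrs s ''h'' i < regs s ''t''
       then (if a = ''x'' then of_bit b else arrs s' ''x'' i) else 0 :: nat)"
    define s2 where "s2 = set_reg ''i'' (Suc i) (set_cell ''y'' i w
      (set_cell a i (of_bit b) (set_reg ''b'' (of_bit b) s')))"
    have "wpe 13 ?body (\<phi> m) (set_reg ''b'' (of_bit b) s') = \<phi> m s2"
      using a i th by (auto simp: s2_def w_def)
    moreover have "I m s2"
    proof -
      have "agree {''i'', ''b''} {a, ''y''} s s2"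
        using ag by (simp add: agree_def s2_def)
      moreover have "arrs s2 a j \<le> 1" if "j < Suc i" for j
        using I i(3) that a by (cases "j = i") (auto simp: s2_def I_def)
      moreover have "of_nat (arrs s2 ''y'' j) = of_nat (arrs s2 a j) + masked n s ! j"
        if r: "a = ''r''" and j: "j < Suc i" for j
      proof (cases "j = i")
        case True
        have "arrs s2 ''y'' i = w" "arrs s2 a i = of_bit b"
          using r by (simp_all add: s2_def)
        moreover have "masked n s ! i = of_nat (if arrs s ''h'' i < regs s ''t'' then arrs s' ''x'' i else 0)"
          using i(4) r th(3) by (simp add: masked_def)
        moreover have "of_nat w = of_nat (of_bit b)
            + (of_nat (if arrs s ''h'' i < regs s ''t'' then arrs s' ''x'' i else 0) :: bit)"
          unfolding w_def of_nat_add using r by simp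
        ultimately show ?thesis using True by (simp only:)
      next
        case False
        then have "of_nat (arrs s' ''y'' j) = of_nat (arrs s' a j) + masked n s ! j"
          using I i(3) r j by (simp only: I_def)
        moreover have "arrs s2 ''y'' j = arrs s' ''y'' j" "arrs s2 a j = arrs s' a j"
          using False r by (simp_all add: s2_def)
        ultimately show ?thesis by (simp only:)
      qed
      moreover have "queries s2 = queries s"
        using I by (simp add: I_def s2_def)
      moreover have "regs s2 ''i'' + m = n" using i by (simp add: s2_def)
      ultimately show ?thesis unfolding I_def i(2) by blast
    qed
    moreover have "pre m s2 = pre (Suc m) s' @ [b]"
      using i a by (auto simp: pre_def s2_def)
    ultimately show ?thesis by (simp add: \<phi>_def)
  qed
  have step: "wpe 15 (Flip ''b'' ;; ?body) (\<phi> m) s' \<le> \<phi> (Suc m) s'" for m s'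
  proof (cases "I (Suc m) s'")
    case True
    have "wpe 15 (Flip ''b'' ;; ?body) (\<phi> m) s'
        = (wpe 13 ?body (\<phi> m) (set_reg ''b'' (of_bit 1) s') +
           wpe 13 ?body (\<phi> m) (set_reg ''b'' (of_bit 0) s')) / 2"
      by (subst wpe_Seq_Flip) (simp_all del: wpe_Seq_Store)
    also have "\<dots> \<le> ((\<integral>\<^sup>+ u. G (pre (Suc m) s' @ 1 # u) \<partial>measure_pmf (ucube m)) +
        (\<integral>\<^sup>+ u. G (pre (Suc m) s' @ 0 # u) \<partial>measure_pmf (ucube m))) / 2"
      by (intro ennreal_half_mono bit True)
    also have "\<dots> = \<phi> (Suc m) s'"
      using True by (simp add: \<phi>_def nn_integral_ucube_Suc del: ucube.simps)
    finally show ?thesis .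
  qed (simp add: \<phi>_def)
  have "wpe T (random_fill a) \<psi> s \<le> wpe T (random_fill a) (\<phi> 0) s"
    by (intro wpe_mono end_le)
  also have "\<dots> \<le> \<phi> n (set_reg ''i'' 0 s)"
    unfolding random_fill_def
  proof (subst wpe_Seq_Assign)
    have n': "regs s' ''n'' = n" if "I m s'" for m s'
      using that agree_regs[of _ _ s s' "''n''"] n by (auto simp: I_def)
    show "wpe (T - 2) (While (Less (Var ''i'') (Var ''n'')) (Flip ''b'' ;; ?body)) (\<phi> 0)
        (set_reg ''i'' (aval (Num 0) s) s) \<le> \<phi> n (set_reg ''i'' 0 s)"
    proof (simp only: aval.simps, rule wpe_While[where T = 15])
      fix m s' assume "\<phi> (Suc m) s' < \<infinity>"
      then have "I (Suc m) s'" by (rule fin)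
      then show "bval (Less (Var ''i'') (Var ''n'')) s' \<and>
          wpe 15 (Flip ''b'' ;; ?body) (\<phi> m) s' \<le> \<phi> (Suc m) s'"
        using n'[of "Suc m" s'] by (intro conjI step) (simp add: I_def)
    next
      fix s' assume "\<phi> 0 s' < \<infinity>"
      then have "I 0 s'" by (rule fin)
      then show "\<not> bval (Less (Var ''i'') (Var ''n'')) s'"
        using n'[of 0 s'] by (simp add: I_def)
    qed (use T in simp)
  qed (use T in simp)
  also have "\<dots> \<le> (\<integral>\<^sup>+ u. G u \<partial>measure_pmf (ucube n))"
    using n by (simp add: \<phi>_def I_def pre_def agree_def del: ucube.simps)
  finally show ?thesis .
qed

definition corrected :: "point \<Rightarrow> bit pmf" where
  "corrected z = map_pmf (\<lambda>r. f (xadd z r) + f r) (ucube n)"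

lemma wpe_corrected_query:
  assumes n: "regs s ''n'' = n"
  assumes post: "\<And>s' b. \<lbrakk>agree {''i'', ''b'', ''u'', ''v'', ''d''} {''r'', ''y''} s s';
      queries s' = queries s + 2; b \<in> set_pmf (corrected (masked n s)); regs s' ''d'' = of_bit b\<rbrakk> \<Longrightarrow> \<psi> s' \<le> G b"
    and T: "20 * n + 20 \<le> T"
  shows "wpe T corrected_query \<psi> s \<le> (\<integral>\<^sup>+ b. G b \<partial>measure_pmf (corrected (masked n s)))"
proof -
  let ?H = "\<lambda>u. f (xadd (masked n s) u) + f u"
  have "wpe T corrected_query \<psi> s \<le> (\<integral>\<^sup>+ u. (if length u = n then G (?H u) else \<infinity>) \<partial>measure_pmf (ucube n))"
    unfolding corrected_query_def
  proof (rule wpe_Seq_le[where ?T2.0 = 5 and ?T1.0 = "20 * n + 10"], rule wpe_random_fill, simp, rule n)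
    fix s' u
    assume u: "length u = n" and ag: "agree {''i'', ''b''} {''r'', ''y''} s s'"
      and q: "queries s' = queries s" and r: "\<forall>i<n. arrs s' ''r'' i = of_bit (u ! i)"
      and y: "''r'' = ''r'' \<longrightarrow> (\<forall>i<n. of_nat (arrs s' ''y'' i) = u ! i + masked n s ! i)"
    have r': "get_point n ''r'' s' = u"
      using u r by (auto simp: get_point_def intro!: nth_equalityI)
    have y': "get_point n ''y'' s' = xadd (masked n s) u"
      using u y by (auto simp: get_point_def xadd_def add.commute intro!: nth_equalityI)
    have b: "?H u \<in> set_pmf (corrected (masked n s))"
      using u by (auto simp: corrected_def set_ucube cube_def)
    let ?s = "count_query (set_reg ''v'' (of_bit (f u)) (count_query (set_reg ''u'' (of_bit (f (xadd (masked n s) u))) s')))"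
    have "\<psi> (set_reg ''d'' (of_bit (?H u)) ?s) \<le> G (?H u)"
      using ag q by (intro post b) (simp_all add: agree_def)
    \<comment> \<open>On bits the two truncated differences add up to \<open>|u - v|\<close>, which
      is the sum modulo 2.\<close>
    moreover have "wpe 5 (Query ''u'' ''y'' ;; Query ''v'' ''r'' ;;
        Assign ''d'' (Plus (Monus (Var ''u'') (Var ''v'')) (Monus (Var ''v'') (Var ''u'')))) \<psi> s'
        = \<psi> (set_reg ''d'' (of_bit (?H u)) ?s)"
      by (simp add: y' r' del: even_add)
    ultimately show "wpe 5 (Query ''u'' ''y'' ;; Query ''v'' ''r'' ;;
        Assign ''d'' (Plus (Monus (Var ''u'') (Var ''v'')) (Monus (Var ''v'') (Var ''u'')))) \<psi> s'
      \<le> (if length u = n then G (?H u) else \<infinity>)"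
      by (simp only: u if_True refl)
  qed (use T in auto)
  also have "\<dots> = (\<integral>\<^sup>+ b. G b \<partial>measure_pmf (corrected (masked n s)))"
    by (auto simp: corrected_def AE_measure_pmf_iff length_ucube intro!: nn_integral_cong_AE)
  finally show ?thesis .
qed

end

section \<open>Linear functions under the uniform distribution\<close>

definition chi :: "nat set \<Rightarrow> point \<Rightarrow> bit" where
  "chi S x = (\<Sum>i\<in>S. x ! i)"

definition unit_point :: "nat \<Rightarrow> nat \<Rightarrow> point" where
  "unit_point n i = (replicate n 0)[i := 1]"

lemma bit_add_self [simp]: "b + b = (0 :: bit)" "b + (b + c) = (c :: bit)"
  by (cases b; cases c; simp)+

lemma UNIV_bit: "UNIV = {0, 1 :: bit}"
  using bit.exhaust by blast

lemma bit_add_eq_0_iff: "a + b = 0 \<longleftrightarrow> a = (b :: bit)"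
  by (cases a; cases b) simp_all

lemma length_xadd [simp]: "length (xadd x y) = min (length x) (length y)"
  by (simp add: xadd_def)

lemma nth_xadd [simp]: "i < length x \<Longrightarrow> i < length y \<Longrightarrow> xadd x y ! i = x ! i + y ! i"
  by (simp add: xadd_def)

lemma xadd_commute: "xadd x y = xadd y x"
  by (rule nth_equalityI) (auto simp: add.commute)

lemma xadd_assoc: "xadd (xadd x y) z = xadd x (xadd y z)"
  by (rule nth_equalityI) (auto simp: add.assoc)

lemma xadd_in_cube: "x \<in> cube n \<Longrightarrow> y \<in> cube n \<Longrightarrow> xadd x y \<in> cube n"
  by (simp add: cube_def)

lemma chi_xadd:
  assumes "S \<subseteq> {..<n}" "x \<in> cube n" "y \<in> cube n"
  shows "chi S (xadd x y) = chi S x + chi S y"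
proof -
  have "chi S (xadd x y) = (\<Sum>i\<in>S. x ! i + y ! i)"
    unfolding chi_def using assms by (intro sum.cong) (auto simp: cube_def)
  then show ?thesis by (simp add: chi_def sum.distrib)
qed

lemma bernoulli_half_Not: "map_pmf Not (bernoulli_pmf (1/2)) = bernoulli_pmf (1/2)"
proof (rule pmf_eqI)
  fix b
  have "pmf (map_pmf Not (bernoulli_pmf (1/2))) (\<not> \<not> b) = pmf (bernoulli_pmf (1/2)) (\<not> b)"
    by (rule pmf_map_inj') (auto simp: inj_def)
  then show "pmf (map_pmf Not (bernoulli_pmf (1/2))) b = pmf (bernoulli_pmf (1/2)) b"
    by (cases b) simp_all
qed

lemma map_xadd_ucube: "a \<in> cube n \<Longrightarrow> map_pmf (xadd a) (ucube n) = ucube n"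
proof (induction n arbitrary: a)
  case 0
  then show ?case by (simp add: cube_def xadd_def)
next
  case (Suc n)
  then obtain c a' where a: "a = c # a'" "a' \<in> cube n" by (auto simp: cube_def length_Suc_conv)
  have eq: "map_pmf (xadd a) (map_pmf ((#) (of_bool b)) (ucube n)) = map_pmf ((#) (c + of_bool b)) (ucube n)" for b
  proof -
    have "map_pmf (xadd a) (map_pmf ((#) (of_bool b)) (ucube n))
        = map_pmf ((#) (c + of_bool b)) (map_pmf (xadd a') (ucube n))"
      by (simp add: pmf.map_comp o_def a xadd_def)
    then show ?thesis by (simp add: Suc.IH[OF a(2)])
  qed
  have "map_pmf (xadd a) (ucube (Suc n)) =
      bind_pmf (bernoulli_pmf (1/2)) (\<lambda>b. map_pmf ((#) (c + of_bool b)) (ucube n))"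
    by (simp only: ucube.simps map_bind_pmf eq)
  also have "\<dots> = ucube (Suc n)"
  proof (cases c)
    assume one: "c = 1"
    have "bind_pmf (bernoulli_pmf (1/2)) (\<lambda>b. map_pmf ((#) (c + of_bool b)) (ucube n))
        = bind_pmf (map_pmf Not (bernoulli_pmf (1/2))) (\<lambda>b. map_pmf ((#) (of_bool b)) (ucube n))"
      unfolding bind_map_pmf by (intro bind_pmf_cong refl arg_cong[where f = "\<lambda>b. map_pmf ((#) b) (ucube n)"])
        (auto simp: one split: if_splits)
    then show ?thesis by (simp add: bernoulli_half_Not)
  qed simp
  finally show ?case .
qed

lemma chi_unit_point: "S \<subseteq> {..<n} \<Longrightarrow> i \<in> S \<Longrightarrow> chi S (unit_point n i) = 1"
proof -
  assume S: "S \<subseteq> {..<n}" "i \<in> S"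
  have "chi S (unit_point n i) = (\<Sum>j\<in>S. if j = i then 1 else 0)"
    unfolding chi_def using S by (intro sum.cong) (auto simp: unit_point_def nth_list_update)
  also have "\<dots> = 1" using S finite_subset[OF S(1)] by simp
  finally show ?thesis .
qed

lemma unit_point_in_cube [simp]: "unit_point n i \<in> cube n"
  by (simp add: unit_point_def cube_def)

lemma pmf_bit_sum: "pmf p 0 + pmf p (1 :: bit) = 1"
proof -
  have "(\<Sum>b\<in>UNIV. pmf p b) = 1"
  proof (rule sum_pmf_eq_1)
    show "finite (UNIV :: bit set)" by (simp add: UNIV_bit)
  qed simp
  then show ?thesis by (simp only: UNIV_bit) simp
qed

text \<open>Translation by the unit point of some \<open>i\<close> in \<open>S\<close> preserves the
  uniform distribution and toggles the value of \<open>chi S\<close>.\<close>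

lemma prob_chi_half:
  assumes "S \<subseteq> {..<n}" "S \<noteq> {}"
  shows "pmf (map_pmf (chi S) (ucube n)) b = 1 / 2"
proof -
  obtain i where i: "i \<in> S" using assms by auto
  let ?M = "map_pmf (chi S) (ucube n)"
  have "?M = map_pmf (chi S) (map_pmf (xadd (unit_point n i)) (ucube n))"
    by (simp add: map_xadd_ucube)
  also have "\<dots> = map_pmf (\<lambda>u. 1 + chi S u) (ucube n)"
    unfolding pmf.map_comp using chi_unit_point[OF assms(1) i]
    by (intro map_pmf_cong) (auto simp: set_ucube chi_xadd[OF assms(1)])
  also have "\<dots> = map_pmf ((+) 1) ?M"
    by (simp add: pmf.map_comp o_def)
  finally have eq: "?M = map_pmf ((+) 1) ?M" .
  have "pmf (map_pmf ((+) 1) ?M) (1 + b) = pmf ?M b" for b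
    by (rule pmf_map_inj') (auto simp: inj_def)
  then have swap: "pmf ?M (1 + b) = pmf ?M b" for b using eq by simp
  have "pmf ?M 0 + pmf ?M 1 = 1" by (rule pmf_bit_sum)
  then show ?thesis using swap[of 0] by (cases b) simp_all
qed

text \<open>\<open>S\<close> is read off from the unit points. The induction is on the length
  \<open>m\<close> of a prefix that supports \<open>x\<close> and splits off one unit point at a
  time; at \<open>m = 0\<close> the point satisfies \<open>x + x = x\<close>, which forces the value
  0.\<close>

lemma additive_imp_chi:
  assumes add: "\<And>x y. x \<in> cube n \<Longrightarrow> y \<in> cube n \<Longrightarrow> g (xadd x y) = g x + (g y :: bit)"
  shows "\<exists>S \<subseteq> {..<n}. \<forall>x \<in> cube n. g x = chi S x"
proof -
  define S where "S = {i. i < n \<and> g (unit_point n i) = 1}"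
  have "g x = (\<Sum>i\<in>S \<inter> {..<m}. x ! i)"
    if "m \<le> n" "x \<in> cube n" "\<forall>i<n. m \<le> i \<longrightarrow> x ! i = 0" for m x
    using that
  proof (induction m arbitrary: x)
    case 0
    then have "xadd x x = x" by (intro nth_equalityI) (auto simp: cube_def)
    then show ?case using add[of x x] 0 by simp
  next
    case (Suc m)
    define x' where "x' = x[m := 0]"
    have x': "x' \<in> cube n" using Suc by (simp add: x'_def cube_def)
    have IH: "g x' = (\<Sum>i\<in>S \<inter> {..<m}. x' ! i)"
      using Suc.prems x' by (intro Suc.IH) (auto simp: x'_def cube_def nth_list_update)
    have sm: "(\<Sum>i\<in>S \<inter> {..<m}. x' ! i) = (\<Sum>i\<in>S \<inter> {..<m}. x ! i)"
      by (intro sum.cong) (auto simp: x'_def)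
    have "S \<inter> {..<Suc m} = (if m \<in> S then insert m (S \<inter> {..<m}) else S \<inter> {..<m})"
      by (auto simp: less_Suc_eq)
    then have split: "(\<Sum>i\<in>S \<inter> {..<Suc m}. x ! i) = (if m \<in> S then x ! m else 0) + (\<Sum>i\<in>S \<inter> {..<m}. x ! i)"
      by simp
    show ?case
    proof (cases "x ! m = 0")
      case True
      then have "x' = x" by (metis x'_def list_update_id)
      then show ?thesis using IH True split by simp
    next
      case False
      then have one: "x ! m = 1" by simp
      have "x = xadd x' (unit_point n m)"
        using Suc.prems one by (intro nth_equalityI) (auto simp: cube_def x'_def unit_point_def nth_list_update)
      then have "g x = g x' + g (unit_point n m)" using add[OF x', of "unit_point n m"] by simp
      moreover have "g (unit_point n m) = (if m \<in> S then 1 else 0)"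
        using Suc.prems by (auto simp: S_def)
      ultimately show ?thesis using IH split one sm by (simp add: add.commute)
    qed
  qed
  moreover have Sn: "S \<subseteq> {..<n}" by (auto simp: S_def)
  ultimately have "g x = chi S x" if "x \<in> cube n" for x
    using that Sn unfolding chi_def by (metis cube_def inf.absorb1 leD mem_Collect_eq order_refl)
  then show ?thesis using Sn by blast
qed

section \<open>The linearity test\<close>

lemma bit_add3_eq_0_iff: "a + b + c = 0 \<longleftrightarrow> c + b = (a :: bit)"
  by (cases a; cases b; cases c) simp_all

lemma bit_add_telescope: "a + b + (c + a) = c + (b :: bit)"
  by (cases a; cases b; cases c) simp_all

lemma pmf_bool_sum: "pmf p False + pmf p True = 1"
proof -
  have "(\<Sum>b\<in>UNIV. pmf p b) = 1" by (rule sum_pmf_eq_1) simp_all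
  then show ?thesis by (simp add: UNIV_bool)
qed

lemma prob_differ_pair:
  fixes p :: "bit pmf"
  shows "measure_pmf.prob (pair_pmf p p) {(a, b). a \<noteq> b} = 2 * (pmf p 0 * pmf p 1)"
proof -
  have "{(a, b). a \<noteq> b} = {(0, 1), (1, 0 :: bit)}"
    by auto
  then show ?thesis by (simp add: measure_measure_pmf_finite pmf_pair)
qed

context access
begin

text \<open>The outcome of one comparison round. For uniform \<open>X\<close> this is the
  Blum-Luby-Rubinfeld test, and for \<open>X = D\<close> the test that \<open>f\<close> is close to
  its correction under \<open>D\<close>, so one definition and one loop serve both.\<close>

definition consistent :: "point pmf \<Rightarrow> bool pmf" where
  "consistent X = bind_pmf X (\<lambda>x. map_pmf (\<lambda>b. b = f x) (corrected x))"

definition bad_pairs :: "(point \<times> point) set" where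
  "bad_pairs = {(r, s). f r + f s + f (xadd r s) \<noteq> 0}"

lemma consistent_ucube_False:
  "pmf (consistent (ucube n)) False = measure_pmf.prob (pair_pmf (ucube n) (ucube n)) bad_pairs"
proof -
  have "consistent (ucube n) = map_pmf (\<lambda>z. z \<notin> bad_pairs) (pair_pmf (ucube n) (ucube n))"
    unfolding consistent_def pair_pmf_def map_bind_pmf corrected_def pmf.map_comp map_return_pmf
    unfolding map_pmf_def bind_assoc_pmf bind_return_pmf
    by (intro bind_pmf_cong refl arg_cong[where f = return_pmf])
      (simp add: bad_pairs_def bit_add3_eq_0_iff)
  then show ?thesis by (simp add: pmf_map vimage_def)
qed

text \<open>For fixed \<open>x\<close>, translating one component of a uniform pair, or also
  swapping the two, gives a uniform pair again.\<close>

lemma prob_bad_shift: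
  assumes x: "x \<in> cube n"
  shows "measure_pmf.prob (pair_pmf (ucube n) (ucube n)) {(r, s). (xadd x r, s) \<in> bad_pairs}
      = measure_pmf.prob (pair_pmf (ucube n) (ucube n)) bad_pairs" (is ?A)
    and "measure_pmf.prob (pair_pmf (ucube n) (ucube n)) {(r, s). (xadd x s, r) \<in> bad_pairs}
      = measure_pmf.prob (pair_pmf (ucube n) (ucube n)) bad_pairs" (is ?B)
proof -
  let ?P = "pair_pmf (ucube n) (ucube n)"
  have 1: "?P = map_pmf (\<lambda>(r, s). (xadd x r, s)) ?P"
    using pair_map_pmf1[of "xadd x" "ucube n" "ucube n"]
    by (simp add: map_xadd_ucube[OF x] apfst_def map_prod_def)
  have 2: "?P = map_pmf (\<lambda>(r, s). (xadd x s, r)) ?P"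
  proof -
    have "map_pmf (\<lambda>(r, s). (xadd x s, r)) ?P
        = map_pmf (\<lambda>(r, s). (xadd x r, s)) (map_pmf (\<lambda>(r, s). (s, r)) ?P)"
      by (simp add: pmf.map_comp o_def case_prod_unfold)
    then show ?thesis using 1 pair_commute_pmf[of "ucube n" "ucube n"] by metis
  qed
  show ?A by (subst (2) 1) (simp add: vimage_def case_prod_unfold)
  show ?B by (subst (2) 2) (simp add: vimage_def case_prod_unfold)
qed

text \<open>Compare two independent corrected values of \<open>x\<close>, with shifts
  \<open>r\<close> and \<open>s\<close>. If neither \<open>(x + r, s)\<close> nor
  \<open>(x + s, r)\<close> is bad, then \<open>f (x + r) + f s\<close> and
  \<open>f (x + s) + f r\<close> both equal \<open>f (x + r + s)\<close>, so the corrected values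
  agree. Disagreement has probability \<open>2 p (1 - p)\<close>, and each bad event has the failure
  probability of the linearity test.\<close>

lemma self_consistency:
  assumes x: "x \<in> cube n"
  shows "pmf (corrected x) 0 * pmf (corrected x) 1 \<le> pmf (consistent (ucube n)) False"
proof -
  let ?P = "pair_pmf (ucube n) (ucube n)"
  let ?A = "\<lambda>r. f (xadd x r) + f r"
  have "2 * (pmf (corrected x) 0 * pmf (corrected x) 1) = measure_pmf.prob (pair_pmf (corrected x) (corrected x)) {(a, b). a \<noteq> b}"
    by (simp add: prob_differ_pair)
  also have "\<dots> = measure_pmf.prob ?P {(r, s). ?A r \<noteq> ?A s}"
    by (simp add: corrected_def map_pair[symmetric] vimage_def case_prod_unfold)
  also have "\<dots> \<le> measure_pmf.prob ?P ({(r, s). (xadd x r, s) \<in> bad_pairs} \<union> {(r, s). (xadd x s, r) \<in> bad_pairs})"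
  proof (rule measure_pmf.finite_measure_mono, safe)
    fix r s assume *: "?A r \<noteq> ?A s" "(xadd x s, r) \<notin> bad_pairs"
    have e: "xadd (xadd x s) r = xadd (xadd x r) s" by (metis xadd_assoc xadd_commute)
    have "f (xadd x r) + f s + f (xadd (xadd x r) s) \<noteq> 0"
      using * unfolding bad_pairs_def by (auto simp: e bit_add_eq_0_iff add_ac)
    then show "(xadd x r, s) \<in> bad_pairs" by (simp add: bad_pairs_def)
  qed simp
  also have "\<dots> \<le> measure_pmf.prob ?P {(r, s). (xadd x r, s) \<in> bad_pairs} +
      measure_pmf.prob ?P {(r, s). (xadd x s, r) \<in> bad_pairs}"
    by (rule measure_Un_le) simp_all
  also have "\<dots> = 2 * pmf (consistent (ucube n)) False"
    by (simp add: prob_bad_shift[OF x] consistent_ucube_False)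
  finally show ?thesis by simp
qed

text \<open>Strictly between \<open>1/4\<close> and \<open>3/4\<close> the product
  \<open>p (1 - p)\<close> exceeds \<open>3/16\<close>, whereas \<open>self_consistency\<close> caps
  it at \<open>1/8\<close>.\<close>

lemma majority:
  assumes "x \<in> cube n" "7 / 8 \<le> pmf (consistent (ucube n)) True"
  shows "\<exists>b. 3 / 4 \<le> pmf (corrected x) b"
proof (rule ccontr)
  assume *: "\<not> ?thesis"
  define p where "p = pmf (corrected x) 0"
  have q: "pmf (corrected x) 1 = 1 - p" using pmf_bit_sum[of "corrected x"] by (simp add: p_def)
  have "1/4 < p" "p < 3/4" using * q by (auto simp: p_def not_le field_simps dest: spec[of _ 0] spec[of _ 1])
  then have "(p - 1/4) * (3/4 - p) > 0" by simp
  moreover have "p * (1 - p) = (p - 1/4) * (3/4 - p) + 3/16" by (simp add: field_simps)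
  ultimately have "p * (1 - p) > 3/16" by linarith
  moreover have "p * (1 - p) \<le> 1/8"
    using self_consistency[OF assms(1)] q assms(2) pmf_bool_sum[of "consistent (ucube n)"] by (simp add: p_def)
  ultimately show False by simp
qed

lemma prob_ne_le:
  assumes "3 / 4 \<le> pmf (map_pmf F (ucube n)) b"
  shows "measure_pmf.prob (ucube n) {r. F r \<noteq> b} \<le> 1 / 4"
proof -
  have "{r. F r \<noteq> b} = space (measure_pmf (ucube n)) - {r. F r = b}" by auto
  then have "measure_pmf.prob (ucube n) {r. F r \<noteq> b} = 1 - measure_pmf.prob (ucube n) {r. F r = b}"
    by (metis measure_pmf.prob_compl sets_measure_pmf UNIV_I sets_UNIV)
  then show ?thesis using assms by (simp add: pmf_map vimage_def)
qed

text \<open>The majority value \<open>g\<close> is additive because one shift \<open>r\<close> can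
  be good for three corrections at once: \<open>x\<close> by \<open>r\<close>, \<open>y\<close> by
  \<open>x + r\<close>, and \<open>x + y\<close> by \<open>r\<close>. Each fails with probability at
  most \<open>1/4\<close>, so by the union bound a common good \<open>r\<close> exists, and for it
  the values of \<open>f\<close> telescope.\<close>

lemma linearity_test:
  assumes pass: "7 / 8 \<le> pmf (consistent (ucube n)) True"
  shows "\<exists>S \<subseteq> {..<n}. \<forall>x \<in> cube n. 3 / 4 \<le> pmf (corrected x) (chi S x)"
proof -
  define g where "g x = (SOME b. 3 / 4 \<le> pmf (corrected x) b)" for x
  have g: "3 / 4 \<le> pmf (corrected x) (g x)" if "x \<in> cube n" for x
    unfolding g_def using majority[OF that pass] by (rule someI_ex)
  have "g (xadd x y) = g x + g y" if x: "x \<in> cube n" and y: "y \<in> cube n" for x y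
  proof -
    let ?p = "measure_pmf.prob (ucube n)"
    define E1 where "E1 = {r. f (xadd x r) + f r \<noteq> g x}"
    define E2 where "E2 = {r. f (xadd y (xadd x r)) + f (xadd x r) \<noteq> g y}"
    define E3 where "E3 = {r. f (xadd (xadd x y) r) + f r \<noteq> g (xadd x y)}"
    have 1: "?p E1 \<le> 1 / 4" unfolding E1_def using g[OF x] by (intro prob_ne_le) (simp add: corrected_def)
    have 3: "?p E3 \<le> 1 / 4" unfolding E3_def using g[OF xadd_in_cube[OF x y]]
      by (intro prob_ne_le) (simp add: corrected_def)
    \<comment> \<open>The shift \<open>x + r\<close> is uniform as well, so correcting
      \<open>y\<close> by it has the same distribution as correcting \<open>y\<close> by
      \<open>r\<close>.\<close>
    have "corrected y = map_pmf (\<lambda>r. f (xadd y r) + f r) (map_pmf (xadd x) (ucube n))"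
      by (simp add: corrected_def map_xadd_ucube[OF x])
    then have 2: "?p E2 \<le> 1 / 4" unfolding E2_def using g[OF y]
      by (intro prob_ne_le) (simp add: pmf.map_comp o_def)
    have "?p (E1 \<union> E2 \<union> E3) \<le> ?p E1 + ?p E2 + ?p E3"
      by (intro order_trans[OF measure_Un_le] add_right_mono
          measure_Un_le) auto
    then have "?p (E1 \<union> E2 \<union> E3) < 1" using 1 2 3 by simp
    then have "\<not> set_pmf (ucube n) \<subseteq> E1 \<union> E2 \<union> E3"
      by (metis measure_pmf.prob_eq_1 AE_measure_pmf_iff less_irrefl sets_measure_pmf UNIV_I sets_UNIV subset_iff)
    then obtain r where "r \<notin> E1" "r \<notin> E2" "r \<notin> E3" by auto
    moreover have "xadd y (xadd x r) = xadd (xadd x y) r" by (metis xadd_assoc xadd_commute)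
    ultimately have "g x = f (xadd x r) + f r" "g y = f (xadd (xadd x y) r) + f (xadd x r)"
      "g (xadd x y) = f (xadd (xadd x y) r) + f r"
      by (simp_all only: E1_def E2_def E3_def mem_Collect_eq not_not)
    then show ?thesis by (simp only: bit_add_telescope)
  qed
  then obtain S where "S \<subseteq> {..<n}" "\<forall>x\<in>cube n. g x = chi S x"
    using additive_imp_chi[of n g] by blast
  then show ?thesis using g by metis
qed

text \<open>At a point where \<open>f\<close> differs from \<open>chi S\<close>, the corrected value
  equals \<open>chi S\<close> and hence contradicts \<open>f\<close> with probability at least
  \<open>3/4\<close>.\<close>

lemma inconsistent_far:
  assumes maj: "\<And>x. x \<in> cube n \<Longrightarrow> 3 / 4 \<le> pmf (corrected x) (chi S x)"
    and X: "set_pmf X \<subseteq> cube n"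
  shows "3 / 4 * measure_pmf.prob X {x. f x \<noteq> chi S x} \<le> pmf (consistent X) False"
proof -
  have "3 / 4 * measure_pmf.prob X {x. f x \<noteq> chi S x}
      = (\<integral>x. 3 / 4 * indicator {x. f x \<noteq> chi S x} x \<partial>measure_pmf X)" by simp
  also have "\<dots> \<le> (\<integral>x. pmf (map_pmf (\<lambda>b. b = f x) (corrected x)) False \<partial>measure_pmf X)"
  proof (intro integral_mono_AE)
    show "AE x in measure_pmf X. 3 / 4 * indicator {x. f x \<noteq> chi S x} x \<le> pmf (map_pmf (\<lambda>b. b = f x) (corrected x)) False"
    proof (subst AE_measure_pmf_iff, intro ballI)
      fix x assume "x \<in> set_pmf X"
      then have m: "3 / 4 \<le> pmf (corrected x) (chi S x)" using maj X by auto
      have "pmf (corrected x) (chi S x) \<le> pmf (map_pmf (\<lambda>b. b = f x) (corrected x)) False" if "f x \<noteq> chi S x"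
        unfolding pmf_map pmf.rep_eq[of "corrected x"] using that
        by (intro measure_pmf.finite_measure_mono) auto
      then show "3 / 4 * indicator {x. f x \<noteq> chi S x} x \<le> pmf (map_pmf (\<lambda>b. b = f x) (corrected x)) False"
        using m by (auto simp: indicator_def)
    qed
  qed (auto intro!: measure_pmf.integrable_const_bound[where B = 1] simp: pmf_le_1 indicator_def)
  also have "\<dots> = pmf (consistent X) False"
    by (simp add: consistent_def pmf_bind)
  finally show ?thesis .
qed

end

section \<open>Comparison with corrected queries\<close>

definition equal :: "aexp \<Rightarrow> aexp \<Rightarrow> bexp" where
  "equal a b = Conj (Neg (Less a b)) (Neg (Less b a))"

lemma bval_equal [simp]: "bval (equal a b) s \<longleftrightarrow> aval a s = aval b s"
  by (auto simp: equal_def)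

text \<open>Register \<open>e\<close> is the decrement of \<open>a\<close>: this gives \<open>\<lceil>a / e\<rceil>\<close> rounds without a division.\<close>

definition test_loop :: "com \<Rightarrow> com" where
  "test_loop samp =
    While (Less (Num 0) (Var ''a''))
     (samp ;;
      Query ''c'' ''x'' ;;
      corrected_query ;;
      Cond (equal (Var ''c'') (Var ''d'')) SKIP (Assign ''accept'' (Num 0)) ;;
      Assign ''a'' (Monus (Var ''a'') (Var ''e'')))"

lemma nn_integral_bool_pmf:
  "(\<integral>\<^sup>+ z. F z \<partial>measure_pmf p) = F True * ennreal (pmf p True) + F False * ennreal (pmf p False)"
  by (simp add: nn_integral_measure_pmf nn_integral_count_space_finite UNIV_bool add.commute mult.commute)

lemma agree_set_reg: "agree V A s s' \<Longrightarrow> v \<in> V \<Longrightarrow> agree V A s (set_reg v m s')"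
  by (auto simp: agree_def)

lemma agree_set_cell: "agree V A s s' \<Longrightarrow> a \<in> A \<Longrightarrow> agree V A s (set_cell a i m s')"
  by (auto simp: agree_def)

lemma agree_count_query: "agree V A s s' \<Longrightarrow> agree V A s (count_query s')"
  by (auto simp: agree_def)

lemmas agree_intros = agree_set_reg agree_set_cell agree_count_query

context access
begin

text \<open>Holds if \<open>f\<close> is linear on the cube.\<close>

definition exact :: bool where
  "exact \<longleftrightarrow> (\<forall>x \<in> cube n. \<forall>b \<in> set_pmf (corrected x). b = f x)"

text \<open>The specification of a program that draws a point of \<open>X\<close> into the array
  \<open>x\<close>. It lets a single loop proof cover the uniform points of the linearity test and
  the samples from \<open>D\<close>.\<close>

definition sampler :: "nat \<Rightarrow> com \<Rightarrow> nat \<Rightarrow> point pmf \<Rightarrow> bool" where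
  "sampler T c q X \<longleftrightarrow> (\<forall>s \<psi> G. regs s ''n'' = n \<longrightarrow>
     (\<forall>s' x. x \<in> set_pmf X \<longrightarrow> agree {''i'', ''b''} {''x'', ''y''} s s' \<longrightarrow> queries s' = queries s + q \<longrightarrow>
       (\<forall>i<n. arrs s' ''x'' i = of_bit (x ! i)) \<longrightarrow> \<psi> s' \<le> G x) \<longrightarrow>
     wpe T c \<psi> s \<le> (\<integral>\<^sup>+ x. G x \<partial>measure_pmf X))"

lemma samplerD:
  assumes "sampler T c q X" "regs s ''n'' = n"
    "\<And>s' x. x \<in> set_pmf X \<Longrightarrow> agree {''i'', ''b''} {''x'', ''y''} s s' \<Longrightarrow> queries s' = queries s + q \<Longrightarrow>
       \<forall>i<n. arrs s' ''x'' i = of_bit (x ! i) \<Longrightarrow> \<psi> s' \<le> G x"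
  shows "wpe T c \<psi> s \<le> (\<integral>\<^sup>+ x. G x \<partial>measure_pmf X)"
  using assms unfolding sampler_def by blast

lemma sampler_random_fill: "sampler (20 * n + 10) (random_fill ''x'') 0 (ucube n)"
  unfolding sampler_def
proof (intro allI impI)
  fix s and \<psi> G :: "_ \<Rightarrow> ennreal"
  assume n: "regs s ''n'' = n" and post: "\<forall>s' x. x \<in> set_pmf (ucube n) \<longrightarrow>
    agree {''i'', ''b''} {''x'', ''y''} s s' \<longrightarrow> queries s' = queries s + 0 \<longrightarrow>
       (\<forall>i<n. arrs s' ''x'' i = of_bit (x ! i)) \<longrightarrow> \<psi> s' \<le> G x"
  show "wpe (20 * n + 10) (random_fill ''x'') \<psi> s \<le> (\<integral>\<^sup>+ x. G x \<partial>measure_pmf (ucube n))"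
    by (rule wpe_random_fill[OF _ n]) (use post in \<open>auto simp: set_ucube cube_def\<close>)
qed

lemma sampler_Sample:
  assumes "set_pmf D \<subseteq> cube n"
  shows "sampler 1 (Sample ''x'') 1 D"
  unfolding sampler_def
proof (intro allI impI)
  fix s and \<psi> G :: "_ \<Rightarrow> ennreal"
  assume n: "regs s ''n'' = n" and post: "\<forall>s' x. x \<in> set_pmf D \<longrightarrow>
    agree {''i'', ''b''} {''x'', ''y''} s s' \<longrightarrow> queries s' = queries s + 1 \<longrightarrow>
       (\<forall>i<n. arrs s' ''x'' i = of_bit (x ! i)) \<longrightarrow> \<psi> s' \<le> G x"
  have "\<psi> (count_query (put_point n ''x'' x s)) \<le> G x" if "x \<in> set_pmf D" for x
    using that post by (auto simp: agree_def)
  then show "wpe 1 (Sample ''x'') \<psi> s \<le> (\<integral>\<^sup>+ x. G x \<partial>measure_pmf D)"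
    by (simp add: wpe_Sample nn_integral_pmf_mono)
qed

text \<open>Threshold 1 with all hash values 0 masks nothing, so the corrected queries concern the
  drawn point itself. \<open>N\<close> is \<open>a / e\<close> rounded up; its second inequality
  keeps \<open>a\<close> positive while rounds remain. A round asks \<open>qs\<close> queries for
  the point, one for \<open>f\<close> and two for the correction.\<close>

lemma wpe_test_loop:
  assumes samp: "sampler Ts samp qs X" and X: "set_pmf X \<subseteq> cube n"
  assumes n: "regs s ''n'' = n" and t: "regs s ''t'' = 1" and h: "\<forall>i<n. arrs s ''h'' i = 0"
    and e: "0 < regs s ''e''"
    and N: "regs s ''a'' \<le> N * regs s ''e''" "N * regs s ''e'' < regs s ''a'' + regs s ''e''"
  assumes post: "\<And>s'. \<lbrakk>agree {''i'', ''b'', ''u'', ''v'', ''d'', ''c'', ''a'', ''accept''} {''x'', ''y'', ''r''} s s';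
      queries s' = queries s + N * (qs + 3);
      regs s' ''accept'' = regs s ''accept'' \<or> regs s' ''accept'' = 0;
      exact \<Longrightarrow> regs s' ''accept'' = regs s ''accept''\<rbrakk>
      \<Longrightarrow> \<psi> s' \<le> (if regs s' ''accept'' = 0 then 0 else w)"
    and T: "N * (Ts + 20 * n + 50) + 1 \<le> T"
  shows "wpe T (test_loop samp) \<psi> s \<le> (if regs s ''accept'' = 0 then 0 else ennreal (pmf (consistent X) True) ^ N * w)"
proof -
  let ?V = "{''i'', ''b'', ''u'', ''v'', ''d'', ''c'', ''a'', ''accept''}" and ?A = "{''x'', ''y'', ''r''}"
  define \<rho> where "\<rho> = ennreal (pmf (consistent X) True)"
  define I where "I m s' \<longleftrightarrow> m \<le> N \<and> agree ?V ?A s s' \<and> queries s' = queries s + (N - m) * (qs + 3) \<and>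
    (regs s' ''accept'' = regs s ''accept'' \<or> regs s' ''accept'' = 0) \<and>
    (exact \<longrightarrow> regs s' ''accept'' = regs s ''accept'') \<and>
    regs s' ''a'' \<le> m * regs s ''e'' \<and> m * regs s ''e'' < regs s' ''a'' + regs s ''e''" for m and s' :: state
  \<comment> \<open>A rejected run has weight 0 for good; otherwise each remaining round contributes
    the factor \<open>\<rho>\<close>, and \<open>w\<close> stands for the weight of everything that
    follows the loop.\<close>
  define \<phi> where "\<phi> m s' = (if I m s' then (if regs s' ''accept'' = 0 then 0 else \<rho> ^ m * w) else \<infinity>)"
    for m s'
  have fin: "I m s'" if "\<phi> m s' < \<infinity>" for m s'
    using that by (simp add: \<phi>_def split: if_splits)
  have end_le: "\<psi> s' \<le> \<phi> 0 s'" for s'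
    using post[of s'] by (auto simp: \<phi>_def I_def)
  let ?fin = "Cond (equal (Var ''c'') (Var ''d'')) SKIP (Assign ''accept'' (Num 0)) ;;
      Assign ''a'' (Monus (Var ''a'') (Var ''e''))"
  have body: "wpe (Ts + 20 * n + 48) (samp ;; Query ''c'' ''x'' ;; corrected_query ;; ?fin) (\<phi> m) s1 \<le> \<phi> (Suc m) s1"
    if I: "I (Suc m) s1" for m s1
  proof -
    let ?acc = "regs s1 ''accept''"
    define K where "K = (if ?acc = 0 then 0 else \<rho> ^ m * w)"
    have ag1: "agree ?V ?A s s1" using I by (simp add: I_def)
    have n1: "regs s1 ''n'' = n" using agree_regs[OF ag1, of "''n''"] n by simp
    have "wpe (Ts + 20 * n + 48) (samp ;; Query ''c'' ''x'' ;; corrected_query ;; ?fin) (\<phi> m) s1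
      \<le> (\<integral>\<^sup>+ x. (\<integral>\<^sup>+ b. (if b = f x then K else 0) \<partial>measure_pmf (corrected x)) \<partial>measure_pmf X)"
    proof (rule wpe_Seq_le[where ?T1.0 = Ts and ?T2.0 = "20 * n + 40"], rule samplerD[OF samp n1])
      fix s2 x
      assume x: "x \<in> set_pmf X" and ag2: "agree {''i'', ''b''} {''x'', ''y''} s1 s2"
        and q2: "queries s2 = queries s1 + qs" and ax: "\<forall>i<n. arrs s2 ''x'' i = of_bit (x ! i)"
      have xc: "x \<in> cube n" using x X by auto
      define s3 where "s3 = count_query (set_reg ''c'' (of_bit (f x)) s2)"
      have ag2': "agree ?V ?A s s2" using ag1 ag2 by (rule agree_trans) auto
      have ag3: "agree ?V ?A s s3" unfolding s3_def using ag2' by (intro agree_intros) simp_all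
      have gp: "get_point n ''x'' s2 = x"
        using ax xc by (auto simp: get_point_def cube_def intro!: nth_equalityI)
      have mk: "masked n s3 = x"
        using agree_arrs[OF ag3, of "''h''"] agree_regs[OF ag3, of "''t''"] h t ax xc
        by (auto simp: masked_def cube_def s3_def intro!: nth_equalityI)
      have "wpe (20 * n + 38) (corrected_query ;; ?fin) (\<phi> m) s3
          \<le> (\<integral>\<^sup>+ b. (if b = f x then K else 0) \<partial>measure_pmf (corrected (masked n s3)))"
      proof (rule wpe_Seq_le[where ?T1.0 = "20 * n + 20" and ?T2.0 = 10], rule wpe_corrected_query)
        show "regs s3 ''n'' = n" using agree_regs[OF ag3, of "''n''"] n by simp
        fix s4 b
        assume ag4: "agree {''i'', ''b'', ''u'', ''v'', ''d''} {''r'', ''y''} s3 s4"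
          and q4: "queries s4 = queries s3 + 2"
          and b: "b \<in> set_pmf (corrected (masked n s3))" and d: "regs s4 ''d'' = of_bit b"
        define s5 where "s5 = set_reg ''a'' (regs s4 ''a'' - regs s4 ''e'')
          (if b = f x then s4 else set_reg ''accept'' 0 s4)"
        have c: "regs s4 ''c'' = of_bit (f x)" using agree_regs[OF ag4, of "''c''"] by (simp add: s3_def)
        have "wpe 10 ?fin (\<phi> m) s4 = \<phi> m s5"
          using c d by (cases b; cases "f x") (simp_all add: s5_def wpe_Seq_SKIP)
        also have "\<dots> \<le> (if b = f x then K else 0)"
        proof -
          have ag4': "agree ?V ?A s s4" using ag3 ag4 by (rule agree_trans) auto
          have ag5: "agree ?V ?A s s5" unfolding s5_def using ag4' by (auto intro!: agree_intros)
          have acc5: "regs s5 ''accept'' = (if b = f x then ?acc else 0)"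
            using agree_regs[OF ag4, of "''accept''"] agree_regs[OF ag2, of "''accept''"]
            by (simp add: s5_def s3_def)
          have a5: "regs s5 ''a'' = regs s1 ''a'' - regs s ''e''"
            using agree_regs[OF ag4, of "''a''"] agree_regs[OF ag2, of "''a''"] agree_regs[OF ag4', of "''e''"]
            by (simp add: s5_def s3_def)
          have q5: "queries s5 = queries s + (N - m) * (qs + 3)"
          proof -
            have "N - m = Suc (N - Suc m)" using I by (auto simp: I_def Suc_diff_Suc)
            then have "(N - m) * (qs + 3) = (N - Suc m) * (qs + 3) + (qs + 3)" by simp
            then show ?thesis using I q2 q4 by (simp add: s5_def s3_def I_def)
          qed
          have "exact \<Longrightarrow> b = f x" using b mk xc by (simp add: exact_def)
          then have "I m s5"
            using I ag5 acc5 a5 q5 by (auto simp: I_def)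
          then show ?thesis by (simp add: \<phi>_def acc5 K_def)
        qed
        finally show "wpe 10 ?fin (\<phi> m) s4 \<le> (if b = f x then K else 0)" .
      qed simp_all
      moreover have "wpe (20 * n + 40) (Query ''c'' ''x'' ;; corrected_query ;; ?fin) (\<phi> m) s2
          = wpe (20 * n + 40 - 2) (corrected_query ;; ?fin) (\<phi> m) s3"
        by (subst wpe_Seq_Query, simp, simp only: gp s3_def)
      moreover have "20 * n + 40 - 2 = 20 * n + (38 :: nat)" by simp
      ultimately show "wpe (20 * n + 40) (Query ''c'' ''x'' ;; corrected_query ;; ?fin) (\<phi> m) s2
        \<le> (\<integral>\<^sup>+ b. (if b = f x then K else 0) \<partial>measure_pmf (corrected x))"
        by (simp only: mk)
    qed simp
    also have "\<dots> = (\<integral>\<^sup>+ z. (if z then K else 0) \<partial>measure_pmf (consistent X))"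
      by (simp add: consistent_def nn_integral_bind_pmf)
    also have "\<dots> = \<rho> * K"
      by (simp add: nn_integral_bool_pmf \<rho>_def mult.commute)
    also have "\<dots> = \<phi> (Suc m) s1"
      using I by (simp add: \<phi>_def K_def mult.assoc)
    finally show ?thesis .
  qed
  have "wpe T (test_loop samp) \<psi> s \<le> wpe T (test_loop samp) (\<phi> 0) s"
    by (intro wpe_mono end_le)
  also have "\<dots> \<le> \<phi> N s"
    unfolding test_loop_def
  proof (rule wpe_While[where T = "Ts + 20 * n + 48"])
    fix m s' assume "\<phi> (Suc m) s' < \<infinity>"
    then have I: "I (Suc m) s'" by (rule fin)
    then have "0 < regs s' ''a''" by (auto simp: I_def)
    then show "bval (Less (Num 0) (Var ''a'')) s' \<and>
        wpe (Ts + 20 * n + 48) (samp ;; Query ''c'' ''x'' ;; corrected_query ;; ?fin) (\<phi> m) s' \<le> \<phi> (Suc m) s'"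
      using body[OF I] by (intro conjI) simp_all
  next
    fix s' assume "\<phi> 0 s' < \<infinity>"
    then have "I 0 s'" by (rule fin)
    then show "\<not> bval (Less (Num 0) (Var ''a'')) s'" by (simp add: I_def)
  qed (use T in \<open>simp add: algebra_simps\<close>)
  also have "\<phi> N s = (if regs s ''accept'' = 0 then 0 else \<rho> ^ N * w)"
    using N by (simp add: \<phi>_def I_def agree_refl)
  finally show ?thesis by (simp only: \<rho>_def)
qed

end

section \<open>Hashing and bisection\<close>

text \<open>The binary logarithm of \<open>K + 1\<close>, rounded up: the number of doublings made
  by \<open>level_loop\<close>.\<close>

definition levels :: "nat \<Rightarrow> nat" where
  "levels K = (LEAST N. K + 1 \<le> 2 ^ N)"

definition level_loop :: com where
  "level_loop =
    Assign ''L'' (Num 4) ;;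
    Assign ''g'' (Num 1) ;;
    While (Less (Var ''g'') (Plus (Var ''k'') (Num 1)))
     (Assign ''g'' (Plus (Var ''g'') (Var ''g'')) ;;
      Assign ''L'' (Plus (Var ''L'') (Num 2)))"

definition update_h :: "com \<Rightarrow> com" where
  "update_h body =
    Assign ''i'' (Num 0) ;;
    While (Less (Var ''i'') (Var ''n'')) (body ;; Assign ''i'' (Plus (Var ''i'') (Num 1)))"

text \<open>Appends the random bit \<open>x[i]\<close> to the hash value written in binary, so that
  \<open>L\<close> rounds yield values below \<open>2^L\<close>.\<close>

definition hash_cell :: com where
  "hash_cell = Store ''h'' (Var ''i'')
     (Plus (Plus (Arr ''h'' (Var ''i'')) (Arr ''h'' (Var ''i''))) (Arr ''x'' (Var ''i'')))"

text \<open>The value \<open>w[L] = 2\<^sup>L\<close> lies above all thresholds and marks removed variables.\<close>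

definition kill_cell :: com where
  "kill_cell = Cond (equal (Arr ''h'' (Var ''i'')) (Var ''lo''))
     (Store ''h'' (Var ''i'') (Arr ''w'' (Var ''L''))) SKIP"

text \<open>The powers of two are tabulated by doubling, the machine having no multiplication; the
  bisection reads its interval widths from \<open>w\<close>.\<close>

definition hash_loop :: com where
  "hash_loop =
    Store ''w'' (Num 0) (Num 1) ;;
    Assign ''j'' (Num 0) ;;
    While (Less (Var ''j'') (Var ''L''))
     (random_fill ''x'' ;;
      update_h hash_cell ;;
      Store ''w'' (Plus (Var ''j'') (Num 1)) (Plus (Arr ''w'' (Var ''j'')) (Arr ''w'' (Var ''j''))) ;;
      Assign ''j'' (Plus (Var ''j'') (Num 1)))"

text \<open>
  Bisection for a threshold \<open>lo\<close> such that the linear function changes its value between \<open>lo\<close> and \<open>lo + 1\<close>.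
\<close>

definition search_loop :: com where
  "search_loop =
    Assign ''lo'' (Num 0) ;;
    Assign ''j'' (Var ''L'') ;;
    While (Less (Num 0) (Var ''j''))
     (Assign ''j'' (Monus (Var ''j'') (Num 1)) ;;
      Assign ''t'' (Plus (Var ''lo'') (Arr ''w'' (Var ''j''))) ;;
      corrected_query ;;
      Cond (Less (Num 0) (Var ''d'')) SKIP (Assign ''lo'' (Var ''t'')))"

definition threshold_point :: "nat \<Rightarrow> (nat \<Rightarrow> nat) \<Rightarrow> (nat \<Rightarrow> nat) \<Rightarrow> nat \<Rightarrow> point" where
  "threshold_point n h x t = map (\<lambda>i. if h i < t then of_nat (x i) else 0) [0..<n]"

definition collisions :: "nat set \<Rightarrow> (nat \<Rightarrow> nat) \<Rightarrow> (nat \<times> nat) set" where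
  "collisions T h = {(i, j). i \<in> T \<and> j \<in> T \<and> i < j \<and> h i = h j}"

lemma levels_le: "K + 1 \<le> 2 ^ levels K"
  unfolding levels_def by (rule LeastI[of _ "K + 1"], rule less_imp_le, rule less_exp)

lemma levels_minimal: "m < levels K \<Longrightarrow> 2 ^ m < K + 1"
  using not_less_Least[of m "\<lambda>N. K + 1 \<le> 2 ^ N"] by (simp add: levels_def)

lemma masked_eq_threshold_point: "masked n s = threshold_point n (arrs s ''h'') (arrs s ''x'') (regs s ''t'')"
  by (simp add: masked_def threshold_point_def)

lemma set_cell_same: "set_cell a i (arrs s a i) s = s"
  by (simp add: set_cell_def)

context access
begin

lemma wpe_level_loop:
  assumes K: "regs s ''k'' = K"
  assumes post: "\<And>s'. \<lbrakk>agree {''L'', ''g''} {} s s'; queries s' = queries s;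
      regs s' ''L'' = 4 + 2 * levels K\<rbrakk> \<Longrightarrow> \<psi> s' \<le> v"
    and T: "10 * levels K + 10 \<le> T"
  shows "wpe T level_loop \<psi> s \<le> v"
proof -
  define I where "I m s' \<longleftrightarrow> agree {''L'', ''g''} {} s s' \<and> queries s' = queries s \<and> m \<le> levels K \<and>
    regs s' ''L'' = 4 + 2 * (levels K - m) \<and> regs s' ''g'' = 2 ^ (levels K - m)" for m and s' :: state
  define \<phi> where "\<phi> m s' = (if I m s' then v else \<infinity>)" for m s'
  have fin: "I m s'" if "\<phi> m s' < \<infinity>" for m s'
    using that by (simp add: \<phi>_def split: if_splits)
  have K': "regs s' ''k'' = K" if "I m s'" for m s'
    using that agree_regs[of _ _ s s' "''k''"] K by (auto simp: I_def)
  have end_le: "\<psi> s' \<le> \<phi> 0 s'" for s'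
    using post[of s'] by (auto simp: \<phi>_def I_def)
  have "wpe T level_loop \<psi> s \<le> wpe T level_loop (\<phi> 0) s"
    by (intro wpe_mono end_le)
  also have "\<dots> \<le> \<phi> (levels K) (set_reg ''g'' 1 (set_reg ''L'' 4 s))"
    unfolding level_loop_def
  proof (subst wpe_Seq_Assign, use T in simp, subst wpe_Seq_Assign, use T in simp,
      simp only: aval.simps, rule wpe_While[where T = 5])
    fix m s' assume "\<phi> (Suc m) s' < \<infinity>"
    then have I: "I (Suc m) s'" by (rule fin)
    have "2 ^ (levels K - Suc m) < K + 1"
      by (rule levels_minimal) (use I in \<open>auto simp: I_def\<close>)
    moreover have "levels K - m = Suc (levels K - Suc m)" using I by (auto simp: I_def)
    then have "I m (set_reg ''L'' (regs s' ''L'' + 2) (set_reg ''g'' (regs s' ''g'' + regs s' ''g'') s'))"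
      using I by (auto simp: I_def intro!: agree_intros)
    ultimately show "bval (Less (Var ''g'') (Plus (Var ''k'') (Num 1))) s' \<and>
        wpe 5 (Assign ''g'' (Plus (Var ''g'') (Var ''g'')) ;; Assign ''L'' (Plus (Var ''L'') (Num 2))) (\<phi> m) s'
          \<le> \<phi> (Suc m) s'"
      using I K'[OF I] by (simp add: I_def[of "Suc m"] \<phi>_def)
  next
    fix s' assume "\<phi> 0 s' < \<infinity>"
    then have I: "I 0 s'" by (rule fin)
    then show "\<not> bval (Less (Var ''g'') (Plus (Var ''k'') (Num 1))) s'"
      using levels_le[of K] K'[OF I] by (simp add: I_def)
  qed (use T in simp)
  also have "\<dots> = v"
    by (simp add: \<phi>_def I_def agree_def)
  finally show ?thesis .
qed

text \<open>Every cell is visited once, so \<open>body\<close> may assume that its cell still holds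
  the original value. Hashing and removal of a block are both reduced to their effect on one
  cell.\<close>

lemma wpe_update_h:
  assumes n: "regs s ''n'' = n"
  assumes body: "\<And>s' \<psi>. \<lbrakk>agree {''i''} {''h''} s s'; regs s' ''i'' < n;
      arrs s' ''h'' (regs s' ''i'') = arrs s ''h'' (regs s' ''i'')\<rbrakk>
      \<Longrightarrow> wpe 5 body \<psi> s' \<le> \<psi> (set_cell ''h'' (regs s' ''i'') (F (regs s' ''i'')) s')"
  assumes post: "\<And>s'. \<lbrakk>agree {''i''} {''h''} s s'; queries s' = queries s;
      \<forall>i<n. arrs s' ''h'' i = F i\<rbrakk> \<Longrightarrow> \<psi> s' \<le> v"
    and T: "10 * n + 5 \<le> T"
  shows "wpe T (update_h body) \<psi> s \<le> v"
proof -
  define I where "I m s' \<longleftrightarrow> agree {''i''} {''h''} s s' \<and> queries s' = queries s \<and> regs s' ''i'' + m = n \<and>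
    (\<forall>i<regs s' ''i''. arrs s' ''h'' i = F i) \<and> (\<forall>i\<ge>regs s' ''i''. arrs s' ''h'' i = arrs s ''h'' i)"
    for m and s' :: state
  define \<phi> where "\<phi> m s' = (if I m s' then v else \<infinity>)" for m s'
  have fin: "I m s'" if "\<phi> m s' < \<infinity>" for m s'
    using that by (simp add: \<phi>_def split: if_splits)
  have n': "regs s' ''n'' = n" if "I m s'" for m s'
    using that agree_regs[of _ _ s s' "''n''"] n by (auto simp: I_def)
  have end_le: "\<psi> s' \<le> \<phi> 0 s'" for s'
    using post[of s'] by (auto simp: \<phi>_def I_def)
  have "wpe T (update_h body) \<psi> s \<le> wpe T (update_h body) (\<phi> 0) s"
    by (intro wpe_mono end_le)
  also have "\<dots> \<le> \<phi> n (set_reg ''i'' 0 s)"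
    unfolding update_h_def
  proof (subst wpe_Seq_Assign, use T in simp, simp only: aval.simps, rule wpe_While[where T = 8])
    fix m s' assume "\<phi> (Suc m) s' < \<infinity>"
    then have I: "I (Suc m) s'" by (rule fin)
    let ?i = "regs s' ''i''"
    let ?s = "set_reg ''i'' (Suc ?i) (set_cell ''h'' ?i (F ?i) s')"
    have "wpe 8 (body ;; Assign ''i'' (Plus (Var ''i'') (Num 1))) (\<phi> m) s'
        \<le> wpe 5 body (wpe 2 (Assign ''i'' (Plus (Var ''i'') (Num 1))) (\<phi> m)) s'"
      by (rule wpe_Seq) simp
    also have "\<dots> \<le> \<phi> m ?s"
      by (rule order_trans[OF body]) (use I in \<open>simp_all add: I_def\<close>)
    also have "I m ?s" using I by (auto simp: I_def less_Suc_eq intro!: agree_intros)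
    then have "\<phi> m ?s = \<phi> (Suc m) s'" using I by (simp add: \<phi>_def)
    finally show "bval (Less (Var ''i'') (Var ''n'')) s' \<and>
        wpe 8 (body ;; Assign ''i'' (Plus (Var ''i'') (Num 1))) (\<phi> m) s' \<le> \<phi> (Suc m) s'"
      using n'[OF I] I by (simp add: I_def)
  next
    fix s' assume "\<phi> 0 s' < \<infinity>"
    then have I: "I 0 s'" by (rule fin)
    then show "\<not> bval (Less (Var ''i'') (Var ''n'')) s'"
      using n'[OF I] by (simp add: I_def)
  qed (use T in simp)
  also have "\<dots> = v"
    by (simp add: \<phi>_def I_def agree_def)
  finally show ?thesis .
qed

lemma wpe_kill:
  assumes n: "regs s ''n'' = n"
  assumes post: "\<And>s'. \<lbrakk>agree {''i''} {''h''} s s'; queries s' = queries s;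
      \<forall>i<n. arrs s' ''h'' i = (if arrs s ''h'' i = regs s ''lo'' then arrs s ''w'' (regs s ''L'') else arrs s ''h'' i)\<rbrakk>
      \<Longrightarrow> \<psi> s' \<le> v"
    and T: "10 * n + 5 \<le> T"
  shows "wpe T (update_h kill_cell) \<psi> s \<le> v"
proof (rule wpe_update_h[OF n _ post T])
  fix s' :: state and \<psi> :: "state \<Rightarrow> ennreal"
  let ?i = "regs s' ''i''"
  assume ag: "agree {''i''} {''h''} s s'" and h: "arrs s' ''h'' ?i = arrs s ''h'' ?i"
  have "regs s' ''lo'' = regs s ''lo''" "regs s' ''L'' = regs s ''L''" "arrs s' ''w'' = arrs s ''w''"
    using ag by (auto simp: agree_def)
  then show "wpe 5 kill_cell \<psi> s' \<le> \<psi> (set_cell ''h'' ?i (if arrs s ''h'' ?i = regs s ''lo''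
      then arrs s ''w'' (regs s ''L'') else arrs s ''h'' ?i) s')"
    using h set_cell_same[of "''h''" ?i s'] by (simp add: kill_cell_def)
qed

lemma wpe_hash_cells:
  assumes n: "regs s ''n'' = n"
  assumes post: "\<And>s'. \<lbrakk>agree {''i''} {''h''} s s'; queries s' = queries s;
      \<forall>i<n. arrs s' ''h'' i = 2 * arrs s ''h'' i + arrs s ''x'' i\<rbrakk> \<Longrightarrow> \<psi> s' \<le> v"
    and T: "10 * n + 5 \<le> T"
  shows "wpe T (update_h hash_cell) \<psi> s \<le> v"
proof (rule wpe_update_h[OF n _ post T])
  fix s' :: state and \<psi> :: "state \<Rightarrow> ennreal"
  let ?i = "regs s' ''i''"
  assume ag: "agree {''i''} {''h''} s s'" and h: "arrs s' ''h'' ?i = arrs s ''h'' ?i"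
  have "arrs s' ''x'' = arrs s ''x''"
    using ag by (auto simp: agree_def)
  then show "wpe 5 hash_cell \<psi> s' \<le> \<psi> (set_cell ''h'' ?i (2 * arrs s ''h'' ?i + arrs s ''x'' ?i) s')"
    using h by (simp add: hash_cell_def mult_2)
qed

end

section \<open>Expected number of hash collisions\<close>

lemma prob_equal_coords:
  assumes "i < j" "j < n"
  shows "emeasure (measure_pmf (ucube n)) {u. u ! i = u ! j} = 1 / 2"
proof -
  have "chi {i, j} u = u ! i + u ! j" for u
    using assms by (simp add: chi_def)
  then have "{u. u ! i = u ! j} = chi {i, j} -` {0}"
    by (auto simp: bit_add_eq_0_iff)
  then have "measure_pmf.prob (ucube n) {u. u ! i = u ! j} = 1 / 2"
    using prob_chi_half[of "{i, j}" n 0] assms by (simp add: pmf_map)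
  then show ?thesis
    using ennreal_divide_numeral[of 1 "num.Bit0 num.One"]
    by (simp only: measure_pmf.emeasure_eq_measure ennreal_1 zero_le_one simp_thms)
qed

text \<open>Linearity of expectation: each pair of \<open>C\<close> survives the next random bit
  with probability \<open>1/2\<close>.\<close>

lemma expected_collisions:
  assumes C: "finite C" "C \<subseteq> {(i, j). i < j \<and> j < n}"
  shows "(\<integral>\<^sup>+ u. of_nat (card {(i, j) \<in> C. u ! i = u ! j}) \<partial>measure_pmf (ucube n)) = of_nat (card C) / 2"
proof -
  have "(of_nat (card {(i, j) \<in> C. u ! i = u ! j}) :: ennreal) = (\<Sum>(i, j)\<in>C. indicator {u. u ! i = u ! j} u)" for u :: point
  proof -
    have "(\<Sum>(i, j)\<in>C. indicator {u. u ! i = u ! j} u) = (\<Sum>z\<in>C. if z \<in> {(i, j). u ! i = u ! j} then 1 else (0::ennreal))"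
      by (intro sum.cong) (auto simp: indicator_def)
    also have "\<dots> = of_nat (card (C \<inter> {(i, j). u ! i = u ! j}))"
      using C by (simp add: sum.If_cases)
    finally show ?thesis by (simp add: Int_def case_prod_unfold)
  qed
  then have "(\<integral>\<^sup>+ u. of_nat (card {(i, j) \<in> C. u ! i = u ! j}) \<partial>measure_pmf (ucube n))
      = (\<Sum>z\<in>C. \<integral>\<^sup>+ u. indicator {u. u ! fst z = u ! snd z} u \<partial>measure_pmf (ucube n))"
    by (simp add: nn_integral_sum case_prod_unfold)
  also have "\<dots> = (\<Sum>z\<in>C. 1 / 2)"
    using C by (intro sum.cong) (auto simp: prob_equal_coords)
  finally show ?thesis by (simp add: ennreal_times_divide)
qed

lemma finite_collisions: "finite T \<Longrightarrow> finite (collisions T h)"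
  by (rule finite_subset[of _ "T \<times> T"]) (auto simp: collisions_def)

lemma card_collisions_le: "finite T \<Longrightarrow> card (collisions T h) \<le> (card T)\<^sup>2"
proof -
  assume T: "finite T"
  have "card (collisions T h) \<le> card (T \<times> T)"
    using T by (intro card_mono) (auto simp: collisions_def)
  then show ?thesis by (simp add: power2_eq_square card_cartesian_product)
qed

lemma collisions_hash:
  assumes "T \<subseteq> {..<n}" "\<forall>i<n. h' i = 2 * h i + of_bit (u ! i)"
  shows "collisions T h' = {(i, j) \<in> collisions T h. u ! i = u ! j}"
proof -
  have "h' i = h' j \<longleftrightarrow> h i = h j \<and> u ! i = u ! j" if "i \<in> T" "j \<in> T" for i j
  proof -
    have "2 * a + of_bit b = 2 * c + of_bit d \<longleftrightarrow> a = c \<and> b = d" for a c :: nat and b d :: bit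
      by (cases b; cases d; auto; presburger)
    then show ?thesis using that assms by (auto simp: subset_eq)
  qed
  then show ?thesis by (auto simp: collisions_def)
qed

context access
begin

text \<open>The bound on \<open>\<psi>\<close> is affine in the number of collisions, since only the
  expectation of that number is controlled. It halves in each of the \<open>L\<close> rounds, from
  at most \<open>(card T)^2\<close> pairs at the start, where all hash values are 0.\<close>

lemma wpe_hash_loop:
  assumes n: "regs s ''n'' = n" and L: "regs s ''L'' = L" and h: "\<forall>i<n. arrs s ''h'' i = 0"
    and T: "T \<subseteq> {..<n}"
  assumes post: "\<And>s'. \<lbrakk>agree {''i'', ''b'', ''j''} {''x'', ''y'', ''h'', ''w''} s s'; queries s' = queries s;
      \<forall>j\<le>L. arrs s' ''w'' j = 2 ^ j; \<forall>i<n. arrs s' ''h'' i < 2 ^ L\<rbrakk>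
      \<Longrightarrow> \<psi> s' \<le> v + v' * of_nat (card (collisions T (arrs s' ''h'')))"
    and Ti: "L * (30 * n + 40) + 10 \<le> Ti"
  shows "wpe Ti hash_loop \<psi> s \<le> v + v' * (of_nat ((card T)\<^sup>2) / 2 ^ L)"
proof -
  let ?V = "{''i'', ''b'', ''j''}" and ?A = "{''x'', ''y'', ''h'', ''w''}"
  have finT: "finite T" using T finite_subset by blast
  define I where "I m s' \<longleftrightarrow> agree ?V ?A s s' \<and> queries s' = queries s \<and> regs s' ''j'' + m = L \<and>
    (\<forall>j\<le>regs s' ''j''. arrs s' ''w'' j = 2 ^ j) \<and> (\<forall>i<n. arrs s' ''h'' i < 2 ^ regs s' ''j'')"
    for m and s' :: state
  define \<phi> where "\<phi> m s' = (if I m s' then v + v' * (of_nat (card (collisions T (arrs s' ''h''))) / 2 ^ m) else \<infinity>)"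
    for m s'
  have fin: "I m s'" if "\<phi> m s' < \<infinity>" for m s'
    using that by (simp add: \<phi>_def split: if_splits)
  have n': "regs s' ''n'' = n" if "I m s'" for m s'
    using that agree_regs[of _ _ s s' "''n''"] n by (auto simp: I_def)
  have L': "regs s' ''L'' = L" if "I m s'" for m s'
    using that agree_regs[of _ _ s s' "''L''"] L by (auto simp: I_def)
  have end_le: "\<psi> s' \<le> \<phi> 0 s'" for s'
    using post[of s'] by (auto simp: \<phi>_def I_def divide_ennreal_def)
  let ?last = "Store ''w'' (Plus (Var ''j'') (Num 1)) (Plus (Arr ''w'' (Var ''j'')) (Arr ''w'' (Var ''j''))) ;;
      Assign ''j'' (Plus (Var ''j'') (Num 1))"
  have body: "wpe (30 * n + 35) (random_fill ''x'' ;; update_h hash_cell ;; ?last) (\<phi> m) s1 \<le> \<phi> (Suc m) s1"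
    if I: "I (Suc m) s1" for m s1
  proof -
    let ?C = "collisions T (arrs s1 ''h'')"
    have "wpe (30 * n + 35) (random_fill ''x'' ;; update_h hash_cell ;; ?last) (\<phi> m) s1
      \<le> (\<integral>\<^sup>+ u. v + v' * (of_nat (card {(i, j) \<in> ?C. u ! i = u ! j}) / 2 ^ m) \<partial>measure_pmf (ucube n))"
    proof (rule wpe_Seq_le[where ?T1.0 = "20 * n + 10" and ?T2.0 = "10 * n + 20"],
        rule wpe_random_fill[OF _ n'[OF I]], simp)
      fix s2 u
      assume u: "length u = n" and ag2: "agree {''i'', ''b''} {''x'', ''y''} s1 s2"
        and q2: "queries s2 = queries s1" and x2: "\<forall>i<n. arrs s2 ''x'' i = of_bit (u ! i)"
      have n2: "regs s2 ''n'' = n" using agree_regs[OF ag2, of "''n''"] n'[OF I] by simp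
      have h2: "arrs s2 ''h'' = arrs s1 ''h''" using agree_arrs[OF ag2, of "''h''"] by simp
      show "wpe (10 * n + 20) (update_h hash_cell ;; ?last) (\<phi> m) s2
          \<le> v + v' * (of_nat (card {(i, j) \<in> ?C. u ! i = u ! j}) / 2 ^ m)"
      proof (rule wpe_Seq_le[where ?T1.0 = "10 * n + 5" and ?T2.0 = 10], rule wpe_hash_cells[OF n2])
        fix s3
        assume ag3: "agree {''i''} {''h''} s2 s3" and q3: "queries s3 = queries s2"
          and h3: "\<forall>i<n. arrs s3 ''h'' i = 2 * arrs s2 ''h'' i + arrs s2 ''x'' i"
        let ?j = "regs s1 ''j''"
        have j3: "regs s3 ''j'' = ?j" and w3: "arrs s3 ''w'' = arrs s1 ''w''"
          using ag2 ag3 by (simp_all add: agree_def)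
        define s4 where "s4 = set_reg ''j'' (Suc ?j) (set_cell ''w'' (Suc ?j) (2 ^ Suc ?j) s3)"
        have "wpe 10 ?last (\<phi> m) s3 = \<phi> m s4"
          using I by (simp add: s4_def j3 w3 I_def mult_2)
        moreover have "I m s4"
        proof -
          have "agree ?V ?A s s3"
            using I ag2 ag3 by (auto simp: I_def intro: agree_trans[of ?V ?A s s2 "{''i''}" "{''h''}"]
                agree_trans[of ?V ?A s s1 "{''i'', ''b''}" "{''x'', ''y''}"])
          then have "agree ?V ?A s s4" by (auto simp: s4_def intro!: agree_intros)
          moreover have "arrs s4 ''h'' i < 2 ^ Suc ?j" if "i < n" for i
          proof -
            have "arrs s1 ''h'' i < 2 ^ ?j" using I that by (simp add: I_def)
            moreover have "arrs s4 ''h'' i = 2 * arrs s1 ''h'' i + of_bit (u ! i)"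
              using h3 x2 h2 that by (simp add: s4_def)
            ultimately show ?thesis by (cases "u ! i") simp_all
          qed
          moreover have "\<forall>j\<le>Suc ?j. arrs s4 ''w'' j = 2 ^ j"
            using I by (auto simp: s4_def w3 I_def le_Suc_eq)
          ultimately show ?thesis
            using I q2 q3 by (simp add: I_def s4_def)
        qed
        moreover have "collisions T (arrs s4 ''h'') = {(i, j) \<in> ?C. u ! i = u ! j}"
          by (rule collisions_hash[OF T]) (use h3 x2 h2 in \<open>simp add: s4_def\<close>)
        ultimately show "wpe 10 ?last (\<phi> m) s3
            \<le> v + v' * (of_nat (card {(i, j) \<in> ?C. u ! i = u ! j}) / 2 ^ m)"
          by (simp add: \<phi>_def)
      qed simp_all
    qed simp_all
    also have "\<dots> = v + v' * ((\<integral>\<^sup>+ u. of_nat (card {(i, j) \<in> ?C. u ! i = u ! j}) \<partial>measure_pmf (ucube n)) / 2 ^ m)"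
      by (simp add: nn_integral_add nn_integral_cmult nn_integral_divide)
    also have "\<dots> = v + v' * (of_nat (card ?C) / 2 / 2 ^ m)"
      by (subst expected_collisions) (use T finite_collisions[OF finT] in \<open>auto simp: collisions_def\<close>)
    also have "\<dots> = \<phi> (Suc m) s1"
      using I by (simp add: \<phi>_def divide_ennreal_def ennreal_inverse_mult mult.assoc power_less_top_ennreal)
    finally show ?thesis .
  qed
  define s0 where "s0 = set_reg ''j'' 0 (set_cell ''w'' 0 1 s)"
  have "wpe Ti hash_loop \<psi> s \<le> wpe Ti hash_loop (\<phi> 0) s"
    by (intro wpe_mono end_le)
  also have "\<dots> \<le> \<phi> L s0"
    unfolding hash_loop_def s0_def
  proof (subst wpe_Seq_Store, use Ti in simp, subst wpe_Seq_Assign, use Ti in simp,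
      simp only: aval.simps, rule wpe_While[where T = "30 * n + 35"])
    fix m s' assume "\<phi> (Suc m) s' < \<infinity>"
    then have I: "I (Suc m) s'" by (rule fin)
    show "bval (Less (Var ''j'') (Var ''L'')) s' \<and>
        wpe (30 * n + 35) (random_fill ''x'' ;; update_h hash_cell ;; ?last) (\<phi> m) s' \<le> \<phi> (Suc m) s'"
      using body[OF I] I L'[OF I] by (intro conjI) (auto simp: I_def)
  next
    fix s' assume "\<phi> 0 s' < \<infinity>"
    then have I: "I 0 s'" by (rule fin)
    then show "\<not> bval (Less (Var ''j'') (Var ''L'')) s'"
      using L'[OF I] by (simp add: I_def)
  qed (use Ti in \<open>simp add: algebra_simps\<close>)
  also have "\<phi> L s0 = v + v' * (of_nat (card (collisions T (arrs s ''h''))) / 2 ^ L)"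
    using h by (simp add: \<phi>_def I_def s0_def agree_def)
  also have "\<dots> \<le> v + v' * (of_nat ((card T)\<^sup>2) / 2 ^ L)"
    by (intro add_left_mono mult_left_mono divide_right_mono_ennreal)
      (simp_all only: of_nat_le_iff card_collisions_le[OF finT] zero_le)
  finally show ?thesis .
qed

section \<open>Bisection for a block with a relevant variable\<close>

lemma f_exact:
  assumes exact "x \<in> cube n" "r \<in> cube n"
  shows "f (xadd x r) = f x + f r"
proof -
  have "f (xadd x r) + f r = f x"
    using assms unfolding exact_def by (auto simp: corrected_def set_ucube)
  then have "f (xadd x r) + f r + f r = f x + f r" by simp
  then show ?thesis by (simp add: add.assoc)
qed

lemma threshold_point_in_cube [simp]: "threshold_point n h x t \<in> cube n"
  by (simp add: threshold_point_def cube_def)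

lemma f_threshold_point_0:
  assumes exact
  shows "f (threshold_point n h x 0) = 0"
proof -
  have "xadd (threshold_point n h x 0) (threshold_point n h x 0) = threshold_point n h x 0"
    by (rule nth_equalityI) (auto simp: threshold_point_def)
  then show ?thesis using f_exact[OF assms, of "threshold_point n h x 0" "threshold_point n h x 0"] by simp
qed

lemma wpe_search_loop:
  assumes n: "regs s ''n'' = n" and L: "regs s ''L'' = L" and w: "\<forall>j\<le>L. arrs s ''w'' j = 2 ^ j"
  assumes post: "\<And>s'. \<lbrakk>agree {''i'', ''b'', ''u'', ''v'', ''d'', ''t'', ''lo'', ''j''} {''r'', ''y''} s s';
      queries s' = queries s + 2 * L;
      exact \<Longrightarrow> f (threshold_point n (arrs s ''h'') (arrs s ''x'') (2 ^ L)) = 1 \<Longrightarrow>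
        f (threshold_point n (arrs s ''h'') (arrs s ''x'') (regs s' ''lo'')) = 0 \<and>
        f (threshold_point n (arrs s ''h'') (arrs s ''x'') (Suc (regs s' ''lo''))) = 1 \<and> regs s' ''lo'' < 2 ^ L\<rbrakk>
      \<Longrightarrow> \<psi> s' \<le> v"
    and Ti: "L * (20 * n + 40) + 10 \<le> Ti"
  shows "wpe Ti search_loop \<psi> s \<le> v"
proof -
  let ?V = "{''i'', ''b'', ''u'', ''v'', ''d'', ''t'', ''lo'', ''j''}" and ?A = "{''r'', ''y''}"
  let ?F = "\<lambda>t. f (threshold_point n (arrs s ''h'') (arrs s ''x'') t)"
  \<comment> \<open>The interval from \<open>lo\<close> to \<open>lo + 2^m\<close> has value 0 at
    its left and 1 at its right end. This is claimed only for exact \<open>f\<close> and a true hit;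
    in all other cases just the cost of the search is recorded.\<close>
  define I where "I m s' \<longleftrightarrow> agree ?V ?A s s' \<and> m \<le> L \<and> queries s' = queries s + 2 * (L - m) \<and> regs s' ''j'' = m \<and>
    (exact \<longrightarrow> ?F (2 ^ L) = 1 \<longrightarrow> ?F (regs s' ''lo'') = 0 \<and> ?F (regs s' ''lo'' + 2 ^ m) = 1 \<and>
      regs s' ''lo'' + 2 ^ m \<le> 2 ^ L)" for m and s' :: state
  define \<phi> where "\<phi> m s' = (if I m s' then v else \<infinity>)" for m s'
  have fin: "I m s'" if "\<phi> m s' < \<infinity>" for m s'
    using that by (simp add: \<phi>_def split: if_splits)
  have end_le: "\<psi> s' \<le> \<phi> 0 s'" for s'
    using post[of s'] by (auto simp: \<phi>_def I_def)
  let ?body = "Assign ''j'' (Monus (Var ''j'') (Num 1)) ;;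
      Assign ''t'' (Plus (Var ''lo'') (Arr ''w'' (Var ''j''))) ;;
      corrected_query ;; Cond (Less (Num 0) (Var ''d'')) SKIP (Assign ''lo'' (Var ''t''))"
  have body: "wpe (20 * n + 35) ?body (\<phi> m) s1 \<le> v" if I: "I (Suc m) s1" for m s1
  proof -
    let ?lo = "regs s1 ''lo''"
    have ag1: "agree ?V ?A s s1" using I by (simp add: I_def)
    have w1: "arrs s1 ''w'' m = 2 ^ m"
      using I w agree_arrs[OF ag1, of "''w''"] by (simp add: I_def)
    define s2 where "s2 = set_reg ''t'' (?lo + 2 ^ m) (set_reg ''j'' m s1)"
    have ag2: "agree ?V ?A s s2" unfolding s2_def using ag1 by (auto intro!: agree_intros)
    have mk: "masked n s2 = threshold_point n (arrs s ''h'') (arrs s ''x'') (?lo + 2 ^ m)"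
      using agree_arrs[OF ag2, of "''h''"] agree_arrs[OF ag2, of "''x''"]
      by (simp add: masked_eq_threshold_point) (simp add: s2_def)
    have "wpe (20 * n + 35) ?body (\<phi> m) s1 = wpe (20 * n + 35 - 2 - 2)
        (corrected_query ;; Cond (Less (Num 0) (Var ''d'')) SKIP (Assign ''lo'' (Var ''t''))) (\<phi> m) s2"
      using I w1 by (subst wpe_Seq_Assign, simp, subst wpe_Seq_Assign, simp) (simp add: s2_def I_def)
    also have "\<dots> \<le> (\<integral>\<^sup>+ b. v \<partial>measure_pmf (corrected (masked n s2)))"
    proof (rule wpe_Seq_le[where ?T1.0 = "20 * n + 20" and ?T2.0 = 5], rule wpe_corrected_query)
      show "regs s2 ''n'' = n" using agree_regs[OF ag2, of "''n''"] n by simp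
      fix s3 b
      assume ag3: "agree {''i'', ''b'', ''u'', ''v'', ''d''} {''r'', ''y''} s2 s3"
        and q3: "queries s3 = queries s2 + 2"
        and b: "b \<in> set_pmf (corrected (masked n s2))" and d: "regs s3 ''d'' = of_bit b"
      define s4 where "s4 = (if b = 1 then s3 else set_reg ''lo'' (regs s3 ''t'') s3)"
      have "wpe 5 (Cond (Less (Num 0) (Var ''d'')) SKIP (Assign ''lo'' (Var ''t''))) (\<phi> m) s3 = \<phi> m s4"
        using d by (cases b) (simp_all add: s4_def)
      moreover have "I m s4"
      proof -
        have "agree ?V ?A s s3" using ag2 ag3 by (rule agree_trans) auto
        then have "agree ?V ?A s s4" by (auto simp: s4_def intro!: agree_intros)
        moreover have "regs s3 ''lo'' = ?lo" "regs s3 ''t'' = ?lo + 2 ^ m" "regs s3 ''j'' = m"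
          using agree_regs[OF ag3, of "''lo''"] agree_regs[OF ag3, of "''t''"] agree_regs[OF ag3, of "''j''"]
          by (simp_all add: s2_def)
        moreover have "queries s4 = queries s + 2 * (L - m)"
          using I q3 by (auto simp: s4_def s2_def I_def)
        moreover have "b = ?F (?lo + 2 ^ m)" if exact
          using that b mk by (simp add: exact_def)
        ultimately show ?thesis
          using I by (cases b) (auto simp: I_def s4_def add.assoc mult_2)
      qed
      ultimately show "wpe 5 (Cond (Less (Num 0) (Var ''d'')) SKIP (Assign ''lo'' (Var ''t''))) (\<phi> m) s3 \<le> v"
        by (simp add: \<phi>_def)
    qed simp_all
    finally show ?thesis by simp
  qed
  define s0 where "s0 = set_reg ''j'' L (set_reg ''lo'' 0 s)"
  have "wpe Ti search_loop \<psi> s \<le> wpe Ti search_loop (\<phi> 0) s"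
    by (intro wpe_mono end_le)
  also have "\<dots> \<le> \<phi> L s0"
    unfolding search_loop_def
  proof (subst wpe_Seq_Assign, use Ti in simp, subst wpe_Seq_Assign, use Ti in simp,
      rule wpe_While[where T = "20 * n + 35", THEN order_trans])
    fix m s' assume "\<phi> (Suc m) s' < \<infinity>"
    then have I: "I (Suc m) s'" by (rule fin)
    show "bval (Less (Num 0) (Var ''j'')) s' \<and> wpe (20 * n + 35) ?body (\<phi> m) s' \<le> \<phi> (Suc m) s'"
    proof
      show "bval (Less (Num 0) (Var ''j'')) s'" using I by (simp add: I_def)
      show "wpe (20 * n + 35) ?body (\<phi> m) s' \<le> \<phi> (Suc m) s'"
        using body[OF I] I by (simp only: \<phi>_def if_True)
    qed
  next
    fix s' assume "\<phi> 0 s' < \<infinity>"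
    then have I: "I 0 s'" by (rule fin)
    then show "\<not> bval (Less (Num 0) (Var ''j'')) s'" by (simp add: I_def)
  next
    show "L * (20 * n + 35 + 2) + 1 \<le> Ti - 2 - 2" using Ti by (simp add: algebra_simps)
  qed (use L in \<open>simp add: s0_def\<close>)
  \<comment> \<open>At the left end \<open>lo = 0\<close> the threshold masks every variable, and an
    exact \<open>f\<close> vanishes on the zero point.\<close>
  also have "\<phi> L s0 = v"
    using f_threshold_point_0[of "arrs s ''h''" "arrs s ''x''"] by (auto simp: \<phi>_def I_def s0_def agree_def)
  finally show ?thesis .
qed

end

section \<open>Counting relevant variables\<close>

definition find_loop :: com where
  "find_loop =
    While (Less (Num 0) (Var ''m''))
     (random_fill ''x'' ;;
      Assign ''t'' (Arr ''w'' (Var ''L'')) ;;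
      corrected_query ;;
      Cond (Less (Num 0) (Var ''d''))
        (search_loop ;; update_h kill_cell ;; Assign ''cc'' (Plus (Var ''cc'') (Num 1)))
        SKIP ;;
      Assign ''m'' (Monus (Var ''m'') (Num 1)))"

lemma threshold_point_cong:
  assumes "\<And>i. i < n \<Longrightarrow> h i = h' i" "\<And>i. i < n \<Longrightarrow> x i = x' i"
  shows "threshold_point n h x t = threshold_point n h' x' t"
  using assms by (simp add: threshold_point_def)

text \<open>The two points differ at most in variables of hash value \<open>t\<close>, so a change
  of \<open>chi S\<close> exposes a relevant variable in that block.\<close>

lemma chi_threshold_point_differ:
  assumes "S \<subseteq> {..<n}" "chi S (threshold_point n h x t) \<noteq> chi S (threshold_point n h x (Suc t))"
  shows "\<exists>i\<in>S. h i = t"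
proof (rule ccontr)
  assume "\<not> ?thesis"
  then have "chi S (threshold_point n h x t) = chi S (threshold_point n h x (Suc t))"
    unfolding chi_def using assms(1)
    by (intro sum.cong refl) (auto simp: threshold_point_def subset_eq less_Suc_eq)
  then show False using assms(2) by simp
qed

context access
begin

definition linear_on :: "nat set \<Rightarrow> bool" where
  "linear_on S \<longleftrightarrow> S \<subseteq> {..<n} \<and> (\<forall>x\<in>cube n. f x = chi S x)"

lemma linear_on_exact: "linear_on S \<Longrightarrow> exact"
  by (auto simp: linear_on_def exact_def corrected_def set_ucube xadd_in_cube chi_xadd add.assoc)

text \<open>
  \<open>B m c\<close> bounds the value with \<open>m\<close> rounds left after \<open>c\<close> hits, under an invariant of the hash values and \<open>c\<close>.
\<close>

lemma wpe_find_loop: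
  fixes B :: "nat \<Rightarrow> nat \<Rightarrow> ennreal" and Inv :: "(nat \<Rightarrow> nat) \<Rightarrow> nat \<Rightarrow> bool"
  assumes n: "regs s ''n'' = n" and L: "regs s ''L'' = L" and w: "\<forall>j\<le>L. arrs s ''w'' j = 2 ^ j"
    and m: "regs s ''m'' = R" and cc: "regs s ''cc'' = 0"
    and Inv0: "Inv (arrs s ''h'') 0"
    and Inv_kill: "\<And>h h' lo c. Inv h c \<Longrightarrow> \<forall>i<n. h' i = (if h i = lo then 2 ^ L else h i) \<Longrightarrow> Inv h' (Suc c)"
    and B: "\<And>h c m. Inv h c \<Longrightarrow>
      (\<integral>\<^sup>+ u. \<integral>\<^sup>+ b. (if b = 1 then B m (Suc c) else B m c)
          \<partial>measure_pmf (corrected (threshold_point n h (\<lambda>i. of_bit (u ! i)) (2 ^ L))) \<partial>measure_pmf (ucube n)) \<le> B (Suc m) c"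
  assumes post: "\<And>s'. \<lbrakk>agree {''i'', ''b'', ''u'', ''v'', ''d'', ''t'', ''lo'', ''j'', ''cc'', ''m''} {''x'', ''y'', ''r'', ''h''} s s';
      queries s' \<le> queries s + R * (2 * L + 2);
      \<And>S. linear_on S \<Longrightarrow> regs s' ''cc'' \<le> card S\<rbrakk> \<Longrightarrow> \<psi> s' \<le> v * B 0 (regs s' ''cc'')"
    and Ti: "R * ((L + 6) * (20 * n + 40)) + 1 \<le> Ti"
  shows "wpe Ti find_loop \<psi> s \<le> v * B R 0"
proof -
  let ?V = "{''i'', ''b'', ''u'', ''v'', ''d'', ''t'', ''lo'', ''j'', ''cc'', ''m''}"
    and ?A = "{''x'', ''y'', ''r'', ''h''}"
  \<comment> \<open>For linear \<open>f\<close> the hit counter is charged to relevant variables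
    already marked as removed. This gives \<open>cc \<le> card S\<close> at the end, and so no wrong
    rejection.\<close>
  define I where "I m s' \<longleftrightarrow> agree ?V ?A s s' \<and> m \<le> R \<and> queries s' \<le> queries s + (R - m) * (2 * L + 2) \<and>
    regs s' ''m'' = m \<and> Inv (arrs s' ''h'') (regs s' ''cc'') \<and>
    (\<forall>S. linear_on S \<longrightarrow> regs s' ''cc'' \<le> card {i \<in> S. 2 ^ L \<le> arrs s' ''h'' i})" for m and s' :: state
  define \<phi> where "\<phi> m s' = (if I m s' then v * B m (regs s' ''cc'') else \<infinity>)" for m s'
  have fin: "I m s'" if "\<phi> m s' < \<infinity>" for m s'
    using that by (simp add: \<phi>_def split: if_splits)
  have end_le: "\<psi> s' \<le> \<phi> 0 s'" for s'
  proof (cases "I 0 s'")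
    case True
    have "regs s' ''cc'' \<le> card S" if S: "linear_on S" for S
    proof -
      have "finite S" using S finite_subset unfolding linear_on_def by blast
      then have "card {i \<in> S. 2 ^ L \<le> arrs s' ''h'' i} \<le> card S" by (intro card_mono) auto
      then show ?thesis using True S by (auto simp: I_def intro: order_trans)
    qed
    then show ?thesis using post[of s'] True by (simp add: \<phi>_def I_def)
  qed (simp add: \<phi>_def)
  \<comment> \<open>The two missing steps are those that \<open>wpe_While\<close> adds to each
    round.\<close>
  define Tb where "Tb = (L + 6) * (20 * n + 40) - 2"
  let ?hit = "search_loop ;; update_h kill_cell ;; Assign ''cc'' (Plus (Var ''cc'') (Num 1))"
  let ?rest = "Cond (Less (Num 0) (Var ''d'')) ?hit SKIP ;; Assign ''m'' (Monus (Var ''m'') (Num 1))"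
  have body: "wpe Tb (random_fill ''x'' ;; Assign ''t'' (Arr ''w'' (Var ''L'')) ;; corrected_query ;; ?rest) (\<phi> m) s1 \<le> \<phi> (Suc m) s1"
    if I: "I (Suc m) s1" for m s1
  proof -
    let ?h = "arrs s1 ''h''" and ?c = "regs s1 ''cc''"
    have ag1: "agree ?V ?A s s1" using I by (simp add: I_def)
    have n1: "regs s1 ''n'' = n" using agree_regs[OF ag1, of "''n''"] n by simp
    have L1: "regs s1 ''L'' = L" using agree_regs[OF ag1, of "''L''"] L by simp
    have w1: "arrs s1 ''w'' = arrs s ''w''" using agree_arrs[OF ag1, of "''w''"] by simp
    have q1: "queries s1 + (2 * L + 2) \<le> queries s + (R - m) * (2 * L + 2)"
    proof -
      have "R - m = Suc (R - Suc m)" using I by (auto simp: I_def Suc_diff_Suc)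
      then have "(R - m) * (2 * L + 2) = (R - Suc m) * (2 * L + 2) + (2 * L + 2)"
        by (simp only: mult_Suc add.commute)
      moreover have "queries s1 \<le> queries s + (R - Suc m) * (2 * L + 2)" using I unfolding I_def by blast
      ultimately show ?thesis by linarith
    qed
    have "wpe Tb (random_fill ''x'' ;; Assign ''t'' (Arr ''w'' (Var ''L'')) ;; corrected_query ;; ?rest) (\<phi> m) s1
      \<le> (\<integral>\<^sup>+ u. \<integral>\<^sup>+ b. v * (if b = 1 then B m (Suc ?c) else B m ?c)
          \<partial>measure_pmf (corrected (threshold_point n ?h (\<lambda>i. of_bit (u ! i)) (2 ^ L))) \<partial>measure_pmf (ucube n))"
    proof (rule wpe_Seq_le[where ?T1.0 = "20 * n + 10" and ?T2.0 = "L * (20 * n + 40) + 30 * n + 100"],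
        rule wpe_random_fill[OF _ n1], simp)
      fix s2 u
      assume ag2: "agree {''i'', ''b''} {''x'', ''y''} s1 s2"
        and q2: "queries s2 = queries s1" and x2: "\<forall>i<n. arrs s2 ''x'' i = of_bit (u ! i)"
      define s3 where "s3 = set_reg ''t'' (2 ^ L) s2"
      have L2: "regs s2 ''L'' = L" using agree_regs[OF ag2, of "''L''"] L1 by simp
      have w2: "arrs s2 ''w'' = arrs s ''w''" using agree_arrs[OF ag2, of "''w''"] w1 by simp
      have h2: "arrs s2 ''h'' = ?h" using agree_arrs[OF ag2, of "''h''"] by simp
      have mk: "masked n s3 = threshold_point n ?h (\<lambda>i. of_bit (u ! i)) (2 ^ L)"
        using x2 h2 by (auto simp: masked_eq_threshold_point s3_def intro!: threshold_point_cong)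
      have "wpe (L * (20 * n + 40) + 30 * n + 100) (Assign ''t'' (Arr ''w'' (Var ''L'')) ;; corrected_query ;; ?rest) (\<phi> m) s2
        = wpe (L * (20 * n + 40) + 30 * n + 100 - 2) (corrected_query ;; ?rest) (\<phi> m) s3"
        using L2 w2 w by (subst wpe_Seq_Assign) (simp_all add: s3_def)
      also have "\<dots> \<le> (\<integral>\<^sup>+ b. v * (if b = 1 then B m (Suc ?c) else B m ?c) \<partial>measure_pmf (corrected (masked n s3)))"
      proof (rule wpe_Seq_le[where ?T1.0 = "20 * n + 20" and ?T2.0 = "L * (20 * n + 40) + 10 * n + 50"],
          rule wpe_corrected_query)
        show "regs s3 ''n'' = n" using agree_regs[OF ag2, of "''n''"] n1 by (simp add: s3_def)
        fix s4 b
        assume ag4: "agree {''i'', ''b'', ''u'', ''v'', ''d''} {''r'', ''y''} s3 s4"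
          and q4: "queries s4 = queries s3 + 2"
          and b: "b \<in> set_pmf (corrected (masked n s3))" and d: "regs s4 ''d'' = of_bit b"
        have ag1': "agree ?V ?A s s2" by (rule agree_trans[OF ag1 ag2]) auto
        then have "agree ?V ?A s s3" by (simp add: s3_def agree_set_reg)
        then have ag4': "agree ?V ?A s s4" by (rule agree_trans[OF _ ag4]) auto
        have r4: "regs s4 ''n'' = n" "regs s4 ''L'' = L" "regs s4 ''cc'' = ?c" "regs s4 ''m'' = Suc m"
          using agree_regs[OF ag4, of "''n''"] agree_regs[OF ag4, of "''L''"] agree_regs[OF ag4, of "''cc''"]
            agree_regs[OF ag4, of "''m''"] agree_regs[OF ag2, of "''n''"] agree_regs[OF ag2, of "''cc''"]
            agree_regs[OF ag2, of "''m''"] n1 L2 I by (simp_all add: s3_def I_def)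
        have a4: "arrs s4 ''w'' = arrs s ''w''" "arrs s4 ''h'' = ?h"
          using agree_arrs[OF ag4, of "''w''"] agree_arrs[OF ag4, of "''h''"] w2 h2 by (simp_all add: s3_def)
        have "threshold_point n ?h (arrs s4 ''x'') (2 ^ L) = masked n s3"
          unfolding mk using agree_arrs[OF ag4, of "''x''"] x2 by (intro threshold_point_cong) (simp_all add: s3_def)
        then have f1: "f (threshold_point n ?h (arrs s4 ''x'') (2 ^ L)) = b" if exact
          using that b by (simp add: exact_def masked_eq_threshold_point)
        show "wpe (L * (20 * n + 40) + 10 * n + 50) ?rest (\<phi> m) s4
            \<le> v * (if b = 1 then B m (Suc ?c) else B m ?c)"
        proof (cases "b = 1")
          case False
          define s5 where "s5 = set_reg ''m'' m s4"
          have "wpe (L * (20 * n + 40) + 10 * n + 50) ?rest (\<phi> m) s4 = \<phi> m s5"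
            using d False r4 by (simp add: wpe_Seq_SKIP s5_def)
          moreover have "I m s5"
            using I ag4' r4 a4 q1 q2 q4 by (auto simp: I_def s5_def s3_def intro!: agree_intros)
          ultimately show ?thesis using False r4 by (simp add: \<phi>_def s5_def)
        next
          case True
          have "wpe (L * (20 * n + 40) + 10 * n + 50) ?rest (\<phi> m) s4
            = wpe (L * (20 * n + 40) + 10 * n + 49) (?hit ;; Assign ''m'' (Monus (Var ''m'') (Num 1))) (\<phi> m) s4"
            using d True by (simp add: ac_simps)
          also have "\<dots> \<le> v * B m (Suc ?c)"
          proof (rule wpe_Seq_le[where ?T1.0 = "L * (20 * n + 40) + 10 * n + 40" and ?T2.0 = 1],
              rule wpe_Seq_le[where ?T1.0 = "L * (20 * n + 40) + 10" and ?T2.0 = "10 * n + 20"],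
              rule wpe_search_loop)
            show "regs s4 ''n'' = n" "regs s4 ''L'' = L" by (fact r4)+
            show "\<forall>j\<le>L. arrs s4 ''w'' j = 2 ^ j" using w a4 by simp
            fix s5
            assume ag5: "agree {''i'', ''b'', ''u'', ''v'', ''d'', ''t'', ''lo'', ''j''} {''r'', ''y''} s4 s5"
              and q5: "queries s5 = queries s4 + 2 * L"
              and found: "exact \<Longrightarrow> f (threshold_point n (arrs s4 ''h'') (arrs s4 ''x'') (2 ^ L)) = 1 \<Longrightarrow>
                f (threshold_point n (arrs s4 ''h'') (arrs s4 ''x'') (regs s5 ''lo'')) = 0 \<and>
                f (threshold_point n (arrs s4 ''h'') (arrs s4 ''x'') (Suc (regs s5 ''lo''))) = 1 \<and> regs s5 ''lo'' < 2 ^ L"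
            let ?lo = "regs s5 ''lo''"
            have r5: "regs s5 ''n'' = n" "regs s5 ''L'' = L" "regs s5 ''cc'' = ?c" "regs s5 ''m'' = Suc m"
              using ag5 r4 by (simp_all add: agree_def)
            have a5: "arrs s5 ''w'' = arrs s ''w''" "arrs s5 ''h'' = ?h"
              using ag5 a4 by (simp_all add: agree_def)
            show "wpe (10 * n + 20) (update_h kill_cell ;; Assign ''cc'' (Plus (Var ''cc'') (Num 1)))
              (wpe 1 (Assign ''m'' (Monus (Var ''m'') (Num 1))) (\<phi> m)) s5 \<le> v * B m (Suc ?c)"
            proof (rule wpe_Seq_le[where ?T1.0 = "10 * n + 5" and ?T2.0 = 1], rule wpe_kill, rule r5)
              fix s6
              assume ag6: "agree {''i''} {''h''} s5 s6" and q6: "queries s6 = queries s5"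
                and "\<forall>i<n. arrs s6 ''h'' i = (if arrs s5 ''h'' i = ?lo
                  then arrs s5 ''w'' (regs s5 ''L'') else arrs s5 ''h'' i)"
              then have h6: "\<forall>i<n. arrs s6 ''h'' i = (if ?h i = ?lo then 2 ^ L else ?h i)"
                using a5 r5 w by simp
              have r6: "regs s6 ''cc'' = ?c" "regs s6 ''m'' = Suc m"
                using ag6 r5 by (simp_all add: agree_def)
              define s7 where "s7 = set_reg ''m'' m (set_reg ''cc'' (Suc ?c) s6)"
              have "agree ?V ?A s s5" by (rule agree_trans[OF ag4' ag5]) auto
              then have "agree ?V ?A s s6" by (rule agree_trans[OF _ ag6]) auto
              then have "agree ?V ?A s s7" by (simp add: s7_def agree_set_reg)
              moreover have "queries s7 \<le> queries s + (R - m) * (2 * L + 2)"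
                using q1 q2 q4 q5 q6 by (simp add: s7_def s3_def)
              moreover have "Inv (arrs s7 ''h'') (Suc ?c)"
                using I h6 by (intro Inv_kill[of ?h ?c _ ?lo]) (simp_all add: I_def s7_def)
              moreover have "Suc ?c \<le> card {i \<in> S. 2 ^ L \<le> arrs s7 ''h'' i}" if S: "linear_on S" for S
              proof -
                have Sn: "S \<subseteq> {..<n}" "finite S"
                  using S finite_subset unfolding linear_on_def by blast+
                have "chi S (threshold_point n ?h (arrs s4 ''x'') ?lo) \<noteq> chi S (threshold_point n ?h (arrs s4 ''x'') (Suc ?lo))"
                  and lo: "?lo < 2 ^ L"
                  using found f1 linear_on_exact[OF S] True a4 S by (simp_all add: linear_on_def)
                then obtain i where i: "i \<in> S" "?h i = ?lo"
                  using chi_threshold_point_differ[OF Sn(1)] by blast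
                \<comment> \<open>Because \<open>lo\<close> is below \<open>2^L\<close>, the
                  variable \<open>i\<close> was still alive, so it is a new removed element that
                  pays for this hit.\<close>
                have "card (insert i {i \<in> S. 2 ^ L \<le> ?h i}) \<le> card {i \<in> S. 2 ^ L \<le> arrs s7 ''h'' i}"
                  using Sn i h6 by (intro card_mono) (auto simp: s7_def)
                moreover have "card (insert i {i \<in> S. 2 ^ L \<le> ?h i}) = Suc (card {i \<in> S. 2 ^ L \<le> ?h i})"
                  using Sn i lo by (intro card_insert_disjoint) auto
                ultimately show ?thesis using I S by (auto simp: I_def intro: order_trans)
              qed
              ultimately have "I m s7" using I by (auto simp: I_def s7_def)
              then have "\<phi> m s7 = v * B m (Suc ?c)" by (simp add: \<phi>_def s7_def)
              then show "wpe 1 (Assign ''cc'' (Plus (Var ''cc'') (Num 1)))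
                (wpe 1 (Assign ''m'' (Monus (Var ''m'') (Num 1))) (\<phi> m)) s6 \<le> v * B m (Suc ?c)"
                using r6 by (simp add: s7_def)
            qed simp_all
          qed simp_all
          finally show ?thesis using True by simp
        qed
      qed simp_all
      finally show "wpe (L * (20 * n + 40) + 30 * n + 100) (Assign ''t'' (Arr ''w'' (Var ''L'')) ;; corrected_query ;; ?rest) (\<phi> m) s2
        \<le> (\<integral>\<^sup>+ b. v * (if b = 1 then B m (Suc ?c) else B m ?c)
          \<partial>measure_pmf (corrected (threshold_point n ?h (\<lambda>i. of_bit (u ! i)) (2 ^ L))))"
        unfolding mk .
    qed (simp_all add: Tb_def algebra_simps)
    also have "\<dots> = v * (\<integral>\<^sup>+ u. \<integral>\<^sup>+ b. (if b = 1 then B m (Suc ?c) else B m ?c)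
          \<partial>measure_pmf (corrected (threshold_point n ?h (\<lambda>i. of_bit (u ! i)) (2 ^ L))) \<partial>measure_pmf (ucube n))"
      by (simp add: nn_integral_cmult)
    also have "\<dots> \<le> v * B (Suc m) ?c"
      using I by (intro mult_left_mono B) (simp_all add: I_def)
    also have "\<dots> = \<phi> (Suc m) s1"
      using I by (simp add: \<phi>_def)
    finally show ?thesis .
  qed
  have "wpe Ti find_loop \<psi> s \<le> wpe Ti find_loop (\<phi> 0) s"
    by (intro wpe_mono end_le)
  also have "\<dots> \<le> \<phi> R s"
    unfolding find_loop_def
  proof (rule wpe_While[where T = Tb])
    fix m s' assume "\<phi> (Suc m) s' < \<infinity>"
    then have I: "I (Suc m) s'" by (rule fin)
    have "bval (Less (Num 0) (Var ''m'')) s'" using I by (simp add: I_def)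
    then show "bval (Less (Num 0) (Var ''m'')) s' \<and>
        wpe Tb (random_fill ''x'' ;; Assign ''t'' (Arr ''w'' (Var ''L'')) ;; corrected_query ;; ?rest) (\<phi> m) s' \<le> \<phi> (Suc m) s'"
      using body[OF I] by (rule conjI)
  next
    fix s' assume "\<phi> 0 s' < \<infinity>"
    then have I: "I 0 s'" by (rule fin)
    then show "\<not> bval (Less (Num 0) (Var ''m'')) s'" by (simp add: I_def)
  next
    have "6 * 40 \<le> (L + 6) * (20 * n + 40)" by (intro mult_le_mono) simp_all
    then have "Tb + 2 = (L + 6) * (20 * n + 40)" unfolding Tb_def by linarith
    then show "R * (Tb + 2) + 1 \<le> Ti" using Ti by simp
  qed
  also have "\<phi> R s = v * B R 0"
    using Inv0 m cc by (simp add: \<phi>_def I_def agree_refl)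
  finally show ?thesis .
qed

end

section \<open>The potential of the counting stage\<close>

abbreviation dbl :: "aexp \<Rightarrow> aexp" where
  "dbl e \<equiv> Plus e e"

definition count_tail :: com where
  "count_tail =
    Assign ''cc'' (Num 0) ;;
    Assign ''m'' (dbl (dbl (dbl (Plus (Var ''k'') (Num 2))))) ;;
    find_loop ;;
    Cond (Less (Var ''k'') (Var ''cc'')) (Assign ''accept'' (Num 0)) SKIP"

definition count_stage :: com where
  "count_stage = level_loop ;; hash_loop ;; count_tail"

text \<open>
  Each round multiplies the potential by at most \<open>1 - 3/8 \<cdot> 1/2 \<le> 7/8\<close> in expectation, and \<open>8\<close> rounds
  gain more than a factor 2, so \<open>8 (K + 2)\<close> rounds suffice to bring it from \<open>2\<^sup>K\<close> below \<open>1/4\<close>.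
\<close>

definition potential :: "nat \<Rightarrow> nat \<Rightarrow> nat \<Rightarrow> ennreal" where
  "potential K m c = (if K < c then 0 else 2 ^ (K - c) * ennreal (7/8) ^ m)"

lemma potential_bound: "potential K (8 * (K + 2)) 0 \<le> ennreal (1 / 4)"
proof -
  have "(7/8 :: real) ^ 8 \<le> 1 / 2" by (simp add: power_divide)
  then have "((7/8 :: real) ^ 8) ^ (K + 2) \<le> (1 / 2) ^ (K + 2)" by (intro power_mono) auto
  then have "2 ^ K * ((7/8 :: real) ^ 8) ^ (K + 2) \<le> 2 ^ K * (1 / 2) ^ (K + 2)"
    by (rule mult_left_mono) simp
  also have "\<dots> = 1 / 4" by (simp add: power_divide power_add)
  finally have "ennreal (2 ^ K * (7/8) ^ (8 * (K + 2))) \<le> ennreal (1 / 4)"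
    unfolding power_mult by (rule ennreal_leI)
  moreover have "ennreal (2 ^ K * (7/8) ^ (8 * (K + 2))) = potential K (8 * (K + 2)) 0"
    by (simp only: potential_def ennreal_mult zero_le_power ennreal_power[symmetric]) simp
  ultimately show ?thesis by (simp only:)
qed

lemma nn_integral_bit_pmf:
  "(\<integral>\<^sup>+ b. F b \<partial>measure_pmf p) = F 1 * ennreal (pmf p 1) + F 0 * ennreal (pmf p (0 :: bit))"
  by (simp add: nn_integral_measure_pmf nn_integral_count_space_finite UNIV_bit add.commute mult.commute)

text \<open>A hit halves the potential exactly, except for hit number \<open>K + 1\<close>, which
  guarantees rejection and sends it to 0.\<close>

lemma potential_Suc: "potential K m (Suc c) \<le> potential K m c / 2"
proof (cases "Suc c \<le> K")
  case True
  then have "K - c = Suc (K - Suc c)" by simp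
  then have "potential K m c / 2 = 2 * potential K m (Suc c) / 2"
    using True by (simp add: potential_def mult.assoc)
  also have "\<dots> = potential K m (Suc c)"
    by (subst mult.commute) (simp add: ennreal_mult_divide_eq)
  finally show ?thesis by simp
qed (simp add: potential_def)

lemma chi_threshold_point:
  assumes "S \<subseteq> {..<n}"
  shows "chi S (threshold_point n h (\<lambda>i. of_bit (u ! i)) t) = chi {i \<in> S. h i < t} u"
proof -
  have fin: "finite S" using assms finite_subset by blast
  have "chi S (threshold_point n h (\<lambda>i. of_bit (u ! i)) t) = (\<Sum>i\<in>S. if h i < t then u ! i else 0)"
    unfolding chi_def using assms by (intro sum.cong) (auto simp: threshold_point_def subset_eq)
  then show ?thesis using fin by (simp add: chi_def sum.inter_filter)
qed

context access
begin

text \<open>On random points supported on the alive variables, \<open>chi S\<close> acts as the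
  parity of the alive part of \<open>S\<close>, which is a fair coin when that part is nonempty. The
  value 1 is then reported with probability at least \<open>3/4\<close>, whence
  \<open>3/8 = 1/2 * 3/4\<close>.\<close>

lemma success_prob:
  assumes S: "S \<subseteq> {..<n}" and maj: "\<And>x. x \<in> cube n \<Longrightarrow> 3 / 4 \<le> pmf (corrected x) (chi S x)"
    and alive: "i \<in> S" "h i < t"
  shows "3 / 8 \<le> pmf (bind_pmf (ucube n) (\<lambda>u. corrected (threshold_point n h (\<lambda>i. of_bit (u ! i)) t))) 1"
proof -
  let ?S = "{i \<in> S. h i < t}"
  have "measure_pmf.prob (ucube n) {u. chi ?S u = 1} = 1 / 2"
    using prob_chi_half[of ?S n 1] S alive by (auto simp: pmf_map vimage_def)
  then have "(3 / 8 :: real) = (\<integral>u. 3 / 4 * indicator {u. chi ?S u = 1} u \<partial>measure_pmf (ucube n))" by simp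
  also have "\<dots> \<le> (\<integral>u. pmf (corrected (threshold_point n h (\<lambda>i. of_bit (u ! i)) t)) 1 \<partial>measure_pmf (ucube n))"
  proof (intro integral_mono_AE)
    have "3 / 4 * indicator {u. chi ?S u = 1} u \<le> pmf (corrected (threshold_point n h (\<lambda>i. of_bit (u ! i)) t)) 1" for u
      using maj[OF threshold_point_in_cube, of h "\<lambda>i. of_bit (u ! i)" t]
      unfolding chi_threshold_point[OF S] by (auto simp: indicator_def)
    then show "AE u in measure_pmf (ucube n). 3 / 4 * indicator {u. chi ?S u = 1} u
        \<le> pmf (corrected (threshold_point n h (\<lambda>i. of_bit (u ! i)) t)) 1" by simp
  qed (auto intro!: measure_pmf.integrable_const_bound[where B = 1] simp: pmf_le_1 indicator_def)
  finally show ?thesis by (simp add: pmf_bind)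
qed

text \<open>While \<open>c \<le> K\<close>, the \<open>K + 1\<close> elements of \<open>T\<close>
  cannot all be dead, so some relevant variable is alive and \<open>success_prob\<close> applies.
  For \<open>c > K\<close> both sides are 0.\<close>

lemma potential_step:
  assumes S: "S \<subseteq> {..<n}" and maj: "\<And>x. x \<in> cube n \<Longrightarrow> 3 / 4 \<le> pmf (corrected x) (chi S x)"
    and T: "T \<subseteq> S" "card T = Suc K" and dead: "card {i \<in> T. t \<le> h i} \<le> c"
  shows "(\<integral>\<^sup>+ u. \<integral>\<^sup>+ b. (if b = 1 then potential K m (Suc c) else potential K m c)
          \<partial>measure_pmf (corrected (threshold_point n h (\<lambda>i. of_bit (u ! i)) t)) \<partial>measure_pmf (ucube n)) \<le> potential K (Suc m) c"
proof (cases "K < c")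
  case False
  have finT: "finite T" using T by (metis card.infinite nat.distinct(1))
  have "{i \<in> T. t \<le> h i} \<noteq> T" using dead T False by auto
  then obtain i where "i \<in> T" "h i < t" by fastforce
  then have p: "3 / 8 \<le> pmf (bind_pmf (ucube n) (\<lambda>u. corrected (threshold_point n h (\<lambda>i. of_bit (u ! i)) t))) 1"
    using success_prob[OF S maj] T by blast
  define Z where "Z = bind_pmf (ucube n) (\<lambda>u. corrected (threshold_point n h (\<lambda>i. of_bit (u ! i)) t))"
  let ?X = "potential K m c"
  have "(\<integral>\<^sup>+ u. \<integral>\<^sup>+ b. (if b = 1 then potential K m (Suc c) else ?X)
          \<partial>measure_pmf (corrected (threshold_point n h (\<lambda>i. of_bit (u ! i)) t)) \<partial>measure_pmf (ucube n))
      = potential K m (Suc c) * ennreal (pmf Z 1) + ?X * ennreal (pmf Z 0)"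
    by (subst nn_integral_bind_pmf[symmetric]) (simp only: nn_integral_bit_pmf Z_def, simp)
  also have "\<dots> \<le> ?X / 2 * ennreal (pmf Z 1) + ?X * ennreal (pmf Z 0)"
    by (intro add_right_mono mult_right_mono potential_Suc) simp
  also have "\<dots> = ?X * ennreal (pmf Z 1 / 2 + pmf Z 0)"
  proof -
    have "?X / 2 * ennreal (pmf Z 1) = ?X * ennreal (pmf Z 1 / 2)"
      by (simp add: divide_ennreal_def mult_ac flip: ennreal_divide_numeral)
    then show ?thesis by (simp add: distrib_left)
  qed
  \<comment> \<open>The factor is \<open>1 - pmf Z 1 / 2\<close>, at most
    \<open>13/16\<close>.\<close>
  also have "\<dots> \<le> ?X * ennreal (7/8)"
    using p pmf_bit_sum[of Z] by (intro mult_left_mono ennreal_leI) (simp_all add: Z_def)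
  also have "\<dots> = potential K (Suc m) c"
    using False by (simp add: potential_def mult_ac)
  finally show ?thesis .
qed (simp only: potential_def less_SucI if_True if_cancel, simp)

text \<open>\<open>B\<close> and \<open>Inv\<close> stay abstract because the lemma is used twice:
  with \<open>B\<close> constantly 1, for the guarantees that hold in every run, and with
  \<open>potential\<close>, for soundness. \<open>B0\<close> says that a run that is not rejected
  carries weight at least 1.\<close>

lemma wpe_count_tail:
  fixes B :: "nat \<Rightarrow> nat \<Rightarrow> ennreal" and Inv :: "(nat \<Rightarrow> nat) \<Rightarrow> nat \<Rightarrow> bool"
  assumes n: "regs s ''n'' = n" and L: "regs s ''L'' = L" and w: "\<forall>j\<le>L. arrs s ''w'' j = 2 ^ j"
    and K: "regs s ''k'' = K"
    and Inv0: "Inv (arrs s ''h'') 0"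
    and Inv_kill: "\<And>h h' lo c. Inv h c \<Longrightarrow> \<forall>i<n. h' i = (if h i = lo then 2 ^ L else h i) \<Longrightarrow> Inv h' (Suc c)"
    and B: "\<And>h c m. Inv h c \<Longrightarrow>
      (\<integral>\<^sup>+ u. \<integral>\<^sup>+ b. (if b = 1 then B m (Suc c) else B m c)
          \<partial>measure_pmf (corrected (threshold_point n h (\<lambda>i. of_bit (u ! i)) (2 ^ L))) \<partial>measure_pmf (ucube n)) \<le> B (Suc m) c"
    and B0: "\<And>c. c \<le> K \<Longrightarrow> 1 \<le> B 0 c"
  assumes post: "\<And>s'. \<lbrakk>queries s' \<le> queries s + 8 * (K + 2) * (2 * L + 2);
      regs s' ''accept'' = regs s ''accept'' \<or> regs s' ''accept'' = 0;
      \<And>S. linear_on S \<Longrightarrow> card S \<le> K \<Longrightarrow> regs s' ''accept'' = regs s ''accept''\<rbrakk>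
      \<Longrightarrow> \<psi> s' \<le> (if regs s' ''accept'' = 0 then 0 else v)"
    and Ti: "8 * (K + 2) * ((L + 6) * (20 * n + 40)) + 20 \<le> Ti"
  shows "wpe Ti count_tail \<psi> s \<le> (if regs s ''accept'' = 0 then 0 else v) * B (8 * (K + 2)) 0"
proof -
  let ?R = "8 * (K + 2)" and ?v = "if regs s ''accept'' = 0 then 0 else v"
  define s0 where "s0 = set_reg ''m'' ?R (set_reg ''cc'' 0 s)"
  let ?fin = "Cond (Less (Var ''k'') (Var ''cc'')) (Assign ''accept'' (Num 0)) SKIP"
  have R: "aval (dbl (dbl (dbl (Plus (Var ''k'') (Num 2))))) (set_reg ''cc'' 0 s) = ?R" using K by simp
  have "wpe Ti count_tail \<psi> s = wpe (Ti - 2 - 2) (find_loop ;; ?fin) \<psi> s0"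
    unfolding count_tail_def using Ti K
    by (subst wpe_Seq_Assign, simp, subst wpe_Seq_Assign, simp) (simp only: s0_def R aval.simps(1))
  also have "\<dots> \<le> ?v * B ?R 0"
  proof (rule wpe_Seq_le[where ?T1.0 = "?R * ((L + 6) * (20 * n + 40)) + 1" and ?T2.0 = 5],
      rule wpe_find_loop[where L = L and Inv = Inv])
    show "regs s0 ''n'' = n" "regs s0 ''L'' = L" "\<forall>j\<le>L. arrs s0 ''w'' j = 2 ^ j" "Inv (arrs s0 ''h'') 0"
      "regs s0 ''m'' = ?R" "regs s0 ''cc'' = 0"
      using n L w Inv0 by (simp_all add: s0_def)
    fix s1
    assume ag: "agree {''i'', ''b'', ''u'', ''v'', ''d'', ''t'', ''lo'', ''j'', ''cc'', ''m''}
        {''x'', ''y'', ''r'', ''h''} s0 s1"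
      and q: "queries s1 \<le> queries s0 + ?R * (2 * L + 2)"
      and lin: "\<And>S. linear_on S \<Longrightarrow> regs s1 ''cc'' \<le> card S"
    have r1: "regs s1 ''k'' = K" "regs s1 ''accept'' = regs s ''accept''"
      using agree_regs[OF ag, of "''k''"] agree_regs[OF ag, of "''accept''"] K by (simp_all add: s0_def)
    have q': "queries s1 \<le> queries s + ?R * (2 * L + 2)" using q by (simp add: s0_def)
    show "wpe 5 ?fin \<psi> s1 \<le> ?v * B 0 (regs s1 ''cc'')"
    proof (cases "K < regs s1 ''cc''")
      case True
      have "\<psi> (set_reg ''accept'' 0 s1) \<le> 0"
        by (rule order_trans[OF post]) (use q' lin True in \<open>force+\<close>)
      then show ?thesis using True r1 by simp
    next
      case False
      have "\<psi> s1 \<le> ?v"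
        by (rule order_trans[OF post]) (use q' r1 in simp_all)
      also have "\<dots> \<le> ?v * B 0 (regs s1 ''cc'')"
        using mult_left_mono[OF B0[of "regs s1 ''cc''"], of ?v] False by simp
      finally show ?thesis using False r1 by simp
    qed
  qed (use Ti Inv_kill B in simp_all)
  finally show ?thesis .
qed

end

text \<open>If \<open>p / q > 1\<close>, nothing can be \<epsilon>-far, and accepting at once avoids
  a constant number of queries that \<open>k / \<epsilon>\<close> may not cover. The nested
  differences compute \<open>min k n\<close>: no function has more than \<open>n\<close> variables,
  and the running time must be polynomial in \<open>n\<close>. The 16 linearity rounds bring
  \<open>7/8\<close> below \<open>1/3\<close>; about \<open>4 q / p\<close> samples, each exposing a
  far correction with probability at least \<open>3/4 * p / q\<close>, give an expected number of 3
  failures.\<close>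

definition tester :: com where
  "tester =
    Assign ''accept'' (Num 1) ;;
    Cond (Less (Var ''q'') (Var ''p'')) SKIP
     (Assign ''k'' (Monus (Var ''k'') (Monus (Var ''k'') (Var ''n''))) ;;
      Assign ''t'' (Num 1) ;;
      Assign ''e'' (Num 1) ;;
      Assign ''a'' (Num 16) ;;
      test_loop (random_fill ''x'') ;;
      Assign ''e'' (Var ''p'') ;;
      Assign ''a'' (dbl (dbl (Var ''q''))) ;;
      test_loop (Sample ''x'') ;;
      count_stage)"

definition count_time :: "nat \<Rightarrow> nat \<Rightarrow> nat \<Rightarrow> nat" where
  "count_time n K L = 10 * K + 10 + (L * (30 * n + 40) + 10) +
     (8 * (K + 2) * ((L + 6) * (20 * n + 40)) + 20) + 2"

definition num_levels :: "nat \<Rightarrow> nat" where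
  "num_levels K = 4 + 2 * levels K"

text \<open>16 linearity rounds of 3 queries, \<open>N\<close> comparison rounds of 4 including the
  sample, and \<open>8 (K + 2)\<close> counting rounds, each with one corrected query and at most
  one bisection.\<close>

definition query_total :: "nat \<Rightarrow> nat \<Rightarrow> nat" where
  "query_total N K = 48 + 4 * N + 8 * (K + 2) * (2 * num_levels K + 2)"

lemma levels_le_self: "levels K \<le> K"
  unfolding levels_def by (rule Least_le) (simp add: Suc_leI less_exp)

text \<open>The 4 extra levels supply the factor 16, which makes the expected number of collisions
  among \<open>K + 1\<close> variables at most \<open>1/16\<close>.\<close>

lemma num_levels_large: "16 * (K + 1)\<^sup>2 \<le> 2 ^ num_levels K"
proof -
  have "(K + 1)\<^sup>2 \<le> (2 ^ levels K)\<^sup>2" using levels_le[of K] by (intro power_mono) auto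
  moreover have "2 ^ num_levels K = 16 * ((2 :: nat) ^ levels K)\<^sup>2"
    by (simp only: num_levels_def power_add power_even_eq) simp
  ultimately show ?thesis by simp
qed

lemma collisions_empty_inj:
  assumes "finite T" "card (collisions T h) = 0"
  shows "inj_on h T"
proof (rule inj_onI, rule ccontr)
  fix i j assume *: "i \<in> T" "j \<in> T" "h i = h j" "i \<noteq> j"
  have "collisions T h = {}" using assms finite_collisions by auto
  moreover have "(min i j, max i j) \<in> collisions T h" using * by (auto simp: collisions_def min_def max_def)
  ultimately show False by simp
qed

context access
begin

definition many_variables :: "nat \<Rightarrow> bool" where
  "many_variables K \<longleftrightarrow>
    (\<exists>S \<subseteq> {..<n}. K < card S \<and> (\<forall>x\<in>cube n. 3 / 4 \<le> pmf (corrected x) (chi S x)))"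

text \<open>Alive elements of \<open>T\<close> have distinct hash values, so removing a block kills
  at most one of them, whichever block the bisection returned. Hence at most \<open>c\<close>
  elements of \<open>T\<close> are dead after \<open>c\<close> hits, as
  \<open>potential_step\<close> demands.\<close>

lemma wpe_count_tail_sound:
  assumes n: "regs s ''n'' = n" and L: "regs s ''L'' = L" and w: "\<forall>j\<le>L. arrs s ''w'' j = 2 ^ j"
    and K: "regs s ''k'' = K" and h: "\<forall>i<n. arrs s ''h'' i < 2 ^ L"
    and S: "S \<subseteq> {..<n}" and maj: "\<And>x. x \<in> cube n \<Longrightarrow> 3 / 4 \<le> pmf (corrected x) (chi S x)"
    and T: "T \<subseteq> S" "card T = Suc K" and inj: "inj_on (arrs s ''h'') T"
  assumes post: "\<And>s'. \<lbrakk>queries s' \<le> queries s + 8 * (K + 2) * (2 * L + 2);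
      regs s' ''accept'' = regs s ''accept'' \<or> regs s' ''accept'' = 0;
      \<And>S. linear_on S \<Longrightarrow> card S \<le> K \<Longrightarrow> regs s' ''accept'' = regs s ''accept''\<rbrakk>
      \<Longrightarrow> \<psi> s' \<le> (if regs s' ''accept'' = 0 then 0 else v)"
    and Ti: "8 * (K + 2) * ((L + 6) * (20 * n + 40)) + 20 \<le> Ti"
  shows "wpe Ti count_tail \<psi> s \<le> (if regs s ''accept'' = 0 then 0 else v) * ennreal (1 / 4)"
proof -
  define Inv where "Inv h c \<longleftrightarrow> inj_on h {i \<in> T. h i < 2 ^ L} \<and> card {i \<in> T. 2 ^ L \<le> h i} \<le> c"
    for h :: "nat \<Rightarrow> nat" and c
  have finT: "finite T" using T by (metis card.infinite nat.distinct(1))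
  have Tn: "i < n" if "i \<in> T" for i using that T S by auto
  have "wpe Ti count_tail \<psi> s \<le> (if regs s ''accept'' = 0 then 0 else v) * potential K (8 * (K + 2)) 0"
  proof (rule wpe_count_tail[OF n L w K, where Inv = Inv])
    have "{i \<in> T. 2 ^ L \<le> arrs s ''h'' i} = {}" using h Tn by force
    then have "card {i \<in> T. 2 ^ L \<le> arrs s ''h'' i} = 0" by (simp only: card.empty)
    then show "Inv (arrs s ''h'') 0"
      using inj_on_subset[OF inj, of "{i \<in> T. arrs s ''h'' i < 2 ^ L}"] by (simp add: Inv_def)
  next
    fix h h' :: "nat \<Rightarrow> nat" and lo c
    assume Inv: "Inv h c" and h': "\<forall>i<n. h' i = (if h i = lo then 2 ^ L else h i)"
    have hT: "h' i = (if h i = lo then 2 ^ L else h i)" if "i \<in> T" for i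
      using h' Tn[OF that] by blast
    have sub: "{i \<in> T. h' i < 2 ^ L} \<subseteq> {i \<in> T. h i < 2 ^ L}"
      by (auto simp: hT split: if_splits)
    have "inj_on h' {i \<in> T. h' i < 2 ^ L}"
    proof (rule inj_onI)
      fix i j assume ij: "i \<in> {i \<in> T. h' i < 2 ^ L}" "j \<in> {i \<in> T. h' i < 2 ^ L}" and eq: "h' i = h' j"
      have "h i = h j"
        using ij eq by (auto simp: hT split: if_splits)
      moreover have "inj_on h {i \<in> T. h i < 2 ^ L}" using Inv by (simp add: Inv_def)
      ultimately show "i = j" using sub ij by (meson inj_onD subsetD)
    qed
    moreover have "card {i \<in> T. 2 ^ L \<le> h' i} \<le> Suc c"
    proof -
      \<comment> \<open>The elements killed by this removal; injectivity on the alive part leaves at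
        most one.\<close>
      let ?A = "{i \<in> T. h i < 2 ^ L \<and> h i = lo}"
      have "{i \<in> T. 2 ^ L \<le> h' i} \<subseteq> {i \<in> T. 2 ^ L \<le> h i} \<union> ?A"
        by (auto simp: hT split: if_splits)
      then have "card {i \<in> T. 2 ^ L \<le> h' i} \<le> card ({i \<in> T. 2 ^ L \<le> h i} \<union> ?A)"
        using finT by (intro card_mono) auto
      also have "\<dots> \<le> card {i \<in> T. 2 ^ L \<le> h i} + card ?A" by (rule card_Un_le)
      also have "card ?A \<le> 1"
      proof -
        have "\<forall>i\<in>?A. \<forall>j\<in>?A. i = j" using Inv by (auto simp: Inv_def inj_on_def)
        then show ?thesis using finT by (metis (no_types, lifting) One_nat_def card_le_Suc0_iff_eq finite_Collect_conjI finite_subset mem_Collect_eq subsetI)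
      qed
      finally show ?thesis using Inv by (simp add: Inv_def)
    qed
    ultimately show "Inv h' (Suc c)" by (simp add: Inv_def)
  next
    fix h :: "nat \<Rightarrow> nat" and c m
    assume "Inv h c"
    then show "(\<integral>\<^sup>+ u. \<integral>\<^sup>+ b. (if b = 1 then potential K m (Suc c) else potential K m c)
          \<partial>measure_pmf (corrected (threshold_point n h (\<lambda>i. of_bit (u ! i)) (2 ^ L))) \<partial>measure_pmf (ucube n))
        \<le> potential K (Suc m) c"
      unfolding Inv_def by (intro potential_step[OF S maj T]) auto
  next
    fix c assume "c \<le> K"
    then show "1 \<le> potential K 0 c"
      using one_le_power[of "2 :: ennreal" "K - c"] by (simp add: potential_def)
  qed (use post Ti in auto)
  also have "\<dots> \<le> (if regs s ''accept'' = 0 then 0 else v) * ennreal (1 / 4)"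
    by (intro mult_left_mono potential_bound) simp
  finally show ?thesis .
qed

text \<open>With many variables, acceptance costs at most \<open>1/4\<close> from the potential and
  \<open>1/16\<close> from possible collisions, and \<open>5/16 \<le> 1/3\<close>.\<close>

lemma wpe_count_stage:
  assumes n: "regs s ''n'' = n" and K: "regs s ''k'' = K" and h: "\<forall>i<n. arrs s ''h'' i = 0"
  assumes post: "\<And>s'. \<lbrakk>queries s' \<le> queries s + 8 * (K + 2) * (2 * num_levels K + 2);
      regs s' ''accept'' = regs s ''accept'' \<or> regs s' ''accept'' = 0;
      \<And>S. linear_on S \<Longrightarrow> card S \<le> K \<Longrightarrow> regs s' ''accept'' = regs s ''accept''\<rbrakk>
      \<Longrightarrow> \<psi> s' \<le> (if regs s' ''accept'' = 0 then 0 else v)"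
    and Ti: "count_time n K (num_levels K) \<le> Ti"
  shows "wpe Ti count_stage \<psi> s \<le>
    (if regs s ''accept'' = 0 then 0 else v) * (if many_variables K then ennreal (1 / 3) else 1)"
proof -
  let ?v = "if regs s ''accept'' = 0 then 0 else v"
  let ?L = "num_levels K"
  define Tt where "Tt = 8 * (K + 2) * ((?L + 6) * (20 * n + 40)) + 20"
  define Th where "Th = ?L * (30 * n + 40) + 10"
  have Ti': "10 * K + 10 + Th + Tt + 2 \<le> Ti"
    using Ti by (simp only: count_time_def Th_def Tt_def)
  show ?thesis
    unfolding count_stage_def
  proof (rule wpe_Seq_le[where ?T1.0 = "10 * K + 10" and ?T2.0 = "Th + Tt + 1"], rule wpe_level_loop[OF K])
    fix s1
    assume ag1: "agree {''L'', ''g''} {} s s1" and q1: "queries s1 = queries s"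
      and "regs s1 ''L'' = 4 + 2 * levels K"
    then have L1: "regs s1 ''L'' = ?L" by (simp add: num_levels_def)
    have n1: "regs s1 ''n'' = n" and h1: "\<forall>i<n. arrs s1 ''h'' i = 0"
      using agree_regs[OF ag1, of "''n''"] n agree_arrs[OF ag1, of "''h''"] h by simp_all
    have tail: "regs s2 ''n'' = n" "regs s2 ''L'' = ?L" "regs s2 ''k'' = K"
        "regs s2 ''accept'' = regs s ''accept''" "queries s2 = queries s"
      if "agree {''i'', ''b'', ''j''} {''x'', ''y'', ''h'', ''w''} s1 s2" "queries s2 = queries s1" for s2
      using agree_regs[OF that(1), of "''n''"] agree_regs[OF that(1), of "''L''"]
        agree_regs[OF that(1), of "''k''"] agree_regs[OF that(1), of "''accept''"]
        agree_regs[OF ag1, of "''k''"] agree_regs[OF ag1, of "''accept''"] n1 L1 K q1 that(2) by simp_all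
    show "wpe (Th + Tt + 1) (hash_loop ;; count_tail) \<psi> s1
        \<le> ?v * (if many_variables K then ennreal (1 / 3) else 1)"
    proof (rule wpe_Seq_le[where ?T1.0 = Th and ?T2.0 = Tt])
      have trivial: "wpe Tt count_tail \<psi> s2 \<le> ?v"
        if ag2: "agree {''i'', ''b'', ''j''} {''x'', ''y'', ''h'', ''w''} s1 s2" "queries s2 = queries s1"
          and w2: "\<forall>j\<le>?L. arrs s2 ''w'' j = 2 ^ j" for s2
      proof -
        have "wpe Tt count_tail \<psi> s2 \<le> (if regs s2 ''accept'' = 0 then 0 else v) * 1"
          by (rule wpe_count_tail[OF tail(1,2)[OF ag2] w2 tail(3)[OF ag2],
                where B = "\<lambda>_ _. 1" and Inv = "\<lambda>_ _. True" and v = v])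
            (use post tail[OF ag2] in \<open>simp_all add: Tt_def\<close>)
        then show ?thesis by (simp add: tail[OF ag2])
      qed
      show "wpe Th hash_loop (wpe Tt count_tail \<psi>) s1 \<le> ?v * (if many_variables K then ennreal (1 / 3) else 1)"
      proof (cases "many_variables K")
        case False
        \<comment> \<open>With \<open>T\<close> empty and \<open>v' = 0\<close> the hashing lemma
          supplies just its certain postcondition.\<close>
        have "wpe Th hash_loop (wpe Tt count_tail \<psi>) s1 \<le> ?v + 0 * (of_nat ((card ({} :: nat set))\<^sup>2) / 2 ^ ?L)"
          by (rule wpe_hash_loop[OF n1 L1 h1]) (use trivial in \<open>simp_all add: Th_def\<close>)
        then show ?thesis using False by simp
      next
        case True
        then obtain S where S: "S \<subseteq> {..<n}" "K < card S"
          and maj: "\<And>x. x \<in> cube n \<Longrightarrow> 3 / 4 \<le> pmf (corrected x) (chi S x)"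
          unfolding many_variables_def by blast
        obtain T where T: "T \<subseteq> S" "card T = Suc K" "finite T"
          using obtain_subset_with_card_n[of "Suc K" S] S(2) by (metis Suc_leI)
        have "wpe Th hash_loop (wpe Tt count_tail \<psi>) s1
            \<le> ?v * ennreal (1 / 4) + ?v * (of_nat ((card T)\<^sup>2) / 2 ^ ?L)"
        proof (rule wpe_hash_loop[OF n1 L1 h1])
          show "T \<subseteq> {..<n}" using T S by blast
        next
          fix s2
          assume ag2: "agree {''i'', ''b'', ''j''} {''x'', ''y'', ''h'', ''w''} s1 s2" "queries s2 = queries s1"
            and w2: "\<forall>j\<le>?L. arrs s2 ''w'' j = 2 ^ j" and h2: "\<forall>i<n. arrs s2 ''h'' i < 2 ^ ?L"
          show "wpe Tt count_tail \<psi> s2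
              \<le> ?v * ennreal (1 / 4) + ?v * of_nat (card (collisions T (arrs s2 ''h'')))"
          proof (cases "card (collisions T (arrs s2 ''h'')) = 0")
            case True
            have "wpe Tt count_tail \<psi> s2 \<le> (if regs s2 ''accept'' = 0 then 0 else v) * ennreal (1 / 4)"
              by (rule wpe_count_tail_sound[OF tail(1,2)[OF ag2] w2 tail(3)[OF ag2] h2 S(1) maj T(1,2)
                    collisions_empty_inj[OF T(3) True]])
                (use post tail[OF ag2] in \<open>simp_all add: Tt_def\<close>)
            then show ?thesis using True by (simp add: tail[OF ag2])
          next
            \<comment> \<open>A run with a collision is given up: its trivial weight is covered by
              the summand that counts collisions, as in Markov's inequality.\<close>
            case False
            then have "1 \<le> card (collisions T (arrs s2 ''h''))" by simp
            then have "(1 :: ennreal) \<le> of_nat (card (collisions T (arrs s2 ''h'')))"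
              by (metis of_nat_1 of_nat_le_iff)
            then have "?v * 1 \<le> ?v * of_nat (card (collisions T (arrs s2 ''h'')))"
              by (intro mult_left_mono) simp_all
            then have "?v \<le> ?v * ennreal (1 / 4) + ?v * of_nat (card (collisions T (arrs s2 ''h'')))"
              by (metis add_increasing mult.right_neutral zero_le)
            then show ?thesis using trivial[OF ag2 w2] order_trans by blast
          qed
        qed (simp add: Th_def)
        also have "\<dots> \<le> ?v * ennreal (1 / 4) + ?v * ennreal (1 / 16)"
        proof (intro add_left_mono mult_left_mono)
          have "16 * real ((card T)\<^sup>2) \<le> 2 ^ ?L"
            using num_levels_large[of K] T(2) by (simp flip: of_nat_le_iff[where 'a = real])
          then have "ennreal (real ((card T)\<^sup>2) / 2 ^ ?L) \<le> ennreal (1 / 16)"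
            by (intro ennreal_leI) (simp add: field_simps)
          then show "of_nat ((card T)\<^sup>2) / 2 ^ ?L \<le> ennreal (1 / 16)"
            by (simp add: divide_ennreal[symmetric] ennreal_of_nat_eq_real_of_nat ennreal_power[symmetric])
        qed simp
        also have "\<dots> = ?v * ennreal (5 / 16)"
          by (simp flip: distrib_left ennreal_plus)
        also have "\<dots> \<le> ?v * ennreal (1 / 3)"
          by (intro mult_left_mono ennreal_leI) simp_all
        finally show ?thesis using True by simp
      qed
    qed simp
  qed (use Ti' levels_le_self[of K] in simp_all)
qed

end

section \<open>The tester\<close>

text \<open>The counting stage is charged with \<open>K = n\<close> and \<open>L = 2 n + 4\<close>,
  which makes the time independent of \<open>k\<close>.\<close>

definition tester_time :: "nat \<Rightarrow> nat \<Rightarrow> nat" where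
  "tester_time n N = (16 * (40 * n + 60) + 1) + (N * (20 * n + 60) + 1) + count_time n n (2 * n + 4) + 50"

lemma count_time_mono:
  assumes "K \<le> n"
  shows "count_time n K (num_levels K) \<le> count_time n n (2 * n + 4)"
proof -
  have "num_levels K \<le> 2 * n + 4" using levels_le_self[of K] assms by (simp add: num_levels_def)
  then show ?thesis
    unfolding count_time_def using assms by (intro add_mono mult_le_mono) simp_all
qed

lemma ennreal_power_le_third:
  assumes "0 \<le> x" "x \<le> 1" "3 \<le> real N * (1 - x)"
  shows "ennreal x ^ N \<le> ennreal (1 / 3)"
proof -
  have "x \<le> exp (- (1 - x))" using exp_ge_add_one_self[of "- (1 - x)"] by simp
  then have "x ^ N \<le> exp (- (1 - x)) ^ N" using assms by (intro power_mono) auto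
  also have "\<dots> = exp (- (real N * (1 - x)))" by (simp add: exp_of_nat_mult[symmetric] algebra_simps)
  also have "\<dots> \<le> exp (- 3)" using assms by simp
  also have "\<dots> \<le> 1 / 3"
  proof -
    have "3 \<le> exp (3 :: real)" using exp_ge_add_one_self[of 3] by simp
    then show ?thesis by (simp add: exp_minus field_simps)
  qed
  finally show ?thesis using assms by (simp add: ennreal_power ennreal_leI)
qed

lemma ennreal_power_le_one: "0 \<le> x \<Longrightarrow> x \<le> 1 \<Longrightarrow> ennreal x ^ N \<le> 1"
  by (simp add: ennreal_power power_le_one)

context access
begin

lemma k_linear_iff: "f \<in> k_linear n k \<longleftrightarrow> (\<exists>S. linear_on S \<and> card S \<le> k)"
  by (auto simp: k_linear_def linear_on_def chi_def)

text \<open>A case distinction on \<open>f\<close> alone. Either the linearity test fails often, or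
  \<open>f\<close> has a correction \<open>chi S\<close>. If \<open>S\<close> is too large, the
  third factor is small; otherwise \<open>chi S\<close> belongs to the class, so \<open>f\<close> is
  far from it and the samples from \<open>D\<close> notice.\<close>

lemma far_imp_rejection:
  assumes far: "eps_far \<epsilon> D (k_linear n k) f" and D: "set_pmf D \<subseteq> cube n"
    and N: "4 * q \<le> N * p" and pq: "0 < p" "0 < q" "real p / real q \<le> \<epsilon>"
  shows "ennreal (pmf (consistent (ucube n)) True) ^ 16 *
    (ennreal (pmf (consistent D) True) ^ N * (if many_variables (min k n) then ennreal (1 / 3) else 1)) \<le> ennreal (1 / 3)"
proof -
  let ?r1 = "ennreal (pmf (consistent (ucube n)) True) ^ 16" and ?r2 = "ennreal (pmf (consistent D) True) ^ N"
    and ?r3 = "if many_variables (min k n) then ennreal (1 / 3) else 1"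
  have le1: "?r1 \<le> 1" "?r2 \<le> 1" "?r3 \<le> 1"
    by (simp_all add: ennreal_power_le_one pmf_le_1)
  have mult_le: "a * (b * c) \<le> z" if "a \<le> 1" "b \<le> 1" "c \<le> 1" "a \<le> z \<or> b \<le> z \<or> c \<le> z" for a b c z :: ennreal
    using that mult_mono[of a 1 "b * c" z] mult_mono[of a z "b * c" 1] mult_mono[of b 1 c z] mult_mono[of b z c 1]
      mult_mono[of b 1 c 1] by auto
  have "?r1 \<le> ennreal (1 / 3) \<or> ?r2 \<le> ennreal (1 / 3) \<or> ?r3 \<le> ennreal (1 / 3)"
  proof (cases "7 / 8 \<le> pmf (consistent (ucube n)) True")
    case False
    then have "?r1 \<le> ennreal (7 / 8) ^ 16" by (intro power_mono ennreal_leI) auto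
    also have "\<dots> \<le> ennreal (1 / 3)"
      by (simp add: ennreal_power power_divide ennreal_leI)
    finally show ?thesis by blast
  next
    case True
    then obtain S where S: "S \<subseteq> {..<n}" and maj: "\<And>x. x \<in> cube n \<Longrightarrow> 3 / 4 \<le> pmf (corrected x) (chi S x)"
      using linearity_test by blast
    show ?thesis
    proof (cases "min k n < card S")
      case True
      then show ?thesis using S maj by (auto simp: many_variables_def)
    next
      case False
      then have "chi S \<in> k_linear n k" using S by (auto simp: k_linear_def chi_def)
      then have "\<epsilon> \<le> measure_pmf.prob D {x. f x \<noteq> chi S x}" using far by (simp add: eps_far_def)
      moreover have "3 / 4 * measure_pmf.prob D {x. f x \<noteq> chi S x} \<le> pmf (consistent D) False"
        using maj D by (rule inconsistent_far)
      ultimately have "3 / 4 * (real p / real q) \<le> 1 - pmf (consistent D) True"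
        using pq pmf_bool_sum[of "consistent D"] by simp
      then have "real N * (3 / 4 * (real p / real q)) \<le> real N * (1 - pmf (consistent D) True)"
        by (rule mult_left_mono) simp
      moreover have "3 \<le> real N * (3 / 4 * (real p / real q))"
      proof -
        have "real (4 * q) \<le> real (N * p)" using N by (simp only: of_nat_le_iff)
        then show ?thesis using pq by (simp add: field_simps)
      qed
      ultimately have "?r2 \<le> ennreal (1 / 3)" by (intro ennreal_power_le_third) (auto simp: pmf_le_1)
      then show ?thesis by blast
    qed
  qed
  then show ?thesis by (intro mult_le le1)
qed

text \<open>The indicator of acceptance, raised to \<open>\<infinity>\<close> on outcomes that must
  never occur: too many queries, or rejection of a member of the class.\<close>

definition verdict :: "nat \<Rightarrow> nat \<Rightarrow> state \<Rightarrow> ennreal" where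
  "verdict k Q s =
    (if queries s \<le> Q \<and> (regs s ''accept'' = 0 \<or> regs s ''accept'' = 1) \<and> (f \<in> k_linear n k \<longrightarrow> regs s ''accept'' = 1)
     then (if regs s ''accept'' = 0 then 0 else 1) else \<infinity>)"

lemma wpe_tester:
  assumes D: "set_pmf D \<subseteq> cube n" and pq: "0 < p" "p \<le> q"
    and N: "4 * q \<le> N * p" "N * p < 4 * q + p"
  shows "wpe (tester_time n N) tester (verdict k (query_total N (min k n))) (initial_state n k p q)
    \<le> ennreal (pmf (consistent (ucube n)) True) ^ 16 *
      (ennreal (pmf (consistent D) True) ^ N * (if many_variables (min k n) then ennreal (1 / 3) else 1))"
proof -
  let ?s0 = "initial_state n k p q" and ?K = "min k n"
  let ?\<psi> = "verdict k (query_total N ?K)"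
  let ?r3 = "if many_variables ?K then ennreal (1 / 3) else 1"
  let ?r2 = "ennreal (pmf (consistent D) True) ^ N"
  define Tc where "Tc = count_time n ?K (num_levels ?K)"
  define T2 where "T2 = N * (20 * n + 60) + 1"
  define T1 where "T1 = 16 * (40 * n + 60) + 1"
  have T: "T1 + (T2 + Tc + 5 + 1) + 40 \<le> tester_time n N"
    using count_time_mono[of ?K n] by (simp add: tester_time_def T1_def T2_def Tc_def)
  let ?mid = "Assign ''e'' (Var ''p'') ;; Assign ''a'' (dbl (dbl (Var ''q''))) ;; test_loop (Sample ''x'') ;; count_stage"
  define s1 where "s1 = set_reg ''a'' 16 (set_reg ''e'' 1 (set_reg ''t'' 1 (set_reg ''k'' ?K (set_reg ''accept'' 1 ?s0))))"
  have s1: "regs s1 ''n'' = n" "regs s1 ''k'' = ?K" "regs s1 ''t'' = 1" "regs s1 ''e'' = 1" "regs s1 ''a'' = 16"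
    "regs s1 ''accept'' = 1" "regs s1 ''p'' = p" "regs s1 ''q'' = q" "\<And>i. arrs s1 ''h'' i = 0" "queries s1 = 0"
    by (simp_all add: s1_def initial_state_def)
  have k: "k - (k - n) = ?K" by simp
  \<comment> \<open>Eleven steps: five assignments at two steps each, and the branch.\<close>
  have "wpe (tester_time n N) tester ?\<psi> ?s0 = wpe (tester_time n N - 11) (test_loop (random_fill ''x'') ;; ?mid) ?\<psi> s1"
  proof -
    have "regs ?s0 ''q'' = q" "regs ?s0 ''p'' = p" "regs ?s0 ''k'' = k" "regs ?s0 ''n'' = n"
      by (simp_all add: initial_state_def)
    then show ?thesis
      unfolding tester_def using T pq k by (simp add: s1_def)
  qed
  also have "\<dots> \<le> (if regs s1 ''accept'' = 0 then 0 else ennreal (pmf (consistent (ucube n)) True) ^ 16 * (?r2 * ?r3))"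
  proof (rule wpe_Seq_le[where ?T1.0 = T1 and ?T2.0 = "T2 + Tc + 5"], rule wpe_test_loop[OF sampler_random_fill])
    fix s2
    assume ag2: "agree {''i'', ''b'', ''u'', ''v'', ''d'', ''c'', ''a'', ''accept''} {''x'', ''y'', ''r''} s1 s2"
      and q2: "queries s2 = queries s1 + 16 * (0 + 3)"
      and acc2: "regs s2 ''accept'' = regs s1 ''accept'' \<or> regs s2 ''accept'' = 0"
      and ex2: "exact \<Longrightarrow> regs s2 ''accept'' = regs s1 ''accept''"
    define s3 where "s3 = set_reg ''a'' (q + q + (q + q)) (set_reg ''e'' p s2)"
    have s2: "regs s2 ''n'' = n" "regs s2 ''k'' = ?K" "regs s2 ''t'' = 1" "regs s2 ''p'' = p" "regs s2 ''q'' = q"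
      "\<And>i. arrs s2 ''h'' i = 0"
      using ag2 s1 by (simp_all add: agree_def)
    have s3: "regs s3 ''n'' = n" "regs s3 ''k'' = ?K" "regs s3 ''t'' = 1" "regs s3 ''e'' = p" "regs s3 ''a'' = 4 * q"
      "\<And>i. arrs s3 ''h'' i = 0" "queries s3 = 48" "regs s3 ''accept'' = regs s2 ''accept''"
      using s2 q2 s1 by (simp_all add: s3_def)
    have "wpe (T2 + Tc + 5) ?mid ?\<psi> s2 = wpe (T2 + Tc + 5 - 2 - 2) (test_loop (Sample ''x'') ;; count_stage) ?\<psi> s3"
      using s2 by (subst wpe_Seq_Assign, simp, subst wpe_Seq_Assign, simp) (simp add: s3_def)
    also have "\<dots> \<le> (if regs s3 ''accept'' = 0 then 0 else ?r2 * ?r3)"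
    proof (rule wpe_Seq_le[where ?T1.0 = T2 and ?T2.0 = Tc], rule wpe_test_loop[OF sampler_Sample[OF D] D])
      fix s4
      assume ag4: "agree {''i'', ''b'', ''u'', ''v'', ''d'', ''c'', ''a'', ''accept''} {''x'', ''y'', ''r''} s3 s4"
        and q4: "queries s4 = queries s3 + N * (1 + 3)"
        and acc4: "regs s4 ''accept'' = regs s3 ''accept'' \<or> regs s4 ''accept'' = 0"
        and ex4: "exact \<Longrightarrow> regs s4 ''accept'' = regs s3 ''accept''"
      have s4: "regs s4 ''n'' = n" "regs s4 ''k'' = ?K" "\<forall>i<n. arrs s4 ''h'' i = 0"
        using ag4 s3 by (simp_all add: agree_def)
      have "wpe Tc count_stage ?\<psi> s4 \<le> (if regs s4 ''accept'' = 0 then 0 else 1) * ?r3"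
      proof (rule wpe_count_stage[OF s4])
        fix s5 :: state
        assume q5: "queries s5 \<le> queries s4 + 8 * (?K + 2) * (2 * num_levels ?K + 2)"
          and acc5: "regs s5 ''accept'' = regs s4 ''accept'' \<or> regs s5 ''accept'' = 0"
          and lin5: "\<And>S. linear_on S \<Longrightarrow> card S \<le> ?K \<Longrightarrow> regs s5 ''accept'' = regs s4 ''accept''"
        have "queries s5 \<le> query_total N ?K"
          using q5 q4 s3 by (simp add: query_total_def)
        moreover have "regs s5 ''accept'' = 0 \<or> regs s5 ''accept'' = 1"
          using acc5 acc4 acc2 unfolding s3(8) s1(6) by argo
        moreover have "regs s5 ''accept'' = 1" if fk: "f \<in> k_linear n k"
        proof -
          obtain S where S: "linear_on S" "card S \<le> k" using fk k_linear_iff by blast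
          then have "card S \<le> n" using card_mono[of "{..<n}" S] by (simp add: linear_on_def)
          then have "card S \<le> ?K" using S by simp
          then have "regs s5 ''accept'' = regs s4 ''accept''" by (rule lin5[OF S(1)])
          also have "\<dots> = regs s3 ''accept''" by (rule ex4[OF linear_on_exact[OF S(1)]])
          also have "\<dots> = regs s1 ''accept''" using ex2[OF linear_on_exact[OF S(1)]] s3(8) by simp
          finally show ?thesis using s1(6) by simp
        qed
        ultimately show "?\<psi> s5 \<le> (if regs s5 ''accept'' = 0 then 0 else 1)"
          by (simp add: verdict_def)
      qed (simp add: Tc_def)
      then show "wpe Tc count_stage ?\<psi> s4 \<le> (if regs s4 ''accept'' = 0 then 0 else ?r3)"
        by (simp split: if_splits)
    qed (use s3 N pq in \<open>simp_all add: T2_def mult.commute\<close>)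
    finally show "wpe (T2 + Tc + 5) ?mid ?\<psi> s2 \<le> (if regs s2 ''accept'' = 0 then 0 else ?r2 * ?r3)"
      using s3 by simp
  qed (use s1 T in \<open>simp_all add: T1_def set_ucube\<close>)
  finally show ?thesis using s1 by simp
qed

lemma wpe_tester_trivial:
  assumes "q < p"
  shows "wpe (tester_time n 0) tester (\<lambda>s. if queries s = 0 \<and> regs s ''accept'' = 1 then 0 else \<infinity>)
    (initial_state n k p q) = 0"
  using assms by (simp add: tester_def tester_time_def initial_state_def)

text \<open>Each outcome in the support has positive probability, so a single forbidden one would
  make the expectation infinite.\<close>

lemma wpe_finite_outcome:
  assumes "wpe T c \<psi> s < \<infinity>" "cs \<in> set_pmf (run T n f D c s)"
  shows "fst cs = SKIP \<and> \<psi> (snd cs) < \<infinity>"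
proof -
  have "AE cs in measure_pmf (run T n f D c s). (if fst cs = SKIP then \<psi> (snd cs) else \<infinity>) \<noteq> \<infinity>"
    using assms(1) unfolding wpe_def by (intro nn_integral_PInf_AE) auto
  then show ?thesis using assms(2)
    by (auto simp: AE_measure_pmf_iff less_top split: if_splits)
qed

end

section \<open>Numerical bounds on time and queries\<close>

lemma tester_time_bound:
  assumes "0 < \<epsilon>" "real N \<le> 8 / \<epsilon> + 1"
  shows "real (tester_time n N) \<le> 21000 * (real n + 1 / \<epsilon> + 1) ^ 3"
proof -
  define x where "x = real n + 1 / \<epsilon> + 1"
  define y where "y = 1 / \<epsilon>"
  have "0 \<le> y" "real N \<le> 8 * y + 1" "x = real n + y + 1" using assms by (simp_all add: x_def y_def)
  then have x: "1 \<le> x" "real n \<le> x" "real N \<le> 8 * x"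
    by simp_all
  have x2: "x \<le> x\<^sup>2" and x3: "x\<^sup>2 \<le> x ^ 3"
    using x(1) self_le_power[of x 2] power_increasing[of 2 3 x] by simp_all
  have a: "real N * (20 * real n + 60) \<le> (8 * x) * (80 * x)"
    using x by (intro mult_mono) auto
  have b: "(2 * real n + 4) * (30 * real n + 40) \<le> (6 * x) * (70 * x)"
    using x by (intro mult_mono) auto
  have c: "(8 * (real n + 2)) * ((2 * real n + 10) * (20 * real n + 40)) \<le> (24 * x) * ((12 * x) * (60 * x))"
  proof (rule mult_mono)
    show "(2 * real n + 10) * (20 * real n + 40) \<le> (12 * x) * (60 * x)"
      using x by (intro mult_mono) auto
  qed (use x in simp_all)
  have "real (tester_time n N) = (640 * real n + 961) + (real N * (20 * real n + 60) + 1) + (10 * real n + 10 +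
      ((2 * real n + 4) * (30 * real n + 40) + 10) +
      ((8 * (real n + 2)) * ((2 * real n + 10) * (20 * real n + 40)) + 20) + 2) + 50"
    by (simp add: tester_time_def count_time_def algebra_simps)
  also have "\<dots> \<le> 650 * x + 1054 * x + 640 * x\<^sup>2 + 420 * x\<^sup>2 + 17280 * x ^ 3"
    using a b c x(1,2) by (simp add: power2_eq_square power3_eq_cube)
  \<comment> \<open>As \<open>x \<ge> 1\<close>, all powers are bounded by the cube, and the
    coefficients add up to 20044.\<close>
  also have "\<dots> \<le> 21000 * x ^ 3" using x2 x3 x(1) by simp
  finally show ?thesis by (simp add: x_def)
qed

text \<open>From \<open>\<epsilon> \<le> 2\<close> it follows that
  \<open>k / \<epsilon> \<ge> 1/2\<close>, so additive constants are absorbed by multiples of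
  \<open>k / \<epsilon>\<close>. The shifted logarithm is at least 1 and absorbs the constants of
  the level count.\<close>

lemma query_total_bound:
  assumes k: "1 \<le> k" "K \<le> k" and \<epsilon>: "0 < \<epsilon>" "\<epsilon> \<le> 2" and N: "real N \<le> 8 / \<epsilon> + 1"
  shows "real (query_total N K) \<le> 1200 * (real k / \<epsilon>) * log 2 (real k / \<epsilon> + 2)"
proof -
  define X where "X = real k / \<epsilon>"
  define l where "l = log 2 (X + 2)"
  have X: "1 / \<epsilon> \<le> X" "real k \<le> 2 * X" "1 / 2 \<le> X"
    using k \<epsilon> by (simp_all add: X_def field_simps)
  have l1: "1 \<le> l" using X by (simp add: l_def le_log_iff)
  have lev: "real (levels K) \<le> 2 * l + 1"
  proof (cases "levels K")
    case (Suc m)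
    then have "2 ^ m < K + 1" by (intro levels_minimal) simp
    then have "2 ^ m \<le> K" by simp
    then have "(2 :: real) ^ m \<le> real k" using k by (metis of_nat_le_iff of_nat_numeral of_nat_power order_trans)
    also have "\<dots> \<le> 2 * (X + 2)" using X by simp
    finally have "2 powr real m \<le> 2 * (X + 2)" by (simp add: powr_realpow)
    then have "real m \<le> log 2 (2 * (X + 2))" using X by (subst le_log_iff) auto
    also have "\<dots> = log 2 2 + log 2 (X + 2)" using X by (simp only: log_mult_pos)
    also have "\<dots> = 1 + l" by (simp add: l_def)
    finally show ?thesis using Suc l1 by simp
  qed (use l1 in simp)
  have "2 * real (num_levels K) + 2 \<le> 22 * l" using lev l1 by (simp add: num_levels_def)
  moreover have "8 * (real K + 2) \<le> 48 * X" using X k by simp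
  ultimately have "8 * (real K + 2) * (2 * real (num_levels K) + 2) \<le> (48 * X) * (22 * l)"
    using X l1 by (intro mult_mono[of "8 * (real K + 2)"]) auto
  moreover have "48 + 4 * real N \<le> 136 * X" using N X by simp
  moreover have "136 * X * 1 \<le> 136 * X * l" using X l1 by (intro mult_left_mono) auto
  moreover have "real (query_total N K)
      = 48 + 4 * real N + 8 * (real K + 2) * (2 * real (num_levels K) + 2)"
    by (simp add: query_total_def algebra_simps)
  moreover have "(48 * X) * (22 * l) = 1056 * (X * l)" "136 * X * l = 136 * (X * l)" "0 \<le> X * l"
    using X l1 by simp_all
  \<comment> \<open>The two parts contribute 1056 and 136.\<close>
  ultimately have "real (query_total N K) \<le> 1200 * (X * l)"
    by linarith
  then show ?thesis by (simp add: X_def l_def mult.assoc)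
qed

lemma exists_rounds:
  assumes "0 < p" "0 < (q :: nat)"
  obtains N where "4 * q \<le> N * p" "N * p < 4 * q + p"
proof
  \<comment> \<open>\<open>Suc ?d\<close> is \<open>4 q / p\<close> rounded up.\<close>
  let ?d = "(4 * q - 1) div p"
  have "?d * p + (4 * q - 1) mod p = 4 * q - 1" by simp
  moreover have "(4 * q - 1) mod p < p" using assms by simp
  ultimately show "4 * q \<le> Suc ?d * p" "Suc ?d * p < 4 * q + p"
    unfolding mult_Suc using assms by linarith+
qed

section \<open>Assembling the guarantees of the tester\<close>

context access
begin

lemma tester_correct:
  assumes D: "set_pmf D \<subseteq> cube n" and enc: "encodes \<epsilon> p q" and k: "1 \<le> k"
  shows "\<exists>t. real t \<le> 21000 * (real n + 1 / \<epsilon> + 1) ^ 3 \<and>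
    (let R = run t n f D tester (initial_state n k p q) in
      (\<forall>(c, s) \<in> set_pmf R. c = SKIP \<and>
         real (queries s) \<le> 1200 * (real k / \<epsilon>) * log 2 (real k / \<epsilon> + 2)) \<and>
      (f \<in> k_linear n k \<longrightarrow> measure_pmf.prob R accepting \<ge> 2/3) \<and>
      (eps_far \<epsilon> D (k_linear n k) f \<longrightarrow> measure_pmf.prob R rejecting \<ge> 2/3))"
proof -
  have pq: "0 < p" "0 < q" "real p / real q \<le> \<epsilon>" "\<epsilon> \<le> 2 * (real p / real q)"
    using enc by (auto simp: encodes_def)
  then have \<epsilon>: "0 < \<epsilon>" by (meson divide_pos_pos less_le_trans of_nat_0_less_iff)
  let ?Q = "1200 * (real k / \<epsilon>) * log 2 (real k / \<epsilon> + 2)"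
  show ?thesis
  proof (cases "q < p")
    case True
    define R where "R = run (tester_time n 0) n f D tester (initial_state n k p q)"
    have "wpe (tester_time n 0) tester (\<lambda>s. if queries s = 0 \<and> regs s ''accept'' = 1 then 0 else \<infinity>)
        (initial_state n k p q) < \<infinity>"
      by (simp only: wpe_tester_trivial[OF True]) simp
    then have out: "c = SKIP \<and> queries s = 0 \<and> regs s ''accept'' = 1" if "(c, s) \<in> set_pmf R" for c s
      using wpe_finite_outcome[OF _ that[unfolded R_def]] by (fastforce split: if_splits)
    have "1 \<le> real k / \<epsilon> + 2" using \<epsilon> by simp
    then have "0 \<le> log 2 (real k / \<epsilon> + 2)" by (subst zero_le_log_cancel_iff) simp_all
    then have "0 \<le> ?Q" using \<epsilon> by simp
    then have "\<forall>(c, s) \<in> set_pmf R. c = SKIP \<and> real (queries s) \<le> ?Q"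
      using out by fastforce
    moreover have "measure_pmf.prob R accepting = 1"
      using out by (subst measure_pmf.prob_eq_1) (auto simp: AE_measure_pmf_iff accepting_def)
    \<comment> \<open>Here \<open>\<epsilon> > 1\<close>, whereas the distance to the zero function,
      which lies in the class, is a probability.\<close>
    moreover have "\<not> eps_far \<epsilon> D (k_linear n k) f"
    proof
      assume "eps_far \<epsilon> D (k_linear n k) f"
      moreover have "(\<lambda>_. 0) \<in> k_linear n k" by (auto simp: k_linear_def intro: exI[of _ "{}"])
      ultimately have "\<epsilon> \<le> 1" unfolding eps_far_def by (meson measure_pmf.prob_le_1 order_trans)
      moreover have "1 < real p / real q" using True pq by simp
      ultimately show False using pq by simp
    qed
    moreover have "real (tester_time n 0) \<le> 21000 * (real n + 1 / \<epsilon> + 1) ^ 3"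
      using \<epsilon> by (intro tester_time_bound) auto
    ultimately show ?thesis unfolding R_def by (intro exI[of _ "tester_time n 0"]) (simp add: Let_def)
  next
    case False
    obtain N where N: "4 * q \<le> N * p" "N * p < 4 * q + p" using exists_rounds[OF pq(1,2)] .
    have N_le: "real N \<le> 8 / \<epsilon> + 1"
    proof -
      have "real (N * p) \<le> real (4 * q + p)" using N(2) by (simp only: of_nat_le_iff)
      then have "real N \<le> 4 * (real q / real p) + 1" using pq by (simp add: field_simps)
      moreover have "real q / real p \<le> 2 / \<epsilon>" using pq \<epsilon> by (simp add: field_simps)
      ultimately show ?thesis by simp
    qed
    have \<epsilon>2: "\<epsilon> \<le> 2"
    proof -
      have "real p / real q \<le> 1" using False pq by simp
      then show ?thesis using pq(4) by simp
    qed
    let ?s0 = "initial_state n k p q" and ?K = "min k n"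
    let ?\<psi> = "verdict k (query_total N ?K)"
    define R where "R = run (tester_time n N) n f D tester ?s0"
    have w: "wpe (tester_time n N) tester ?\<psi> ?s0 \<le> ennreal (pmf (consistent (ucube n)) True) ^ 16 *
      (ennreal (pmf (consistent D) True) ^ N * (if many_variables ?K then ennreal (1 / 3) else 1))"
      using False pq N by (intro wpe_tester[OF D]) auto
    have fin: "wpe (tester_time n N) tester ?\<psi> ?s0 < \<infinity>"
      by (rule le_less_trans[OF w]) (auto simp: ennreal_mult_less_top power_less_top_ennreal)
    have out: "c = SKIP \<and> queries s \<le> query_total N ?K \<and> (regs s ''accept'' = 0 \<or> regs s ''accept'' = 1) \<and>
        (f \<in> k_linear n k \<longrightarrow> regs s ''accept'' = 1)" if "(c, s) \<in> set_pmf R" for c s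
      using wpe_finite_outcome[OF fin that[unfolded R_def]] by (auto simp: verdict_def split: if_splits)
    have "\<forall>(c, s) \<in> set_pmf R. c = SKIP \<and> real (queries s) \<le> ?Q"
    proof (clarify, intro conjI)
      fix c s assume cs: "(c, s) \<in> set_pmf R"
      then show "c = SKIP" using out by blast
      have "real (queries s) \<le> real (query_total N ?K)" using out[OF cs] by simp
      also have "\<dots> \<le> ?Q" by (rule query_total_bound[OF k min.cobounded1 \<epsilon> \<epsilon>2 N_le])
      finally show "real (queries s) \<le> ?Q" .
    qed
    moreover have "measure_pmf.prob R accepting \<ge> 2/3" if "f \<in> k_linear n k"
    proof -
      have "measure_pmf.prob R accepting = 1"
        using out that by (subst measure_pmf.prob_eq_1) (auto simp: AE_measure_pmf_iff accepting_def)
      then show ?thesis by simp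
    qed
    moreover have "measure_pmf.prob R rejecting \<ge> 2/3" if far: "eps_far \<epsilon> D (k_linear n k) f"
    proof -
      \<comment> \<open>Runs in the support have halted with verdict 0 or 1, so outside
        \<open>rejecting\<close> the weight is exactly 1 and the expectation bounds the probability
        of acceptance.\<close>
      have "emeasure (measure_pmf R) (- rejecting) = (\<integral>\<^sup>+ cs. indicator (- rejecting) cs \<partial>measure_pmf R)"
        by simp
      also have "\<dots> \<le> wpe (tester_time n N) tester ?\<psi> ?s0"
        unfolding wpe_def R_def[symmetric]
      proof (rule nn_integral_pmf_mono)
        fix cs assume cs: "cs \<in> set_pmf R"
        obtain c s where [simp]: "cs = (c, s)" by (cases cs)
        show "indicator (- rejecting) cs \<le> (if fst cs = SKIP then ?\<psi> (snd cs) else \<infinity>)"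
          using out[of c s] cs by (auto simp: indicator_def rejecting_def verdict_def)
      qed
      also have "\<dots> \<le> ennreal (1 / 3)"
        by (rule order_trans[OF w far_imp_rejection[OF far D N(1) pq(1-3)]])
      finally have "measure_pmf.prob R (- rejecting) \<le> 1 / 3"
        by (simp add: measure_pmf.emeasure_eq_measure ennreal_le_iff)
      moreover have "measure_pmf.prob R (- rejecting) = 1 - measure_pmf.prob R rejecting"
        using measure_pmf.prob_compl[of rejecting R] by (simp add: Compl_eq_Diff_UNIV)
      ultimately show ?thesis by simp
    qed
    moreover have "real (tester_time n N) \<le> 21000 * (real n + 1 / \<epsilon> + 1) ^ 3"
      by (rule tester_time_bound[OF \<epsilon> N_le])
    ultimately show ?thesis unfolding R_def by (intro exI[of _ "tester_time n N"]) (simp add: Let_def)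
  qed
qed

end

theorem theorem7:
  shows "\<exists>P time query_bound.
    distribution_free_tester k_linear P time query_bound \<and>
    polynomial_time time \<and>
    soft_O_k_over_eps query_bound"
proof (intro exI conjI)
  let ?time = "\<lambda>n \<epsilon>. 21000 * (real n + 1 / \<epsilon> + 1) ^ 3"
  let ?Q = "\<lambda>k \<epsilon>. 1200 * (real k / \<epsilon>) * log 2 (real k / \<epsilon> + 2)"
  show "distribution_free_tester k_linear tester ?time ?Q"
    unfolding distribution_free_tester_def using access.tester_correct by blast
  show "polynomial_time ?time"
    unfolding polynomial_time_def by (intro exI[of _ 21000] exI[of _ 3]) simp
  show "soft_O_k_over_eps ?Q"
    unfolding soft_O_k_over_eps_def by (intro exI[of _ 1200] exI[of _ 1]) simp
qed

end
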